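(* Let $b>0$, $a<0$, $c<0$ with $b\le\sqrt{ac}$ and $2b<-a-c$, and let $p>0$ be rational, $p=p_1/p_2$ with $p_1,p_2$ odd and coprime. Let $\sigma$ be defined by $a+c+2b=\frac13-\sigma$. For $\epsilon\in(0,1)$ let $(z^\epsilon,w^\epsilon)\in X=H^1(\mathbb R)\times H^1(\mathbb R)$ be a minimizer of $I^\epsilon$ subject to $G=-1$ (see context). Then for any sequence $\epsilon_j\to0^+$ there are a subsequence (still denoted $\epsilon_j$), translations $y_j\in\mathbb R$, and a nontrivial $(z_0,w_0)\in X$ such that, writing again $(z^{\epsilon_j},w^{\epsilon_j})$ for the translated functions $(z^{\epsilon_j}(\cdot+y_j),w^{\epsilon_j}(\cdot+y_j))$, $$(z^{\epsilon_j},w^{\epsilon_j})\to(z_0,w_0)\ \text{ in }X,\qquad z^{\epsilon_j}-w^{\epsilon_j}\to0,\qquad\text{as }j\to\infty .$$ Moreover, $(z_0,w_0)$ is a nontrivial solution of $$z_0=w_0,\qquad w_0+\left(\tfrac13-\sigma\right)w_0''+\frac{2}{p+1}\,\mathcal J^0\,w_0^{p+1}=0 .$$ In other words, $z_0=w_0\in H^1(\mathbb R)$, with $w_0$ a (rescaled) traveling wave of the generalized Korteweg–de Vries equation.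
   Context: Since $p=p_1/p_2$ with $p_1,p_2$ odd, $s^{p+1}=|s|^{p+1}$ and $s^{p+2}=\operatorname{sgn}(s)|s|^{p+2}$ for real $s$. For $\epsilon\in(0,1)$ put $\omega=\omega(\epsilon)=\sqrt{1-\epsilon^{2/(p+1)}}$. For $(z,w)\in X$ define $$I^\epsilon(z,w)=\int_{\mathbb R}\left(\epsilon^{-\frac2{p+1}}z^2-c(z')^2+\epsilon^{-\frac2{p+1}}w^2-a(w')^2\right)dy-2\omega\int_{\mathbb R}\left(\epsilon^{-\frac2{p+1}}zw+bz'w'\right)dy,$$ $$G(z,w)=\frac2{p+1}\int_{\mathbb R}zw^{p+1}dy,\qquad \mathcal I^\epsilon=\inf\{I^\epsilon(z,w):(z,w)\in X,\ G(z,w)=-1\}.$$ $(z^\epsilon,w^\epsilon)$ denotes a minimizer: $I^\epsilon(z^\epsilon,w^\epsilon)=\mathcal I^\epsilon$, $G(z^\epsilon,w^\epsilon)=-1$. (These are the rescalings $\psi(x)=\epsilon^{1/((p+1)(p+2))}z(\epsilon^{1/(p+1)}x)$, $v(x)=\epsilon^{1/((p+1)(p+2))}w(\epsilon^{1/(p+1)}x)$ of minimizers $(\psi,v)$ of the variational problem giving traveling waves of speed $\omega$ of the generalized $abcb$-Boussinesq system.) Further, $$\mathcal J^0=\inf\left\{\int_{\mathbb R}\left(w^2+(\sigma-\tfrac13)(w')^2\right)dy:\ w\in H^1(\mathbb R),\ \frac2{p+1}\int_{\mathbb R}w^{p+2}dy=-1\right\}.$$ The generalized KdV equation is $u_t+u_x+(\frac13-\sigma)u_{xxx}+(u^{p+1})_x=0$.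 *)

theory Defs
  imports "HOL-Analysis.Analysis"
begin

text \<open>
  Elements of \<open>L\<^sup>2(\<real>)\<close> and \<open>H\<^sup>1(\<real>)\<close> are represented by Borel functions \<open>real \<Rightarrow> real\<close>;
  identities between them are to be read almost everywhere.
\<close>

definition locally_integrable :: "(real \<Rightarrow> real) \<Rightarrow> bool" where
  "locally_integrable f \<longleftrightarrow> (\<forall>l u. set_integrable lborel {l..u} f)"

definition test_function :: "(real \<Rightarrow> real) \<Rightarrow> bool" where
  "test_function \<phi> \<longleftrightarrow>
     (\<forall>n x. (deriv ^^ n) \<phi> field_differentiable at x) \<and> compact (closure {x. \<phi> x \<noteq> 0})"

definition has_weak_deriv :: "(real \<Rightarrow> real) \<Rightarrow> (real \<Rightarrow> real) \<Rightarrow> bool" where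
  "has_weak_deriv f g \<longleftrightarrow> locally_integrable f \<and> locally_integrable g \<and>
     (\<forall>\<phi>. test_function \<phi> \<longrightarrow>
        (LINT x|lborel. f x * deriv \<phi> x) = - (LINT x|lborel. g x * \<phi> x))"

text \<open>Weak derivatives are unique only up to null sets; this picks a representative.\<close>

definition weak_deriv :: "(real \<Rightarrow> real) \<Rightarrow> real \<Rightarrow> real" where
  "weak_deriv f = (SOME g. has_weak_deriv f g)"

definition L2 :: "(real \<Rightarrow> real) set" where
  "L2 = {f \<in> borel_measurable lborel. integrable lborel (\<lambda>x. (f x)\<^sup>2)}"

definition H1 :: "(real \<Rightarrow> real) set" where
  "H1 = {f \<in> L2. \<exists>g \<in> L2. has_weak_deriv f g}"

definition H1_norm :: "(real \<Rightarrow> real) \<Rightarrow> real" where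
  "H1_norm f = sqrt ((LINT x|lborel. (f x)\<^sup>2) + (LINT x|lborel. (weak_deriv f x)\<^sup>2))"

definition X :: "((real \<Rightarrow> real) \<times> (real \<Rightarrow> real)) set" where
  "X = H1 \<times> H1"

definition X_norm :: "(real \<Rightarrow> real) \<times> (real \<Rightarrow> real) \<Rightarrow> real" where
  "X_norm = (\<lambda>(z, w). sqrt ((H1_norm z)\<^sup>2 + (H1_norm w)\<^sup>2))"

definition X_tendsto ::
  "(nat \<Rightarrow> (real \<Rightarrow> real) \<times> (real \<Rightarrow> real)) \<Rightarrow> (real \<Rightarrow> real) \<times> (real \<Rightarrow> real) \<Rightarrow> bool" where
  "X_tendsto F L \<longleftrightarrow>
     (\<lambda>j. X_norm (\<lambda>x. fst (F j) x - fst L x, \<lambda>x. snd (F j) x - snd L x)) \<longlonglongrightarrow> 0"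

definition translate :: "real \<Rightarrow> (real \<Rightarrow> real) \<Rightarrow> real \<Rightarrow> real" where
  "translate y f = (\<lambda>x. f (x + y))"

text \<open>
  Throughout, \<open>p = p\<^sub>1 / p\<^sub>2\<close> with \<open>p\<^sub>1\<close>, \<open>p\<^sub>2\<close> odd, and \<open>s\<^bsup>m/p\<^sub>2\<^esup>\<close> means \<open>root p\<^sub>2 s ^ m\<close>.
  The two lemmas show that the powers below are these ones for all real \<open>s\<close>.
\<close>

definition pow_p1 :: "real \<Rightarrow> real \<Rightarrow> real" where
  "pow_p1 p s = \<bar>s\<bar> powr (p + 1)"

definition pow_p2 :: "real \<Rightarrow> real \<Rightarrow> real" where
  "pow_p2 p s = sgn s * \<bar>s\<bar> powr (p + 2)"

lemma abs_powr_frac: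
  fixes m n :: nat and s :: real
  assumes "n > 0" "m > 0"
  shows "\<bar>s\<bar> powr (real m / real n) = \<bar>root n s\<bar> ^ m"
proof (cases "s = 0")
  case True
  then show ?thesis using assms by simp
next
  case False
  then have pos: "\<bar>s\<bar> > 0" by simp
  have "\<bar>s\<bar> powr (real m / real n) = (\<bar>s\<bar> powr (1 / real n)) powr real m"
    by (simp add: powr_powr)
  also have "\<bar>s\<bar> powr (1 / real n) = root n \<bar>s\<bar>"
    using assms pos by (simp add: root_powr_inverse)
  also have "root n \<bar>s\<bar> powr real m = root n \<bar>s\<bar> ^ m"
    using assms pos by (simp add: powr_realpow)
  also have "root n \<bar>s\<bar> = \<bar>root n s\<bar>"
    using assms by (simp add: real_root_abs)
  finally show ?thesis .
qed

lemma pow_p1_eq_root: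
  fixes p1 p2 :: nat
  assumes "odd p1" "odd p2"
  shows "pow_p1 (real p1 / real p2) s = root p2 s ^ (p1 + p2)"
proof -
  have p2: "p2 > 0" using assms by (simp add: odd_pos)
  then have "real p1 / real p2 + 1 = real (p1 + p2) / real p2"
    by (simp add: field_simps)
  then have "pow_p1 (real p1 / real p2) s = \<bar>root p2 s\<bar> ^ (p1 + p2)"
    unfolding pow_p1_def using abs_powr_frac[of p2 "p1 + p2" s] p2 by simp
  also have "\<dots> = root p2 s ^ (p1 + p2)"
    using assms by (simp add: power_even_abs)
  finally show ?thesis .
qed

lemma pow_p2_eq_root:
  fixes p1 p2 :: nat
  assumes "odd p1" "odd p2"
  shows "pow_p2 (real p1 / real p2) s = root p2 s ^ (p1 + 2 * p2)"
proof -
  have p2: "p2 > 0" using assms by (simp add: odd_pos)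
  then have "real p1 / real p2 + 2 = real (p1 + 2 * p2) / real p2"
    by (simp add: field_simps)
  then have "pow_p2 (real p1 / real p2) s = sgn s * \<bar>root p2 s\<bar> ^ (p1 + 2 * p2)"
    unfolding pow_p2_def using abs_powr_frac[of p2 "p1 + 2 * p2" s] p2 by simp
  also have "sgn s = sgn (root p2 s) ^ (p1 + 2 * p2)"
    using assms p2 by (cases "s = 0"; cases "s > 0") (auto simp: sgn_if)
  also have "\<dots> * \<bar>root p2 s\<bar> ^ (p1 + 2 * p2) = root p2 s ^ (p1 + 2 * p2)"
    by (simp add: power_mult_distrib[symmetric] sgn_mult_abs)
  finally show ?thesis .
qed

definition omega :: "real \<Rightarrow> real \<Rightarrow> real" where
  "omega p \<epsilon> = sqrt (1 - \<epsilon> powr (2 / (p + 1)))"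

definition I_eps ::
  "real \<Rightarrow> real \<Rightarrow> real \<Rightarrow> real \<Rightarrow> real \<Rightarrow> (real \<Rightarrow> real) \<Rightarrow> (real \<Rightarrow> real) \<Rightarrow> real" where
  "I_eps a b c p \<epsilon> z w =
     (LINT y|lborel. \<epsilon> powr (- 2 / (p + 1)) * (z y)\<^sup>2 - c * (weak_deriv z y)\<^sup>2
                   + \<epsilon> powr (- 2 / (p + 1)) * (w y)\<^sup>2 - a * (weak_deriv w y)\<^sup>2)
     - 2 * omega p \<epsilon> *
       (LINT y|lborel. \<epsilon> powr (- 2 / (p + 1)) * (z y * w y)
                     + b * (weak_deriv z y * weak_deriv w y))"

definition G :: "real \<Rightarrow> (real \<Rightarrow> real) \<Rightarrow> (real \<Rightarrow> real) \<Rightarrow> real" where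
  "G p z w = 2 / (p + 1) * (LINT y|lborel. z y * pow_p1 p (w y))"

definition I_inf :: "real \<Rightarrow> real \<Rightarrow> real \<Rightarrow> real \<Rightarrow> real \<Rightarrow> real" where
  "I_inf a b c p \<epsilon> = Inf {I_eps a b c p \<epsilon> z w | z w. (z, w) \<in> X \<and> G p z w = - 1}"

definition is_minimizer ::
  "real \<Rightarrow> real \<Rightarrow> real \<Rightarrow> real \<Rightarrow> real \<Rightarrow> (real \<Rightarrow> real) \<Rightarrow> (real \<Rightarrow> real) \<Rightarrow> bool" where
  "is_minimizer a b c p \<epsilon> z w \<longleftrightarrow>
     (z, w) \<in> X \<and> G p z w = - 1 \<and> I_eps a b c p \<epsilon> z w = I_inf a b c p \<epsilon>"

definition J0 :: "real \<Rightarrow> real \<Rightarrow> real" where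
  "J0 \<sigma> p = Inf {LINT y|lborel. (w y)\<^sup>2 + (\<sigma> - 1 / 3) * (weak_deriv w y)\<^sup>2 | w.
     w \<in> H1 \<and> 2 / (p + 1) * (LINT y|lborel. pow_p2 p (w y)) = - 1}"

definition solves_limit_eq :: "real \<Rightarrow> real \<Rightarrow> (real \<Rightarrow> real) \<Rightarrow> bool" where
  "solves_limit_eq \<sigma> p w \<longleftrightarrow>
     (\<exists>w' w''. has_weak_deriv w w' \<and> has_weak_deriv w' w'' \<and>
        (AE x in lborel. w x + (1 / 3 - \<sigma>) * w'' x
                         + 2 / (p + 1) * J0 \<sigma> p * pow_p1 p (w x) = 0))"

text \<open>Classical solutions \<open>u t x\<close> of \<open>u\<^sub>t + u\<^sub>x + (1/3 - \<sigma>) u\<^sub>x\<^sub>x\<^sub>x + (u\<^bsup>p+1\<^esup>)\<^sub>x = 0\<close>.\<close>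

definition gKdV_solution :: "real \<Rightarrow> real \<Rightarrow> (real \<Rightarrow> real \<Rightarrow> real) \<Rightarrow> bool" where
  "gKdV_solution \<sigma> p u \<longleftrightarrow>
     (\<exists>ut ux uxx uxxx fx. \<forall>t x.
        ((\<lambda>\<tau>. u \<tau> x) has_real_derivative ut t x) (at t) \<and>
        (u t has_real_derivative ux t x) (at x) \<and>
        (ux t has_real_derivative uxx t x) (at x) \<and>
        (uxx t has_real_derivative uxxx t x) (at x) \<and>
        ((\<lambda>y. pow_p1 p (u t y)) has_real_derivative fx t x) (at x) \<and>
        ut t x + ux t x + (1 / 3 - \<sigma>) * uxxx t x + fx t x = 0)"

text \<open>
  After changing \<open>w\<close> on a null set to a (smooth) representative \<open>W\<close>, some amplitude and
  length rescaling of it is the profile of a wave travelling with positive speed \<open>s\<close>.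
\<close>

definition rescaled_gKdV_travelling_wave :: "real \<Rightarrow> real \<Rightarrow> (real \<Rightarrow> real) \<Rightarrow> bool" where
  "rescaled_gKdV_travelling_wave \<sigma> p w \<longleftrightarrow>
     (\<exists>W A \<kappa> s. (AE x in lborel. w x = W x) \<and> A > 0 \<and> \<kappa> > 0 \<and> s > 0 \<and>
        gKdV_solution \<sigma> p (\<lambda>t x. A * W (\<kappa> * (x - s * t))))"

end

theory Submission
  imports Defs "HOL-Complex_Analysis.Great_Picard" "HOL-Computational_Algebra.Polynomial"
begin

text \<open>
  Write \<open>\<delta> = \<epsilon>\<^bsup>2/(p+1)\<^esup>\<close>, \<open>\<kappa> = (1 - \<omega>)/\<delta> = 1/(1 + \<omega>)\<close>, \<open>\<gamma> = \<sigma> - 1/3\<close>. In suitable coordinates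
  \<open>z = q + \<mu> d\<close>, \<open>w = q - \<nu> d\<close> with \<open>d = z - w\<close> the functional becomes
  \<open>\<integral> d\<^sup>2/\<delta> + \<gamma> (q')\<^sup>2 + ((a c - b\<^sup>2)/\<gamma>) (d')\<^sup>2 + 2 \<kappa> z w + 2 \<kappa> \<delta> b z' w'\<close>, so that the energy bounds \<open>q\<close> in \<open>H\<^sup>1\<close>,
  \<open>d/\<surd>\<delta>\<close> and \<open>\<surd>\<delta> d'\<close> in \<open>L\<^sup>2\<close>, and \<open>d\<close> uniformly. The constraint keeps \<open>sup \<bar>q\<bar>\<close> away from \<open>0\<close>; after a
  translation \<open>q\<close> converges pointwise to some \<open>q0 \<noteq> 0\<close>. By the Euler-Lagrange equation in the direction
  \<open>(\<phi>, \<phi>)\<close> the derivatives converge as well, and \<open>q0\<close> solves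
  \<open>q0 - \<gamma> q0'' = - (2 l0/(p+1)) \<bar>q0\<bar>\<^bsup>p+1\<^esup>\<close>, where \<open>l0 \<le> J0\<close> is the limit of the minimal values. Testing with \<open>q0\<close>
  gives \<open>J(q0) = l0 \<theta>\<close> with \<open>\<theta> = - G(q0, q0)\<close>. Lower semicontinuity gives \<open>J(q0) \<le> l0\<close>, homogeneity gives
  \<open>J(q0) \<ge> l0 \<theta>\<^bsup>2/(p+2)\<^esup>\<close>; hence \<open>\<theta> = 1\<close>, no energy is lost, \<open>l0 = J0\<close>, and the convergence is strong,
  without any concentration-compactness dichotomy. Strong convergence of \<open>d'\<close> is not an energy estimate when
  \<open>a c = b\<^sup>2\<close>; it follows from the Euler-Lagrange equation in the direction \<open>d\<close>, at order \<open>\<delta>\<close>.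
\<close>

section \<open>Square-integrable functions\<close>

text \<open>The coordinates come from completing squares. As \<omega> = 1 - \<kappa>\<delta>, the
  singular part of the functional is exactly (z - w)^2/\<delta>, while -c z'^2 - a w'^2 - 2b z'w' is
  diagonal in d = z - w and q = \<nu> z + \<mu> w for \<mu> = (-a - b)/\<gamma>, \<nu> = (-c -
  b)/\<gamma>. The obstacle is compactness of derivatives: q' is bounded in L^2 only, and for d' the
  energy allows the size 1/sqrt \<delta>. In the direction (\<phi>, \<phi>) the 1/\<delta> term
  drops out of the Euler-Lagrange equation, which then bounds the derivative of the momentum P =
  \<gamma> q' + \<kappa>\<delta>b (z' + w') in L^2. Since P - \<gamma> q' tends to 0 in L^2,
  pointwise convergent subsequences of q and P are all the compactness used. Escape of mass is not
  excluded beforehand: the limits of the norms of q and P are kept as separate numbers, and equality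
  in the chain for \<theta> identifies them with the norms of the limits. Minimality is used in a
  scale invariant form, so perturbed pairs need not be brought back to the constraint and the
  multiplier comes from one-variable calculus.\<close>

definition ip :: "(real \<Rightarrow> real) \<Rightarrow> (real \<Rightarrow> real) \<Rightarrow> real" where
  "ip f g = (LINT x|lborel. f x * g x)"

definition l2 :: "(real \<Rightarrow> real) \<Rightarrow> real" where
  "l2 f = sqrt (ip f f)"

lemma L2_measurable [measurable_dest]: "f \<in> L2 \<Longrightarrow> f \<in> borel_measurable borel"
  by (simp add: L2_def)

lemma L2_square_integrable: "f \<in> L2 \<Longrightarrow> integrable lborel (\<lambda>x. f x * f x)"
  by (simp add: L2_def power2_eq_square)

lemma L2I: "f \<in> borel_measurable borel \<Longrightarrow> integrable lborel (\<lambda>x. f x * f x) \<Longrightarrow> f \<in> L2"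
  by (simp add: L2_def power2_eq_square)

lemma L2_mult_integrable:
  assumes "f \<in> L2" "g \<in> L2"
  shows "integrable lborel (\<lambda>x. f x * g x)"
proof (rule Bochner_Integration.integrable_bound)
  show "integrable lborel (\<lambda>x. f x * f x + g x * g x)"
    using assms by (intro Bochner_Integration.integrable_add L2_square_integrable)
  have [measurable]: "f \<in> borel_measurable borel" "g \<in> borel_measurable borel"
    using assms by (auto dest: L2_measurable)
  show "(\<lambda>x. f x * g x) \<in> borel_measurable lborel" by measurable
  have "\<bar>f x * g x\<bar> \<le> \<bar>f x * f x + g x * g x\<bar>" for x
  proof -
    have "0 \<le> (\<bar>f x\<bar> - \<bar>g x\<bar>)\<^sup>2" by simp
    then have "2 * \<bar>f x * g x\<bar> \<le> f x * f x + g x * g x"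
      by (simp add: power2_diff abs_mult flip: power2_eq_square)
    moreover have "0 \<le> \<bar>f x * g x\<bar>" by simp
    ultimately show ?thesis by linarith
  qed
  then show "AE x in lborel. norm (f x * g x) \<le> norm (f x * f x + g x * g x)" by simp
qed

lemma L2_dominated:
  assumes "g \<in> L2" "f \<in> borel_measurable borel" "AE x in lborel. \<bar>f x\<bar> \<le> C * \<bar>g x\<bar>"
  shows "f \<in> L2"
proof (rule L2I[OF assms(2)], rule Bochner_Integration.integrable_bound)
  show "integrable lborel (\<lambda>x. C\<^sup>2 * (g x * g x))"
    using assms by (intro integrable_mult_right L2_square_integrable)
  have [measurable]: "f \<in> borel_measurable borel" by (fact assms)
  show "(\<lambda>x. f x * f x) \<in> borel_measurable lborel" by measurable
  show "AE x in lborel. norm (f x * f x) \<le> norm (C\<^sup>2 * (g x * g x))"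
    using assms(3)
  proof eventually_elim
    case (elim x)
    then have "\<bar>f x\<bar> * \<bar>f x\<bar> \<le> (C * \<bar>g x\<bar>) * (C * \<bar>g x\<bar>)"
      by (intro mult_mono) (auto intro: order_trans[OF abs_ge_zero])
    then show ?case by (simp add: abs_mult power2_eq_square mult_ac)
  qed
qed

lemma L2_scale: "f \<in> L2 \<Longrightarrow> (\<lambda>x. c * f x) \<in> L2"
  by (rule L2_dominated[of f _ "\<bar>c\<bar>"]) (auto simp: abs_mult dest: L2_measurable)

lemma L2_add:
  assumes "f \<in> L2" "g \<in> L2"
  shows "(\<lambda>x. f x + g x) \<in> L2"
proof (rule L2I)
  have [measurable]: "f \<in> borel_measurable borel" "g \<in> borel_measurable borel"
    using assms by (auto dest: L2_measurable)
  show "(\<lambda>x. f x + g x) \<in> borel_measurable borel" by measurable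
  have "integrable lborel (\<lambda>x. f x * f x + f x * g x + (g x * f x + g x * g x))"
    using assms by (intro Bochner_Integration.integrable_add L2_mult_integrable)
  then show "integrable lborel (\<lambda>x. (f x + g x) * (f x + g x))"
    by (simp add: algebra_simps)
qed

lemma L2_uminus: "f \<in> L2 \<Longrightarrow> (\<lambda>x. - f x) \<in> L2"
  using L2_scale[of f "-1"] by simp

lemma L2_diff: "f \<in> L2 \<Longrightarrow> g \<in> L2 \<Longrightarrow> (\<lambda>x. f x - g x) \<in> L2"
  using L2_add[OF _ L2_uminus, of f g] by simp

lemma L2_zero: "(\<lambda>x. 0) \<in> L2"
  by (simp add: L2_def)

lemma L2_bounded_mult:
  assumes "f \<in> L2" "h \<in> borel_measurable borel" "\<And>x. \<bar>h x\<bar> \<le> C"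
  shows "(\<lambda>x. h x * f x) \<in> L2"
proof (rule L2_dominated[OF assms(1)])
  have [measurable]: "f \<in> borel_measurable borel" using assms(1) by (rule L2_measurable)
  have [measurable]: "h \<in> borel_measurable borel" by (fact assms)
  show "(\<lambda>x. h x * f x) \<in> borel_measurable borel" by measurable
  show "AE x in lborel. \<bar>h x * f x\<bar> \<le> C * \<bar>f x\<bar>"
    using assms(3) by (intro AE_I2) (auto simp: abs_mult intro!: mult_right_mono)
qed

lemma L2_indicator: "(indicator {a..b} :: real \<Rightarrow> real) \<in> L2"
proof (rule L2I)
  show "(indicator {a..b} :: real \<Rightarrow> real) \<in> borel_measurable borel" by measurable
  have "integrable lborel (indicator {a..b} :: real \<Rightarrow> real)"
    by (simp add: integrable_indicator_iff emeasure_lborel_Icc_eq)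
  moreover have "(\<lambda>x. indicator {a..b} x * indicator {a..b} x :: real) = indicator {a..b}"
    by (auto simp: indicator_def)
  ultimately show "integrable lborel (\<lambda>x. indicator {a..b} x * indicator {a..b} x :: real)"
    by simp
qed

lemmas L2_closed = L2_add L2_diff L2_scale L2_uminus L2_zero

lemma ip_commute: "ip f g = ip g f"
  by (simp add: ip_def mult.commute)

lemma ip_add_left: "f \<in> L2 \<Longrightarrow> g \<in> L2 \<Longrightarrow> h \<in> L2 \<Longrightarrow> ip (\<lambda>x. f x + g x) h = ip f h + ip g h"
  by (simp add: ip_def distrib_right L2_mult_integrable)

lemma ip_diff_left: "f \<in> L2 \<Longrightarrow> g \<in> L2 \<Longrightarrow> h \<in> L2 \<Longrightarrow> ip (\<lambda>x. f x - g x) h = ip f h - ip g h"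
  by (simp add: ip_def left_diff_distrib L2_mult_integrable)

lemma ip_scale_left: "ip (\<lambda>x. c * f x) h = c * ip f h"
  by (simp add: ip_def mult.assoc)

lemma ip_add_right: "f \<in> L2 \<Longrightarrow> g \<in> L2 \<Longrightarrow> h \<in> L2 \<Longrightarrow> ip h (\<lambda>x. f x + g x) = ip h f + ip h g"
  by (simp add: ip_add_left ip_commute[of h])

lemma ip_diff_right: "f \<in> L2 \<Longrightarrow> g \<in> L2 \<Longrightarrow> h \<in> L2 \<Longrightarrow> ip h (\<lambda>x. f x - g x) = ip h f - ip h g"
  by (simp add: ip_diff_left ip_commute[of h])

lemma ip_scale_right: "ip h (\<lambda>x. c * f x) = c * ip h f"
  by (simp add: ip_scale_left ip_commute[of h])

lemmas ip_linear = ip_add_left ip_diff_left ip_scale_left ip_add_right ip_diff_right ip_scale_right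

lemma ip_self_nonneg: "0 \<le> ip f f"
  by (simp add: ip_def)

lemma l2_nonneg: "0 \<le> l2 f"
  by (simp add: l2_def ip_self_nonneg)

lemma l2_sq: "(l2 f)\<^sup>2 = ip f f"
  by (simp add: l2_def ip_self_nonneg)

lemma ip_cong_AE:
  assumes "AE x in lborel. f x = f' x" "AE x in lborel. g x = g' x"
    and "f \<in> borel_measurable borel" "f' \<in> borel_measurable borel"
    and "g \<in> borel_measurable borel" "g' \<in> borel_measurable borel"
  shows "ip f g = ip f' g'"
  unfolding ip_def
proof (rule integral_cong_AE)
  have [measurable]: "f \<in> borel_measurable borel" "f' \<in> borel_measurable borel"
    "g \<in> borel_measurable borel" "g' \<in> borel_measurable borel" by fact+
  show "(\<lambda>x. f x * g x) \<in> borel_measurable lborel" "(\<lambda>x. f' x * g' x) \<in> borel_measurable lborel"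
    by measurable
  show "AE x in lborel. f x * g x = f' x * g' x"
    using assms(1,2) by eventually_elim simp
qed

lemma ip_Cauchy_Schwarz:
  assumes "f \<in> L2" "g \<in> L2"
  shows "\<bar>ip f g\<bar> \<le> l2 f * l2 g"
proof -
  have quad: "0 \<le> ip f f - 2 * t * ip f g + t\<^sup>2 * ip g g" for t
  proof -
    have "0 \<le> ip (\<lambda>x. f x - t * g x) (\<lambda>x. f x - t * g x)" by (rule ip_self_nonneg)
    also have "\<dots> = ip f f - 2 * t * ip f g + t\<^sup>2 * ip g g"
      using assms by (simp add: ip_linear L2_closed ip_commute[of g f] power2_eq_square algebra_simps)
    finally show ?thesis .
  qed
  have "(ip f g)\<^sup>2 \<le> ip f f * ip g g"
  proof (cases "ip g g = 0")
    case True
    have "ip f g = 0"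
    proof (rule ccontr)
      assume n: "ip f g \<noteq> 0"
      \<comment> \<open>When \<open>ip g g = 0\<close> the quadratic is affine in t; the t below
        gives it the value -1.\<close>
      show False
        using quad[of "(ip f f + 1) / (2 * ip f g)"] True n by simp
    qed
    then show ?thesis using True by simp
  next
    case False
    then have pos: "ip g g > 0" using ip_self_nonneg[of g] by simp
    have "0 \<le> ip f f - (ip f g)\<^sup>2 / ip g g"
      using quad[of "ip f g / ip g g"] pos by (simp add: power2_eq_square field_simps)
    then show ?thesis using pos by (simp add: field_simps)
  qed
  then have "sqrt ((ip f g)\<^sup>2) \<le> sqrt (ip f f * ip g g)" by (rule real_sqrt_le_mono)
  then show ?thesis by (simp add: l2_def real_sqrt_mult)
qed

lemma l2_triangle:
  assumes "f \<in> L2" "g \<in> L2"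
  shows "l2 (\<lambda>x. f x + g x) \<le> l2 f + l2 g"
proof (rule power2_le_imp_le)
  have "(l2 (\<lambda>x. f x + g x))\<^sup>2 = ip f f + 2 * ip f g + ip g g"
    using assms by (simp add: l2_sq ip_linear L2_closed ip_commute[of g f])
  also have "\<dots> \<le> (l2 f + l2 g)\<^sup>2"
    using ip_Cauchy_Schwarz[OF assms] by (simp add: power2_sum l2_sq abs_le_iff)
  finally show "(l2 (\<lambda>x. f x + g x))\<^sup>2 \<le> (l2 f + l2 g)\<^sup>2" .
qed (simp add: l2_nonneg)

lemma l2_scale: "l2 (\<lambda>x. c * f x) = \<bar>c\<bar> * l2 f"
  by (simp add: l2_def ip_scale_left ip_scale_right real_sqrt_mult mult.assoc[symmetric])

lemma l2_uminus: "l2 (\<lambda>x. - f x) = l2 f"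
  by (simp add: l2_def ip_def)

lemma l2_triangle_diff:
  assumes "f \<in> L2" "g \<in> L2"
  shows "l2 (\<lambda>x. f x - g x) \<le> l2 f + l2 g"
  using l2_triangle[OF assms(1) L2_uminus[OF assms(2)]] by (simp add: l2_uminus)

lemma l2_mono:
  assumes "g \<in> L2" "f \<in> borel_measurable borel" "AE x in lborel. \<bar>f x\<bar> \<le> C * \<bar>g x\<bar>" "0 \<le> C"
  shows "l2 f \<le> C * l2 g"
proof -
  have fL: "f \<in> L2" by (rule L2_dominated[OF assms(1-3)])
  have "ip f f \<le> ip (\<lambda>x. C * g x) (\<lambda>x. C * g x)"
    unfolding ip_def
  proof (rule integral_mono_AE)
    show "integrable lborel (\<lambda>x. f x * f x)" using fL by (rule L2_square_integrable)
    show "integrable lborel (\<lambda>x. C * g x * (C * g x))"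
      using L2_scale[OF assms(1)] by (rule L2_square_integrable)
    show "AE x in lborel. f x * f x \<le> C * g x * (C * g x)"
      using assms(3)
    proof eventually_elim
      case (elim x)
      then have "\<bar>f x\<bar> * \<bar>f x\<bar> \<le> (C * \<bar>g x\<bar>) * (C * \<bar>g x\<bar>)"
        by (intro mult_mono) (auto intro: order_trans[OF abs_ge_zero])
      then show ?case by (simp add: mult_ac abs_mult_self_eq flip: abs_mult)
    qed
  qed
  then have "l2 f \<le> l2 (\<lambda>x. C * g x)" unfolding l2_def by (rule real_sqrt_le_mono)
  then show ?thesis using assms(4) by (simp add: l2_scale)
qed

lemma l2_cong_AE:
  assumes "AE x in lborel. f x = f' x" "f \<in> borel_measurable borel" "f' \<in> borel_measurable borel"
  shows "l2 f = l2 f'"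
  unfolding l2_def using ip_cong_AE[of f f' f f'] assms by simp

lemma L2_cong_AE:
  assumes "f \<in> L2" "AE x in lborel. f x = f' x" "f' \<in> borel_measurable borel"
  shows "f' \<in> L2"
  by (rule L2_dominated[OF assms(1,3), of 1]) (use assms(2) in auto)

lemma L2_set_integrable:
  assumes "f \<in> L2"
  shows "set_integrable lborel {a..b} f"
  using L2_mult_integrable[OF L2_indicator assms] by (simp add: set_integrable_def)

lemma L2_locally_integrable: "f \<in> L2 \<Longrightarrow> locally_integrable f"
  by (simp add: locally_integrable_def L2_set_integrable)

section \<open>Translation invariance\<close>

lemma L2_translate: "f \<in> L2 \<Longrightarrow> (\<lambda>x. f (x + y)) \<in> L2"
proof (rule L2I)
  assume f: "f \<in> L2"
  have [measurable]: "f \<in> borel_measurable borel" using f by (rule L2_measurable)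
  show "(\<lambda>x. f (x + y)) \<in> borel_measurable borel" by measurable
  show "integrable lborel (\<lambda>x. f (x + y) * f (x + y))"
    using L2_square_integrable[OF f] lborel_integrable_real_affine_iff[of 1 "\<lambda>x. f x * f x" y]
    by (simp add: add.commute)
qed

lemma lborel_integral_translate:
  fixes f :: "real \<Rightarrow> real"
  shows "(LINT x|lborel. f (x + y)) = (LINT x|lborel. f x)"
  using lborel_integral_real_affine[of 1 f y] by (simp add: add.commute)

lemma ip_translate: "ip (\<lambda>x. f (x + y)) (\<lambda>x. g (x + y)) = ip f g"
  unfolding ip_def using lborel_integral_translate[of "\<lambda>x. f x * g x" y] by simp

lemma l2_translate: "l2 (\<lambda>x. f (x + y)) = l2 f"
  by (simp add: l2_def ip_translate)

lemma lborel_AE_translate: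
  assumes "AE x in lborel. P (x::real)"
  shows "AE x in lborel. P (x + y)"
proof -
  obtain N where N: "{x. \<not> P x} \<subseteq> N" "N \<in> sets lborel" "emeasure lborel N = 0"
    using assms by (auto elim!: AE_E)
  have "N \<in> null_sets lborel" using N by (auto simp: null_sets_def)
  then have "{x. x + y \<in> N} \<in> null_sets lborel"
    using null_sets_translation[of N "-y"] by simp
  then show ?thesis by (rule AE_I') (use N(1) in auto)
qed

section \<open>Absolutely continuous representatives\<close>

text \<open>The first function is the absolutely continuous representative of an H^1 function, the
  second any derivative of it. The integral identity holds at every pair of points, so f can be
  evaluated pointwise, whereas g matters only up to null sets. The analysis is done with such pairs;
  the choice made by \<open>weak_deriv\<close> enters only when the functionals are
  translated.\<close>

definition sob :: "(real \<Rightarrow> real) \<Rightarrow> (real \<Rightarrow> real) \<Rightarrow> bool" where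
  "sob f g \<longleftrightarrow> f \<in> L2 \<and> g \<in> L2 \<and> (\<forall>x y. x \<le> y \<longrightarrow> f y - f x = (LINT t:{x..y}|lborel. g t))"

lemma sob_L2: "sob f g \<Longrightarrow> f \<in> L2" "sob f g \<Longrightarrow> g \<in> L2"
  by (auto simp: sob_def)

lemma sob_diff_eq: "sob f g \<Longrightarrow> x \<le> y \<Longrightarrow> f y - f x = (LINT t:{x..y}|lborel. g t)"
  by (auto simp: sob_def)

lemma sob_add: "sob f f' \<Longrightarrow> sob g g' \<Longrightarrow> sob (\<lambda>x. f x + g x) (\<lambda>x. f' x + g' x)"
  unfolding sob_def
  by (auto intro!: L2_add simp: set_integral_add L2_set_integrable) (metis add_diff_add)

lemma sob_scale: "sob f f' \<Longrightarrow> sob (\<lambda>x. c * f x) (\<lambda>x. c * f' x)"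
  unfolding sob_def
  by (auto intro!: L2_scale) (metis right_diff_distrib')

lemma sob_diff: "sob f f' \<Longrightarrow> sob g g' \<Longrightarrow> sob (\<lambda>x. f x - g x) (\<lambda>x. f' x - g' x)"
  using sob_add[OF _ sob_scale[of g g' "-1"], of f f'] by simp

lemma sob_zero: "sob (\<lambda>x. 0) (\<lambda>x. 0)"
  by (simp add: sob_def L2_zero)

lemma sob_translate:
  assumes "sob f f'"
  shows "sob (\<lambda>x. f (x + y)) (\<lambda>x. f' (x + y))"
  unfolding sob_def
proof (intro conjI allI impI)
  show "(\<lambda>x. f (x + y)) \<in> L2" "(\<lambda>x. f' (x + y)) \<in> L2"
    using assms by (auto simp: sob_def L2_translate)
  fix s t :: real assume "s \<le> t"
  have "f (t + y) - f (s + y) = (LINT x|lborel. indicator {s+y..t+y} x *\<^sub>R f' x)"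
    using assms \<open>s \<le> t\<close> by (simp add: sob_def set_lebesgue_integral_def)
  also have "\<dots> = (LINT x|lborel. indicator {s+y..t+y} (x + y) *\<^sub>R f' (x + y))"
    by (rule lborel_integral_translate[symmetric])
  also have "\<dots> = (LINT x:{s..t}|lborel. f' (x + y))"
    unfolding set_lebesgue_integral_def
    by (rule Bochner_Integration.integral_cong) (auto simp: indicator_def)
  finally show "f (t + y) - f (s + y) = (LINT x:{s..t}|lborel. f' (x + y))" .
qed

section \<open>Pointwise bounds and decay of H^1 functions\<close>

lemma ip_indicator_self: "x \<le> y \<Longrightarrow> ip (indicator {x..y}) (indicator {x..y}) = y - x"
proof -
  assume "x \<le> y"
  have "(\<lambda>t. indicator {x..y} t * indicator {x..y} t :: real) = indicator {x..y}"
    by (auto simp: indicator_def)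
  then show ?thesis using \<open>x \<le> y\<close> by (simp add: ip_def)
qed

lemma set_integral_eq_ip: "(LINT t:A|lborel. g t) = ip (indicator A) g"
  by (simp add: ip_def set_lebesgue_integral_def)

text \<open>Cauchy-Schwarz against the indicator of the interval. Stated for primitives rather than
  for \<open>sob\<close>, so that it covers primitives whose square integrability is not known
  yet.\<close>

lemma antiderivative_holder:
  assumes g: "g \<in> L2" and f: "\<And>x y. x \<le> y \<Longrightarrow> f y - f x = (LINT t:{x..y}|lborel. g t)"
  shows "\<bar>f y - f x\<bar> \<le> l2 g * sqrt \<bar>y - x\<bar>"
proof -
  have *: "\<bar>f y - f x\<bar> \<le> l2 g * sqrt \<bar>y - x\<bar>" if "x \<le> y" for x y
  proof -
    have "\<bar>f y - f x\<bar> = \<bar>ip (indicator {x..y}) g\<bar>"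
      using f[OF that] by (simp add: set_integral_eq_ip)
    also have "\<dots> \<le> l2 (indicator {x..y}) * l2 g"
      by (intro ip_Cauchy_Schwarz L2_indicator g)
    also have "l2 (indicator {x..y}) = sqrt \<bar>y - x\<bar>"
      using that by (simp add: l2_def ip_indicator_self)
    finally show ?thesis by (simp add: mult.commute)
  qed
  show ?thesis using *[of x y] *[of y x] by (cases "x \<le> y") (auto simp: abs_minus_commute)
qed

lemma sob_holder:
  assumes "sob f g"
  shows "\<bar>f y - f x\<bar> \<le> l2 g * sqrt \<bar>y - x\<bar>"
  by (rule antiderivative_holder[OF sob_L2(2)[OF assms] sob_diff_eq[OF assms]])

lemma holder_isCont:
  fixes f :: "real \<Rightarrow> real"
  assumes "\<And>y. \<bar>f y - f x\<bar> \<le> C * sqrt \<bar>y - x\<bar>"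
  shows "isCont f x"
proof -
  have "((\<lambda>y. C * sqrt \<bar>y - x\<bar>) \<longlongrightarrow> C * sqrt \<bar>x - x\<bar>) (at x)"
    by (intro tendsto_intros)
  then have "((\<lambda>y. f y - f x) \<longlongrightarrow> 0) (at x)"
    by (intro Lim_null_comparison[of "\<lambda>y. f y - f x" "\<lambda>y. C * sqrt \<bar>y - x\<bar>"] always_eventually)
      (use assms in auto)
  then show ?thesis
    unfolding isCont_def by (rule LIM_zero_cancel)
qed

lemma sob_continuous: "sob f g \<Longrightarrow> isCont f x"
  by (rule holder_isCont[OF sob_holder])

text \<open>If \<open>\<bar>f x\<bar> = M\<close> then \<open>\<bar>f\<bar> \<ge> M/2\<close> on an interval of length \<open>M\<^sup>2/(4\<parallel>g\<parallel>\<^sup>2)\<close> at \<open>x\<close>, by the Hoelder bound.\<close>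
lemma sob_sup_interpolation:
  assumes "sob f g"
  shows "(f x)\<^sup>2 \<le> 4 * l2 f * l2 g"
proof -
  have fL: "f \<in> L2" using assms by (rule sob_L2)
  have key: "r * (f x)\<^sup>2 \<le> 4 * (l2 f)\<^sup>2" if r: "r > 0" "2 * l2 g * sqrt r \<le> \<bar>f x\<bar>" for r
  proof -
    have low: "indicator {x..x+r} t * ((f x)\<^sup>2 / 4) \<le> f t * f t" for t
    proof (cases "t \<in> {x..x+r}")
      case True
      then have "\<bar>f t - f x\<bar> \<le> l2 g * sqrt \<bar>t - x\<bar>" "sqrt \<bar>t - x\<bar> \<le> sqrt r"
        using sob_holder[OF assms, where x = x and y = t] by auto
      then have "\<bar>f t - f x\<bar> \<le> l2 g * sqrt r"
        by (meson mult_left_mono l2_nonneg order_trans)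
      then have "\<bar>f x\<bar> / 2 \<le> \<bar>f t\<bar>" using r(2) by linarith
      then have "(\<bar>f x\<bar> / 2)\<^sup>2 \<le> \<bar>f t\<bar>\<^sup>2" by (intro power_mono) auto
      then show ?thesis using True by (simp add: power_divide power2_eq_square)
    qed simp
    have "r * ((f x)\<^sup>2 / 4) = (LINT t|lborel. indicator {x..x+r} t * ((f x)\<^sup>2 / 4))"
      using r by simp
    also have "\<dots> \<le> ip f f"
      unfolding ip_def
    proof (rule integral_mono[OF _ L2_square_integrable[OF fL] low])
      show "integrable lborel (\<lambda>t. indicator {x..x+r} t * ((f x)\<^sup>2 / 4))"
        by (intro integrable_mult_left integrable_real_indicator) (auto simp: emeasure_lborel_Icc_eq)
    qed
    finally show ?thesis by (simp add: l2_sq)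
  qed
  show ?thesis
  proof (cases "f x = 0")
    case True
    then show ?thesis by (simp add: l2_nonneg)
  next
    case nz: False
    show ?thesis
    proof (cases "l2 g = 0")
      case True
      \<comment> \<open>With \<open>l2 g = 0\<close> every length r is allowed in
        \<open>key\<close>; this one turns it into 4 |f|^2 + 1 \<le> 4 |f|^2, a
        contradiction.\<close>
      define r where "r = (4 * (l2 f)\<^sup>2 + 1) / (f x)\<^sup>2"
      have "r > 0" unfolding r_def using nz by (intro divide_pos_pos) (auto intro: add_nonneg_pos)
      with key[of r] True have "r * (f x)\<^sup>2 \<le> 4 * (l2 f)\<^sup>2" by simp
      then show ?thesis using nz by (simp add: r_def)
    next
      case False
      then have g: "l2 g > 0" using l2_nonneg[of g] by simp
      define r where "r = (\<bar>f x\<bar> / (2 * l2 g))\<^sup>2"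
      have "r > 0" using nz g by (simp add: r_def)
      moreover have "2 * l2 g * sqrt r \<le> \<bar>f x\<bar>" using g by (simp add: r_def)
      ultimately have "r * (f x)\<^sup>2 \<le> 4 * (l2 f)\<^sup>2" by (rule key)
      then have "(f x)\<^sup>2 * (f x)\<^sup>2 \<le> 16 * ((l2 f)\<^sup>2 * (l2 g)\<^sup>2)"
        using g by (simp add: r_def power_divide power_mult_distrib field_simps)
      then have "((f x)\<^sup>2)\<^sup>2 \<le> (4 * l2 f * l2 g)\<^sup>2"
        by (simp add: power_mult_distrib power2_eq_square mult_ac)
      then show ?thesis
        by (rule power2_le_imp_le) (simp add: l2_nonneg)
    qed
  qed
qed

lemma sob_bounded:
  assumes "sob f g"
  shows "\<bar>f x\<bar> \<le> 2 * (l2 f + l2 g)"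
proof (rule power2_le_imp_le)
  have "(f x)\<^sup>2 \<le> 4 * (l2 f * l2 g)" using sob_sup_interpolation[OF assms] by (simp add: mult_ac)
  also have "\<dots> \<le> 4 * (l2 f + l2 g)\<^sup>2"
    using l2_nonneg[of f] l2_nonneg[of g] by (simp add: power2_sum)
  also have "\<dots> = (2 * (l2 f + l2 g))\<^sup>2" by (subst power_mult_distrib) simp
  finally show "\<bar>f x\<bar>\<^sup>2 \<le> (2 * (l2 f + l2 g))\<^sup>2" by simp
  show "0 \<le> 2 * (l2 f + l2 g)" by (simp add: l2_nonneg)
qed

lemma sob_C1:
  assumes "f \<in> L2" "f' \<in> L2" "\<And>x. (f has_real_derivative f' x) (at x)" "\<And>x. isCont f' x"
  shows "sob f f'"
  unfolding sob_def
proof (intro conjI allI impI assms(1,2))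
  fix x y :: real assume "x \<le> y"
  have "integral\<^sup>L lborel (\<lambda>t. indicator {x..y} t *\<^sub>R f' t) = f y - f x"
  proof (rule integral_FTC_atLeastAtMost[OF \<open>x \<le> y\<close>])
    show "(f has_vector_derivative f' t) (at t within {x..y})" for t
      using assms(3)[of t] by (simp add: has_vector_derivative_at_within has_real_derivative_iff_has_vector_derivative)
    show "continuous_on {x..y} f'" using assms(4) by (simp add: continuous_at_imp_continuous_on)
  qed
  then show "f y - f x = (LINT t:{x..y}|lborel. f' t)" by (simp add: set_lebesgue_integral_def)
qed

text \<open>Average (f x)^2 \<le> 2 (f t)^2 + 2 (f t - f x)^2 over t in a unit interval starting at
  x. The right-hand side sees f and g only on that interval, which yields decay at infinity.\<close>

lemma local_square_mean_le:
  assumes "sob f g"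
  shows "(f x)\<^sup>2 \<le> 2 * ip (\<lambda>t. indicator {x..x+1} t * f t) f + 2 * ip (\<lambda>t. indicator {x..x+1} t * g t) g"
proof -
  let ?I = "\<lambda>t. indicator {x..x+1} t :: real"
  have fL: "f \<in> L2" and gL: "g \<in> L2" using assms by (auto dest: sob_L2)
  have IfL: "(\<lambda>t. ?I t * f t) \<in> L2" and IgL: "(\<lambda>t. ?I t * g t) \<in> L2"
    using fL gL by (auto intro!: L2_bounded_mult[of _ _ 1] simp: indicator_def)
  have pt: "?I t * (f x)\<^sup>2 \<le> 2 * (?I t * f t * f t) + ?I t * (2 * ip (\<lambda>t. ?I t * g t) g)" for t
  proof (cases "t \<in> {x..x+1}")
    case True
    have "f t - f x = ip (indicator {x..t}) (\<lambda>t. ?I t * g t)"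
      using sob_diff_eq[OF assms, of x t] True unfolding set_integral_eq_ip ip_def
      by simp (rule Bochner_Integration.integral_cong, auto simp: indicator_def)
    then have "\<bar>f t - f x\<bar> \<le> l2 (indicator {x..t}) * l2 (\<lambda>t. ?I t * g t)"
      using ip_Cauchy_Schwarz[OF L2_indicator IgL] by simp
    also have "\<dots> \<le> 1 * l2 (\<lambda>t. ?I t * g t)"
      using True by (intro mult_right_mono) (auto simp: l2_def ip_indicator_self ip_self_nonneg)
    finally have "(f t - f x)\<^sup>2 \<le> (l2 (\<lambda>t. ?I t * g t))\<^sup>2"
      by (simp add: abs_le_square_iff[symmetric] l2_nonneg)
    also have "\<dots> = ip (\<lambda>t. ?I t * g t) g"
      unfolding l2_sq ip_def by (rule Bochner_Integration.integral_cong) (auto simp: indicator_def)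
    finally have A: "(f t - f x)\<^sup>2 \<le> ip (\<lambda>t. ?I t * g t) g" .
    have "0 \<le> (f x - 2 * f t)\<^sup>2" by simp
    then have "(f x)\<^sup>2 \<le> 2 * (f t * f t) + 2 * (f t - f x)\<^sup>2"
      by (simp add: power2_eq_square algebra_simps)
    then show ?thesis using A True by simp
  qed simp
  have "(f x)\<^sup>2 = (LINT t|lborel. ?I t * (f x)\<^sup>2)" by simp
  also have "\<dots> \<le> (LINT t|lborel. 2 * (?I t * f t * f t) + ?I t * (2 * ip (\<lambda>t. ?I t * g t) g))"
  proof (rule integral_mono[OF _ _ pt])
    show "integrable lborel (\<lambda>t. ?I t * (f x)\<^sup>2)"
      by (intro integrable_mult_left integrable_real_indicator) (auto simp: emeasure_lborel_Icc_eq)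
    show "integrable lborel (\<lambda>t. 2 * (?I t * f t * f t) + ?I t * (2 * ip (\<lambda>t. ?I t * g t) g))"
      by (intro Bochner_Integration.integrable_add integrable_mult_right integrable_mult_left integrable_real_indicator
          L2_mult_integrable IfL fL) (auto simp: emeasure_lborel_Icc_eq)
  qed
  also have "\<dots> = 2 * ip (\<lambda>t. ?I t * f t) f + 2 * ip (\<lambda>t. ?I t * g t) g"
  proof -
    have "integrable lborel (\<lambda>t. ?I t * (2 * ip (\<lambda>t. ?I t * g t) g))"
      by (intro integrable_mult_left integrable_real_indicator) (auto simp: emeasure_lborel_Icc_eq)
    then show ?thesis
      by (subst Bochner_Integration.integral_add)
        (use L2_mult_integrable[OF IfL fL] in \<open>auto simp: ip_def\<close>)
  qed
  finally show ?thesis .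
qed

text \<open>Dominated convergence. The sets need not be nested; each point only has to leave them
  eventually.\<close>

lemma tail_tendsto_0:
  fixes h :: "real \<Rightarrow> real" and S :: "nat \<Rightarrow> real set"
  assumes h: "integrable lborel h" and [measurable]: "\<And>n. S n \<in> sets borel"
    and ev: "\<And>x. eventually (\<lambda>n. x \<notin> S n) sequentially"
  shows "(\<lambda>n. LINT t|lborel. indicator (S n) t * h t) \<longlonglongrightarrow> 0"
proof -
  have [measurable]: "h \<in> borel_measurable borel"
    using h by (simp add: integrable_iff_bounded)
  have "(\<lambda>n. LINT t|lborel. indicator (S n) t * h t) \<longlonglongrightarrow> (LINT (t::real)|lborel. 0)"
  proof (rule Bochner_Integration.integral_dominated_convergence[where w = "\<lambda>t. \<bar>h t\<bar>"])
    show "AE x in lborel. (\<lambda>n. indicator (S n) x * h x) \<longlonglongrightarrow> 0"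
    proof (rule AE_I2)
      fix x
      show "(\<lambda>n. indicator (S n) x * h x) \<longlonglongrightarrow> 0"
        by (rule tendsto_eventually, rule eventually_mono[OF ev[of x]]) simp
    qed
    show "AE x in lborel. norm (indicator (S n) x * h x) \<le> \<bar>h x\<bar>" for n
      by (simp add: abs_mult indicator_def)
  qed (use h in auto)
  then show ?thesis by simp
qed

lemma sob_tendsto_0:
  assumes "sob f g" and ev: "\<And>x. eventually (\<lambda>n. x < u n \<or> u n + 1 < x) sequentially"
  shows "(\<lambda>n. f (u n)) \<longlonglongrightarrow> 0"
proof -
  have fL: "f \<in> L2" and gL: "g \<in> L2" using assms by (auto dest: sob_L2)
  have t: "(\<lambda>n. ip (\<lambda>t. indicator {u n..u n+1} t * h t) h) \<longlonglongrightarrow> 0" if "h \<in> L2" for h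
    unfolding ip_def mult.assoc
    by (rule tail_tendsto_0[OF L2_square_integrable[OF that]])
      (auto simp: not_le intro: ev)
  have "(\<lambda>n. 2 * ip (\<lambda>t. indicator {u n..u n+1} t * f t) f + 2 * ip (\<lambda>t. indicator {u n..u n+1} t * g t) g)
      \<longlonglongrightarrow> 2 * 0 + 2 * 0"
    by (intro tendsto_intros t fL gL)
  then have "(\<lambda>n. (f (u n))\<^sup>2) \<longlonglongrightarrow> 0"
    by (intro tendsto_sandwich[where f = "\<lambda>n. 0" and g = "\<lambda>n. (f (u n))\<^sup>2", OF _ _ tendsto_const] always_eventually)
      (use local_square_mean_le[OF assms(1)] in auto)
  then have "(\<lambda>n. sqrt ((f (u n))\<^sup>2)) \<longlonglongrightarrow> sqrt 0" by (rule tendsto_real_sqrt)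
  then have "(\<lambda>n. \<bar>f (u n)\<bar>) \<longlonglongrightarrow> 0" by simp
  then show ?thesis by (rule tendsto_rabs_zero_cancel)
qed

section \<open>Smooth test functions\<close>

definition smooth :: "(real \<Rightarrow> real) \<Rightarrow> bool" where
  "smooth f \<longleftrightarrow> (\<forall>n x. (deriv ^^ n) f field_differentiable at x)"

text \<open>Smoothness is shown by exhibiting a family of functions closed under differentiation,
  which avoids formulas for the n-th derivative.\<close>

lemma smooth_coinduct:
  assumes "f \<in> K" and K: "\<And>h. h \<in> K \<Longrightarrow> \<exists>h' \<in> K. \<forall>x. (h has_field_derivative h' x) (at x)"
  shows "smooth f"
proof -
  have step: "(\<forall>x. h field_differentiable at x) \<and> deriv h \<in> K" if "h \<in> K" for h
  proof -
    obtain h' where h': "h' \<in> K" "\<And>x. (h has_field_derivative h' x) (at x)" using K[OF \<open>h \<in> K\<close>] by blast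
    have "deriv h = h'" using h'(2) by (auto intro!: DERIV_imp_deriv)
    then show ?thesis using h' by (auto simp: field_differentiable_def)
  qed
  have "(deriv ^^ n) f \<in> K" for n
    by (induction n) (use assms(1) step in auto)
  then show ?thesis using step by (auto simp: smooth_def)
qed

lemma smooth_field_derivative:
  assumes "smooth f"
  shows "(f has_field_derivative deriv f x) (at x)"
  using assms[unfolded smooth_def, rule_format, of 0 x] by (simp add: DERIV_deriv_iff_field_differentiable)

lemma smooth_deriv: "smooth f \<Longrightarrow> smooth (deriv f)"
  unfolding smooth_def by (metis comp_apply funpow_Suc_right)

lemma smooth_isCont: "smooth f \<Longrightarrow> isCont f x"
  by (rule DERIV_isCont[OF smooth_field_derivative])

lemma smooth_integral:
  assumes "smooth f" "\<And>x. (g has_field_derivative f x) (at x)"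
  shows "smooth g"
proof (rule smooth_coinduct[of _ "insert g {f. smooth f}"])
  fix h assume "h \<in> insert g {f. smooth f}"
  then show "\<exists>h'\<in>insert g {f. smooth f}. \<forall>x. (h has_field_derivative h' x) (at x)"
  proof
    assume "h = g"
    then show ?thesis using assms by (intro bexI[of _ f]) auto
  next
    assume "h \<in> {f. smooth f}"
    then show ?thesis
      by (intro bexI[of _ "deriv h"]) (auto intro: smooth_deriv smooth_field_derivative)
  qed
qed simp

lemma smooth_affine_combination:
  assumes "smooth f" "smooth g"
  shows "smooth (\<lambda>x. f x + c * g x)"
proof (rule smooth_coinduct[of _ "{\<lambda>x. f x + c * g x | f g. smooth f \<and> smooth g}"])
  show "(\<lambda>x. f x + c * g x) \<in> {\<lambda>x. f x + c * g x | f g. smooth f \<and> smooth g}"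
    using assms by blast
  fix h assume "h \<in> {\<lambda>x. f x + c * g x | f g. smooth f \<and> smooth g}"
  then obtain f g where h: "h = (\<lambda>x. f x + c * g x)" "smooth f" "smooth g" by auto
  have "(h has_field_derivative deriv f x + c * deriv g x) (at x)" for x
    unfolding h(1) using h by (auto intro!: derivative_eq_intros smooth_field_derivative)
  then show "\<exists>h'\<in>{\<lambda>x. f x + c * g x | f g. smooth f \<and> smooth g}. \<forall>x. (h has_field_derivative h' x) (at x)"
    using h by (intro bexI[of _ "\<lambda>x. deriv f x + c * deriv g x"]) (auto intro: smooth_deriv)
qed

text \<open>Products of smooth functions are not closed under differentiation, but finite sums of
  them are, by the product rule. This is the family needed for
  \<open>smooth_coinduct\<close>.\<close>

inductive_set product_span :: "(real \<Rightarrow> real) set" where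
  prod: "smooth f \<Longrightarrow> smooth g \<Longrightarrow> (\<lambda>x. f x * g x) \<in> product_span"
| sum: "f \<in> product_span \<Longrightarrow> g \<in> product_span \<Longrightarrow> (\<lambda>x. f x + g x) \<in> product_span"

lemma smooth_mult:
  assumes "smooth f" "smooth g"
  shows "smooth (\<lambda>x. f x * g x)"
proof (rule smooth_coinduct[of _ product_span])
  show "(\<lambda>x. f x * g x) \<in> product_span" using assms by (rule product_span.prod)
  fix h assume "h \<in> product_span"
  then show "\<exists>h' \<in> product_span. \<forall>x. (h has_field_derivative h' x) (at x)"
  proof induction
    case (prod f g)
    have "(\<lambda>x. deriv f x * g x + f x * deriv g x) \<in> product_span"
      using prod by (intro product_span.intros smooth_deriv)
    moreover have "((\<lambda>x. f x * g x) has_field_derivative deriv f x * g x + f x * deriv g x) (at x)" for x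
      using prod by (auto intro!: derivative_eq_intros smooth_field_derivative)
    ultimately show ?case by (intro bexI[of _ "\<lambda>x. deriv f x * g x + f x * deriv g x"]) auto
  next
    case (sum f g)
    then obtain f' g' where "f' \<in> product_span" "g' \<in> product_span"
      "\<And>x. (f has_field_derivative f' x) (at x)" "\<And>x. (g has_field_derivative g' x) (at x)"
      by blast
    then show ?case
      by (intro bexI[of _ "\<lambda>x. f' x + g' x"]) (auto intro!: derivative_eq_intros product_span.sum)
  qed
qed

section \<open>Flat exponentials and compactly supported bumps\<close>

definition flat_exp :: "real \<Rightarrow> real poly \<Rightarrow> real \<Rightarrow> real" where
  "flat_exp a P x = (if x > 0 then poly P (1 / x) * exp (- a / x) else 0)"

lemma poly_exp_tendsto_0:
  fixes P :: "real poly"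
  assumes "a > 0"
  shows "((\<lambda>y. poly P y * exp (- a * y)) \<longlongrightarrow> 0) at_top"
proof -
  have "((\<lambda>y. coeff P i * (y ^ i * exp (- a * y))) \<longlongrightarrow> coeff P i * 0) at_top" for i
  proof (intro tendsto_intros)
    have "((\<lambda>y. (1 / a) ^ i * ((a * y) ^ i / exp (a * y))) \<longlongrightarrow> (1 / a) ^ i * 0) at_top"
      by (intro tendsto_intros filterlim_compose[OF tendsto_power_div_exp_0]
          filterlim_tendsto_pos_mult_at_top[OF tendsto_const assms filterlim_ident])
    moreover have "(1 / a) ^ i * ((a * y) ^ i / exp (a * y)) = y ^ i * exp (- a * y)" for y
      using assms by (simp add: power_mult_distrib exp_minus field_simps power_divide)
    ultimately show "((\<lambda>y. y ^ i * exp (- a * y)) \<longlongrightarrow> 0) at_top" by simp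
  qed
  then have "((\<lambda>y. \<Sum>i\<le>degree P. coeff P i * (y ^ i * exp (- a * y))) \<longlongrightarrow> (\<Sum>i\<le>degree P. coeff P i * 0)) at_top"
    by (intro tendsto_sum)
  then show ?thesis by (simp add: poly_altdef sum_distrib_right mult.assoc)
qed

text \<open>With y = 1/x, the derivative of P(y) exp (-a y) in x is y^2 (a P(y) - P'(y)) exp (-a y).
  The polynomial factor is carried along precisely to make the family closed under this operation.
  At 0 the difference quotient from the right is y P(y) exp (-a y) for y tending to
  infinity.\<close>

lemma flat_exp_derivative:
  assumes "a > 0"
  shows "(flat_exp a P has_field_derivative flat_exp a ([:0, 0, 1:] * (smult a P - pderiv P)) x) (at x)"
proof -
  let ?Q = "[:0, 0, 1:] * (smult a P - pderiv P)"
  consider "x > 0" | "x < 0" | "x = 0" by linarith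
  then show ?thesis
  proof cases
    case 1
    have "((\<lambda>x. poly P (1 / x) * exp (- a / x)) has_field_derivative flat_exp a ?Q x) (at x)"
      using 1 by (auto intro!: derivative_eq_intros DERIV_chain2[OF poly_DERIV]
          simp: flat_exp_def field_simps power2_eq_square)
    then show ?thesis
      by (rule has_field_derivative_transform_within_open[of _ _ _ "{0<..}"])
        (use 1 in \<open>auto simp: flat_exp_def\<close>)
  next
    case 2
    have "((\<lambda>x. 0) has_field_derivative flat_exp a ?Q x) (at x)" using 2 by (simp add: flat_exp_def)
    then show ?thesis
      by (rule has_field_derivative_transform_within_open[of _ _ _ "{..<0}"])
        (use 2 in \<open>auto simp: flat_exp_def\<close>)
  next
    case 3
    have lim: "((\<lambda>h. flat_exp a P h / h) \<longlongrightarrow> 0) (at_right 0)"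
    proof -
      have "((\<lambda>h. poly ([:0, 1:] * P) (inverse h) * exp (- a * inverse h)) \<longlongrightarrow> 0) (at_right 0)"
        by (rule filterlim_compose[OF poly_exp_tendsto_0[OF assms] filterlim_inverse_at_top_right])
      then show ?thesis
        by (rule Lim_transform_eventually)
          (auto simp: eventually_at_filter flat_exp_def field_simps intro!: always_eventually)
    qed
    have "((\<lambda>h. flat_exp a P h / h) \<longlongrightarrow> 0) (at_left 0)"
      by (rule Lim_transform_eventually[OF tendsto_const])
          (auto simp: eventually_at_filter flat_exp_def intro!: always_eventually)
    with lim have "((\<lambda>h. flat_exp a P h / h) \<longlongrightarrow> 0) (at 0)"
      by (simp add: filterlim_at_split)
    then show ?thesis
      using 3 by (simp add: DERIV_def flat_exp_def)
  qed
qed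

lemma smooth_flat_exp: "a > 0 \<Longrightarrow> smooth (\<lambda>x. flat_exp a P (s * x + t))"
proof -
  assume a: "a > 0"
  have "smooth (\<lambda>x. 1 * flat_exp a P (s * x + t))"
  proof (rule smooth_coinduct[of _ "{\<lambda>x. c * flat_exp a P (s * x + t) | c P. True}"])
    show "(\<lambda>x. 1 * flat_exp a P (s * x + t)) \<in> {\<lambda>x. c * flat_exp a P (s * x + t) | c P. True}" by blast
    fix h assume "h \<in> {\<lambda>x. c * flat_exp a P (s * x + t) | c P. True}"
    then obtain c P where h: "h = (\<lambda>x. c * flat_exp a P (s * x + t))" by auto
    have "(h has_field_derivative (c * s) * flat_exp a ([:0, 0, 1:] * (smult a P - pderiv P)) (s * x + t)) (at x)" for x
      unfolding h by (auto intro!: derivative_eq_intros DERIV_chain2[OF flat_exp_derivative[OF a]])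
    then show "\<exists>h'\<in>{\<lambda>x. c * flat_exp a P (s * x + t) | c P. True}. \<forall>x. (h has_field_derivative h' x) (at x)"
      by (intro bexI[of _ "\<lambda>x. (c * s) * flat_exp a ([:0, 0, 1:] * (smult a P - pderiv P)) (s * x + t)"]) blast+
  qed
  then show ?thesis by simp
qed

lemma test_functionI:
  assumes "smooth \<phi>" "\<And>x. x \<notin> {l..u} \<Longrightarrow> \<phi> x = 0"
  shows "test_function \<phi>"
  unfolding test_function_def
proof
  show "\<forall>n x. (deriv ^^ n) \<phi> field_differentiable at x" using assms(1) by (simp add: smooth_def)
  have "{x. \<phi> x \<noteq> 0} \<subseteq> {l..u}" using assms(2) by blast
  then have "bounded {x. \<phi> x \<noteq> 0}" by (rule bounded_subset[OF bounded_closed_interval])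
  then show "compact (closure {x. \<phi> x \<noteq> 0})" by (simp add: compact_closure)
qed

lemma test_function_smooth: "test_function \<phi> \<Longrightarrow> smooth \<phi>"
  by (simp add: test_function_def smooth_def)

lemma test_function_support:
  assumes "test_function \<phi>"
  obtains R where "R > 0" "\<And>x. x \<notin> {-R<..<R} \<Longrightarrow> \<phi> x = 0" "\<And>x. x \<notin> {-R<..<R} \<Longrightarrow> deriv \<phi> x = 0"
proof -
  have "bounded {x. \<phi> x \<noteq> 0}"
    using assms by (auto simp: test_function_def compact_closure)
  then obtain B where B: "\<And>x. \<phi> x \<noteq> 0 \<Longrightarrow> \<bar>x\<bar> \<le> B" unfolding bounded_iff by auto
  \<comment> \<open>The margin 1 makes \<phi> vanish near every point outside the open interval,
    including its end points, so the derivative vanishes there as well.\<close>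
  define R where "R = \<bar>B\<bar> + 1"
  have z: "\<phi> x = 0" if "x \<notin> {-R<..<R}" for x
    by (rule ccontr) (use B[of x] that in \<open>auto simp: R_def\<close>)
  have "deriv \<phi> x = 0" if "x \<notin> {-R<..<R}" for x
  proof (rule DERIV_imp_deriv)
    have "((\<lambda>x. 0) has_field_derivative 0) (at x)" by simp
    then show "(\<phi> has_field_derivative 0) (at x)"
    proof (rule has_field_derivative_transform_within_open[of _ _ _ "- {-\<bar>B\<bar>..\<bar>B\<bar>}"])
      show "x \<in> - {-\<bar>B\<bar>..\<bar>B\<bar>}" using that by (auto simp: R_def)
      show "0 = \<phi> y" if "y \<in> - {-\<bar>B\<bar>..\<bar>B\<bar>}" for y
        by (rule ccontr) (use B[of y] that in auto)
    qed auto
  qed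
  then show ?thesis using z that[of R] by (auto simp: R_def)
qed

text \<open>The parameter a serves the limit a to 0, in which the bumps converge pointwise to the
  indicator of the open interval. They take the place of mollifiers.\<close>

definition bump :: "real \<Rightarrow> real \<Rightarrow> real \<Rightarrow> real \<Rightarrow> real" where
  "bump a l u x = flat_exp a 1 (x - l) * flat_exp a 1 (u - x)"

lemma bump_eq: "bump a l u x = (if l < x \<and> x < u then exp (- a * (1 / (x - l) + 1 / (u - x))) else 0)"
  by (auto simp: bump_def flat_exp_def mult_exp_exp algebra_simps)

lemma test_function_bump:
  assumes "a > 0"
  shows "test_function (bump a l u)"
proof (rule test_functionI[of _ l u])
  have "smooth (\<lambda>x. flat_exp a 1 (1 * x + (- l)) * flat_exp a 1 ((-1) * x + u))"
    using assms by (intro smooth_mult smooth_flat_exp)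
  moreover have "(\<lambda>x. flat_exp a 1 (1 * x + (- l)) * flat_exp a 1 ((-1) * x + u)) = bump a l u"
    by (auto simp: bump_def)
  ultimately show "smooth (bump a l u)" by simp
qed (auto simp: bump_eq)

lemma bump_bounds: "a > 0 \<Longrightarrow> 0 \<le> bump a l u x" "a > 0 \<Longrightarrow> bump a l u x \<le> 1"
  by (auto simp: bump_eq intro!: add_nonneg_nonneg)

lemma bump_tendsto: "(\<lambda>n. bump (1 / real (Suc n)) l u x) \<longlonglongrightarrow> indicator {l<..<u} x"
proof (cases "l < x \<and> x < u")
  case True
  have "(\<lambda>n. exp (- (1 / real (Suc n)) * (1 / (x - l) + 1 / (u - x)))) \<longlonglongrightarrow> exp (- 0 * (1 / (x - l) + 1 / (u - x)))"
    by (intro tendsto_intros) (use LIMSEQ_inverse_real_of_nat in \<open>simp add: inverse_eq_divide\<close>)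
  then show ?thesis using True by (simp add: bump_eq)
next
  case False
  then show ?thesis by (auto simp: bump_eq)
qed

section \<open>The fundamental lemma of the calculus of variations\<close>

lemma locally_integrable_measurable:
  assumes "locally_integrable f"
  shows "f \<in> borel_measurable borel"
proof (rule borel_measurable_LIMSEQ_real)
  show "(\<lambda>n. indicator {- real n..real n} x *\<^sub>R f x) \<longlonglongrightarrow> f x" for x
  proof (rule tendsto_eventually)
    obtain N where "\<bar>x\<bar> \<le> real N" using real_arch_simple by blast
    then show "\<forall>\<^sub>F n in sequentially. indicator {- real n..real n} x *\<^sub>R f x = f x"
      by (intro eventually_sequentiallyI[of N]) (auto simp: indicator_def)
  qed
  show "(\<lambda>x. indicator {- real n..real n} x *\<^sub>R f x) \<in> borel_measurable borel" for n
  proof -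
    have "integrable lborel (\<lambda>x. indicator {- real n..real n} x *\<^sub>R f x)"
      using assms unfolding locally_integrable_def set_integrable_def by blast
    from borel_measurable_integrable[OF this] show ?thesis by simp
  qed
qed

lemma locally_integrable_mult:
  assumes "locally_integrable f" "\<And>x. isCont h x" "\<And>x. x \<notin> {-R..R} \<Longrightarrow> h x = 0"
  shows "integrable lborel (\<lambda>x. f x * h x)"
proof -
  have "compact (h ` {-R..R})"
    by (intro compact_continuous_image continuous_at_imp_continuous_on ballI assms(2)) simp
  then have "bounded (h ` {-R..R})" by (rule compact_imp_bounded)
  then obtain B where B: "\<And>x. x \<in> {-R..R} \<Longrightarrow> \<bar>h x\<bar> \<le> B"
    unfolding bounded_iff by (metis imageI real_norm_def)
  have [measurable]: "h \<in> borel_measurable borel"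
    by (intro borel_measurable_continuous_onI continuous_at_imp_continuous_on ballI assms(2))
  have [measurable]: "f \<in> borel_measurable borel" by (rule locally_integrable_measurable) fact
  show ?thesis
  proof (rule Bochner_Integration.integrable_bound)
    have "integrable lborel (\<lambda>x. indicator {-R..R} x *\<^sub>R f x)"
      using assms(1) by (simp add: locally_integrable_def set_integrable_def)
    then show "integrable lborel (\<lambda>x. B * (indicator {-R..R} x *\<^sub>R f x))" by simp
    have "\<bar>f x * h x\<bar> \<le> \<bar>B * (indicator {-R..R} x *\<^sub>R f x)\<bar>" for x
    proof (cases "x \<in> {-R..R}")
      case True
      have "\<bar>f x\<bar> * \<bar>h x\<bar> \<le> \<bar>f x\<bar> * \<bar>B\<bar>"
        using B[OF True] by (intro mult_left_mono) auto
      then show ?thesis using True by (simp add: abs_mult mult.commute)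
    next
      case False
      then show ?thesis using assms(3)[of x] by simp
    qed
    then show "AE x in lborel. norm (f x * h x) \<le> norm (B * (indicator {-R..R} x *\<^sub>R f x))" by simp
  qed measurable
qed

lemma locally_integrable_test:
  assumes "locally_integrable f" "test_function \<phi>"
  shows "integrable lborel (\<lambda>x. f x * \<phi> x)" "integrable lborel (\<lambda>x. f x * deriv \<phi> x)"
proof -
  obtain R where R: "\<And>x. x \<notin> {-R<..<R} \<Longrightarrow> \<phi> x = 0" "\<And>x. x \<notin> {-R<..<R} \<Longrightarrow> deriv \<phi> x = 0"
    using test_function_support[OF assms(2)] by metis
  note s = test_function_smooth[OF assms(2)]
  show "integrable lborel (\<lambda>x. f x * \<phi> x)"
    by (rule locally_integrable_mult[OF assms(1), of _ R]) (auto intro!: smooth_isCont s R)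
  show "integrable lborel (\<lambda>x. f x * deriv \<phi> x)"
    by (rule locally_integrable_mult[OF assms(1), of _ R]) (auto intro!: smooth_isCont smooth_deriv s R)
qed

text \<open>The bumps approximate the indicator, are bounded by 1 and supported in the same
  interval, so dominated convergence applies.\<close>

lemma integral_Ioo_eq_0:
  assumes h: "locally_integrable h" and 0: "\<And>\<phi>. test_function \<phi> \<Longrightarrow> (LINT x|lborel. h x * \<phi> x) = 0"
  shows "(LINT x|lborel. h x * indicator {l<..<u} x) = 0"
proof -
  have [measurable]: "h \<in> borel_measurable borel" using h by (rule locally_integrable_measurable)
  have t: "test_function (bump (1 / real (Suc n)) l u)" for n by (rule test_function_bump) simp
  have [measurable]: "bump (1 / real (Suc n)) l u \<in> borel_measurable borel" for n
    by (intro borel_measurable_continuous_onI continuous_at_imp_continuous_on ballI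
        smooth_isCont test_function_smooth[OF t])
  have "(\<lambda>n. LINT x|lborel. h x * bump (1 / real (Suc n)) l u x) \<longlonglongrightarrow> (LINT x|lborel. h x * indicator {l<..<u} x)"
  proof (rule Bochner_Integration.integral_dominated_convergence[where w = "\<lambda>x. \<bar>indicator {l..u} x *\<^sub>R h x\<bar>"])
    show "integrable lborel (\<lambda>x. \<bar>indicator {l..u} x *\<^sub>R h x\<bar>)"
      using h by (intro Bochner_Integration.integrable_abs) (simp add: locally_integrable_def set_integrable_def)
    show "AE x in lborel. (\<lambda>n. h x * bump (1 / real (Suc n)) l u x) \<longlonglongrightarrow> h x * indicator {l<..<u} x"
      by (intro AE_I2 tendsto_intros bump_tendsto)
    show "AE x in lborel. norm (h x * bump (1 / real (Suc n)) l u x) \<le> \<bar>indicator {l..u} x *\<^sub>R h x\<bar>" for n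
    proof (rule AE_I2)
      fix x
      show "norm (h x * bump (1 / real (Suc n)) l u x) \<le> \<bar>indicator {l..u} x *\<^sub>R h x\<bar>"
      proof (cases "x \<in> {l..u}")
        case True
        have "\<bar>h x\<bar> * \<bar>bump (1 / real (Suc n)) l u x\<bar> \<le> \<bar>h x\<bar> * 1"
          using bump_bounds[of "1 / real (Suc n)" l u x] by (intro mult_left_mono) auto
        then show ?thesis using True by (simp add: abs_mult)
      qed (auto simp: bump_eq)
    qed
  qed measurable
  then show ?thesis unfolding 0[OF t] LIMSEQ_const_iff by simp
qed

text \<open>On (-n, n) the positive and the negative part of h are densities of two measures. They
  agree on all half-lines, because h integrates to 0 over every bounded open interval, and are
  finite there; hence the measures coincide, and so do the densities almost everywhere.\<close>

lemma fundamental_lemma: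
  assumes h: "locally_integrable h" and 0: "\<And>\<phi>. test_function \<phi> \<Longrightarrow> (LINT x|lborel. h x * \<phi> x) = 0"
  shows "AE x in lborel. h x = 0"
proof -
  have [measurable]: "h \<in> borel_measurable borel" using h by (rule locally_integrable_measurable)
  have "AE x in lborel. indicator {- real n<..<real n} x * h x = 0" for n
  proof -
    define k where "k x = indicator {- real n<..<real n} x * h x" for x
    have [measurable]: "k \<in> borel_measurable borel" unfolding k_def by measurable
    have "integrable lborel (\<lambda>x. indicator {- real n<..<real n} x *\<^sub>R (indicator {- real n..real n} x *\<^sub>R h x))"
      by (rule integrable_mult_indicator) (use h in \<open>auto simp: locally_integrable_def set_integrable_def\<close>)
    then have k: "integrable lborel k"
      by (rule Bochner_Integration.integrable_cong[THEN iffD1, rotated 2]) (auto simp: k_def indicator_def)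
    have kz: "(LINT x|lborel. indicator {y<..} x * k x) = 0" for y
    proof -
      have "(LINT x|lborel. indicator {y<..} x * k x) = (LINT x|lborel. h x * indicator {max y (- real n)<..<real n} x)"
        by (rule Bochner_Integration.integral_cong) (auto simp: k_def indicator_def)
      then show ?thesis using integral_Ioo_eq_0[OF h 0] by simp
    qed
    define P where "P = density lborel (\<lambda>x. ennreal (k x))"
    define N where "N = density lborel (\<lambda>x. ennreal (- k x))"
    have part: "(\<integral>\<^sup>+x. ennreal (indicator A x * k x) \<partial>lborel) < \<infinity>"
      "(\<integral>\<^sup>+x. ennreal (- (indicator A x * k x)) \<partial>lborel) < \<infinity>"
      "integrable lborel (\<lambda>x. indicator A x * k x)" if "A \<in> sets borel" for A
    proof -
      show *: "integrable lborel (\<lambda>x. indicator A x * k x)"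
        using integrable_mult_indicator[OF _ k, of A] that by simp
      show "(\<integral>\<^sup>+x. ennreal (indicator A x * k x) \<partial>lborel) < \<infinity>"
        "(\<integral>\<^sup>+x. ennreal (- (indicator A x * k x)) \<partial>lborel) < \<infinity>"
        using * by (auto simp: real_integrable_def less_top)
    qed
    have emP: "emeasure P A = (\<integral>\<^sup>+x. ennreal (indicator A x * k x) \<partial>lborel)" if "A \<in> sets borel" for A
      unfolding P_def using that by (subst emeasure_density) (auto intro!: nn_integral_cong split: split_indicator)
    have emN: "emeasure N A = (\<integral>\<^sup>+x. ennreal (- (indicator A x * k x)) \<partial>lborel)" if "A \<in> sets borel" for A
      unfolding N_def using that by (subst emeasure_density) (auto intro!: nn_integral_cong split: split_indicator)
    have "P = N"
    proof (rule measure_eqI_lessThan)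
      show "sets P = sets borel" "sets N = sets borel" by (auto simp: P_def N_def)
      show "emeasure P {y<..} < \<infinity>" for y using part[of "{y<..}"] by (simp add: emP)
      show "emeasure P {y<..} = emeasure N {y<..}" for y
      proof -
        have "enn2real (emeasure P {y<..}) - enn2real (emeasure N {y<..}) = 0"
          using kz[of y] part[of "{y<..}"] by (simp add: emP emN real_lebesgue_integral_def)
        then show ?thesis
          using part[of "{y<..}"]
          by (metis emP emN diff_eq_eq add_0 ennreal_enn2real greaterThan_borel infinity_ennreal_def)
      qed
    qed
    then have "AE x in lborel. ennreal (k x) = ennreal (- k x)"
      unfolding P_def N_def by (intro sigma_finite_measure.density_unique_iff[OF sigma_finite_lborel, THEN iffD1]) auto
    then show ?thesis
      unfolding k_def[symmetric]
    proof eventually_elim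
      case (elim x)
      \<comment> \<open>\<open>ennreal\<close> sends negative numbers to 0, so the two values can
        agree only if both parts of \<open>k x\<close> vanish.\<close>
      then show ?case by (cases "k x \<ge> 0") (auto simp: ennreal_neg)
    qed
  qed
  then have "AE x in lborel. \<forall>n. indicator {- real n<..<real n} x * h x = 0"
    unfolding AE_all_countable by blast
  then show ?thesis
  proof eventually_elim
    case (elim x)
    obtain n where "\<bar>x\<bar> < real n" using reals_Archimedean2 by blast
    then show ?case using elim[rule_format, of n] by (auto simp: indicator_def split: if_splits)
  qed
qed

section \<open>The lemma of du Bois-Reymond\<close>

lemma continuous_antiderivative:
  fixes g :: "real \<Rightarrow> real"
  assumes "\<And>x. isCont g x"
  obtains G where "\<And>x. (G has_real_derivative g x) (at x)"
proof
  fix x :: real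
  define l u where "l = min 0 x - 1" and "u = max 0 x + 1"
  have "((\<lambda>u. LBINT y=ereal 0..ereal u. g y) has_vector_derivative g x) (at x within {l..u})"
    by (rule interval_integral_FTC2) (auto simp: l_def u_def assms continuous_at_imp_continuous_on)
  moreover have "at x within {l..u} = at x"
    by (rule at_within_interior) (auto simp: l_def u_def)
  ultimately show "((\<lambda>u. LBINT y=ereal 0..ereal u. g y) has_real_derivative g x) (at x)"
    by (simp add: has_real_derivative_iff_has_vector_derivative)
qed

lemma derivative_integral:
  assumes "x \<le> y" "\<And>t. (F has_real_derivative f t) (at t)" "\<And>t. isCont f t"
  shows "(LINT t:{x..y}|lborel. f t) = F y - F x"
proof -
  have "integral\<^sup>L lborel (\<lambda>t. indicator {x..y} t *\<^sub>R f t) = F y - F x"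
  proof (rule integral_FTC_atLeastAtMost[OF assms(1)])
    show "(F has_vector_derivative f t) (at t within {x..y})" for t
      using assms(2)[of t] by (simp add: has_vector_derivative_at_within has_real_derivative_iff_has_vector_derivative)
    show "continuous_on {x..y} f" using assms(3) by (simp add: continuous_at_imp_continuous_on)
  qed
  then show ?thesis by (simp add: set_lebesgue_integral_def)
qed

lemma integral_support:
  fixes h :: "real \<Rightarrow> real"
  assumes "\<And>x. x \<notin> {l..u} \<Longrightarrow> h x = 0"
  shows "(LINT x|lborel. h x) = (LINT x:{l..u}|lborel. h x)"
  unfolding set_lebesgue_integral_def
  by (rule Bochner_Integration.integral_cong) (use assms in \<open>auto simp: indicator_def\<close>)

lemma integral_deriv_test_function:
  assumes "test_function \<phi>"
  shows "(LINT x|lborel. deriv \<phi> x) = 0"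
proof -
  obtain R where R: "R > 0" "\<And>x. x \<notin> {-R<..<R} \<Longrightarrow> \<phi> x = 0" "\<And>x. x \<notin> {-R<..<R} \<Longrightarrow> deriv \<phi> x = 0"
    using test_function_support[OF assms] by metis
  note s = test_function_smooth[OF assms]
  have "(LINT x|lborel. deriv \<phi> x) = (LINT x:{-R..R}|lborel. deriv \<phi> x)"
    by (rule integral_support) (use R in auto)
  also have "\<dots> = \<phi> R - \<phi> (- R)"
    using R(1) by (intro derivative_integral smooth_field_derivative smooth_isCont smooth_deriv s) auto
  finally show ?thesis using R by simp
qed

text \<open>The primitive that vanishes to the left of the support equals the total integral to the
  right of it. Mean zero is therefore what makes its support compact.\<close>

lemma test_function_antiderivative:
  assumes "test_function \<phi>" "(LINT x|lborel. \<phi> x) = 0"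
  obtains \<psi> where "test_function \<psi>" "deriv \<psi> = \<phi>"
proof -
  obtain R where R: "R > 0" "\<And>x. x \<notin> {-R<..<R} \<Longrightarrow> \<phi> x = 0"
    using test_function_support[OF assms(1)] by metis
  note s = test_function_smooth[OF assms(1)]
  obtain F where F: "\<And>x. (F has_real_derivative \<phi> x) (at x)"
    using continuous_antiderivative[OF smooth_isCont[OF s]] by blast
  define \<psi> where "\<psi> x = F x - F (- R)" for x
  have \<psi>: "(\<psi> has_real_derivative \<phi> x) (at x)" for x
    unfolding \<psi>_def by (auto intro!: derivative_eq_intros F)
  have int: "F y - F x = (LINT t:{x..y}|lborel. \<phi> t)" if "x \<le> y" for x y
    using derivative_integral[OF that F smooth_isCont[OF s]] by simp
  have z: "(LINT t:{x..y}|lborel. \<phi> t) = 0" if "\<And>t. t \<in> {x..y} \<Longrightarrow> t \<notin> {-R<..<R}" for x y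
  proof -
    have "(LINT t:{x..y}|lborel. \<phi> t) = (LINT t:{x..y}|lborel. 0)"
      by (rule set_lebesgue_integral_cong) (use that R in auto)
    then show ?thesis by simp
  qed
  have FR: "F R - F (- R) = 0"
  proof -
    have "(LINT x|lborel. \<phi> x) = (LINT x:{-R..R}|lborel. \<phi> x)"
      by (rule integral_support) (use R in auto)
    then show ?thesis using int[of "-R" R] R(1) assms(2) by simp
  qed
  have "\<psi> x = 0" if "x \<notin> {-R..R}" for x
  proof (cases "x < -R")
    case True
    then show ?thesis using int[of x "-R"] z[of x "-R"] by (simp add: \<psi>_def)
  next
    case False
    then have "x > R" using that by auto
    then show ?thesis using int[of R x] z[of R x] FR by (simp add: \<psi>_def)
  qed
  then have "test_function \<psi>"
    using smooth_integral[OF s \<psi>] by (intro test_functionI[of \<psi> "-R" R]) auto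
  moreover have "deriv \<psi> = \<phi>"
    using \<psi> by (auto intro!: DERIV_imp_deriv)
  ultimately show ?thesis by (rule that)
qed

lemma locally_integrable_const: "locally_integrable (\<lambda>x. c)"
  unfolding locally_integrable_def by (auto intro!: borel_integrable_atLeastAtMost')

text \<open>Integration by parts for a function that need not be differentiable: f is written as the
  integral of g, and Fubini is applied to \<phi>'(x) g(t) on the triangle -R \<le> t \<le> x \<le>
  R. The kernel \<open>k\<close> is this product; its two iterated integrals are the two sides of
  the claim.\<close>

lemma has_weak_deriv_integral:
  assumes g: "locally_integrable g" and f: "\<And>x. isCont f x"
    and fg: "\<And>x y. x \<le> y \<Longrightarrow> f y - f x = (LINT t:{x..y}|lborel. g t)"
  shows "has_weak_deriv f g"
  unfolding has_weak_deriv_def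
proof (intro conjI allI impI)
  show fl: "locally_integrable f"
    unfolding locally_integrable_def
    by (auto intro!: borel_integrable_atLeastAtMost' continuous_at_imp_continuous_on f)
  show "locally_integrable g" by (fact g)
  fix \<phi> assume t: "test_function \<phi>"
  obtain R where R: "R > 0" "\<And>x. x \<notin> {-R<..<R} \<Longrightarrow> \<phi> x = 0" "\<And>x. x \<notin> {-R<..<R} \<Longrightarrow> deriv \<phi> x = 0"
    using test_function_support[OF t] by metis
  note s = test_function_smooth[OF t]
  have [measurable]: "g \<in> borel_measurable borel" using g by (rule locally_integrable_measurable)
  have [measurable]: "deriv \<phi> \<in> borel_measurable borel"
    by (intro borel_measurable_continuous_onI continuous_at_imp_continuous_on ballI smooth_isCont smooth_deriv s)
  define u where "u x = indicator {-R..R} x * deriv \<phi> x" for x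
  define v where "v x = indicator {-R..R} x * g x" for x
  have u: "integrable lborel u"
    using borel_integrable_atLeastAtMost'[of "-R" R "deriv \<phi>"]
    by (auto simp: u_def[abs_def] set_integrable_def intro!: continuous_at_imp_continuous_on smooth_isCont smooth_deriv s)
  have v: "integrable lborel v"
    using g by (auto simp: v_def[abs_def] locally_integrable_def set_integrable_def)
  have [measurable]: "u \<in> borel_measurable borel" "v \<in> borel_measurable borel"
    unfolding u_def v_def by measurable
  define k where "k x t = (if t \<le> x then u x * v t else 0)" for x t
  have km: "case_prod k \<in> borel_measurable (lborel \<Otimes>\<^sub>M lborel)"
    unfolding k_def by measurable
  have "integrable (lborel \<Otimes>\<^sub>M lborel) (\<lambda>(x, t). u x * v t)"
  proof (rule lborel_pair.Fubini_integrable)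
    show "(\<lambda>(x, t). u x * v t) \<in> borel_measurable (lborel \<Otimes>\<^sub>M lborel)" by measurable
    have "integrable lborel (\<lambda>x. \<bar>u x\<bar> * (LINT t|lborel. \<bar>v t\<bar>))"
      using u by (intro integrable_mult_left Bochner_Integration.integrable_abs)
    then show "integrable lborel (\<lambda>x. LINT y|lborel. norm (case (x, y) of (x, t) \<Rightarrow> u x * v t))"
      by (simp add: abs_mult)
    show "AE x in lborel. integrable lborel (\<lambda>y. case (x, y) of (x, t) \<Rightarrow> u x * v t)"
      using v by simp
  qed
  then have ki: "integrable (lborel \<Otimes>\<^sub>M lborel) (case_prod k)"
    by (rule Bochner_Integration.integrable_bound[OF _ km]) (auto simp: k_def)
  have inner1: "(LINT t|lborel. k x t) = u x * (f x - f (-R))" for x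
  proof (cases "x \<in> {-R..R}")
    case True
    have "(LINT t|lborel. k x t) = (LINT t|lborel. u x * (indicator {-R..x} t * g t))"
      by (rule Bochner_Integration.integral_cong) (use True in \<open>auto simp: k_def v_def indicator_def\<close>)
    also have "\<dots> = u x * (LINT t:{-R..x}|lborel. g t)"
      by (simp add: set_lebesgue_integral_def)
    also have "\<dots> = u x * (f x - f (-R))"
      using fg[of "-R" x] True by simp
    finally show ?thesis .
  next
    case False
    then have "u x = 0" by (simp add: u_def)
    moreover from this have "k x = (\<lambda>t. 0)" by (auto simp: k_def)
    ultimately show ?thesis by simp
  qed
  have inner2: "(LINT x|lborel. k x t) = - (g t * \<phi> t)" for t
  proof (cases "t \<in> {-R..R}")
    case True
    have "(LINT x|lborel. k x t) = (LINT x|lborel. g t * (indicator {t..R} x * deriv \<phi> x))"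
      by (rule Bochner_Integration.integral_cong) (use True in \<open>auto simp: k_def v_def u_def indicator_def\<close>)
    also have "\<dots> = g t * (LINT x:{t..R}|lborel. deriv \<phi> x)"
      by (simp add: set_lebesgue_integral_def)
    also have "\<dots> = g t * (\<phi> R - \<phi> t)"
      using True by (subst derivative_integral[of _ _ \<phi>]) (auto intro!: smooth_field_derivative smooth_isCont smooth_deriv s)
    finally show ?thesis using R(2)[of R] by simp
  next
    case False
    then have "v t = 0" "t \<notin> {-R<..<R}" by (auto simp: v_def)
    moreover from this have "(\<lambda>x. k x t) = (\<lambda>x. 0)" by (auto simp: k_def)
    ultimately show ?thesis using R(2)[of t] by simp
  qed
  \<comment> \<open>The inner integral produces f x - f (-R). The constant f (-R) may be added back
    because \<phi>' has mean zero.\<close>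
  have "(LINT x|lborel. f x * deriv \<phi> x) = (LINT x|lborel. u x * (f x - f (-R)) + f (-R) * deriv \<phi> x)"
    by (rule Bochner_Integration.integral_cong) (use R(3) in \<open>auto simp: u_def indicator_def algebra_simps\<close>)
  also have "\<dots> = (LINT x|lborel. u x * (f x - f (-R))) + f (-R) * (LINT x|lborel. deriv \<phi> x)"
  proof (subst Bochner_Integration.integral_add)
    show "integrable lborel (\<lambda>x. f (- R) * deriv \<phi> x)"
      by (rule locally_integrable_test(2)[OF locally_integrable_const t])
    show "integrable lborel (\<lambda>x. u x * (f x - f (-R)))"
      using lborel_pair.integrable_fst[OF ki] by (simp add: inner1)
  qed auto
  also have "(LINT x|lborel. u x * (f x - f (-R))) = (LINT x|lborel. LINT t|lborel. k x t)"
    by (simp add: inner1)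
  also have "\<dots> = (LINT t|lborel. LINT x|lborel. k x t)"
    using lborel_pair.Fubini_integral[OF ki] by simp
  also have "\<dots> = - (LINT t|lborel. g t * \<phi> t)" by (simp add: inner2)
  finally show "(LINT x|lborel. f x * deriv \<phi> x) = - (LINT x|lborel. g x * \<phi> x)"
    by (simp add: integral_deriv_test_function[OF t])
qed

lemma L2_antiderivative:
  assumes "g \<in> L2"
  obtains F where "\<And>x. isCont F x" "\<And>x y. x \<le> y \<Longrightarrow> F y - F x = (LINT t:{x..y}|lborel. g t)"
proof
  define F where "F x = (LBINT t=ereal 0..ereal x. g t)" for x
  have int: "interval_lebesgue_integrable lborel (ereal x) (ereal y) g" for x y
    unfolding interval_lebesgue_integrable_def
    by (auto intro!: set_integrable_subset[OF L2_set_integrable[OF assms, of "min x y" "max x y"]])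
  have F: "F y - F x = (LINT t:{x..y}|lborel. g t)" if "x \<le> y" for x y
  proof -
    have "F x + (LBINT t=ereal x..ereal y. g t) = F y"
      unfolding F_def by (rule interval_integral_sum) (simp add: int flip: ereal_min ereal_max)
    then show ?thesis using that by (simp add: interval_integral_Icc)
  qed
  then show "\<And>x y. x \<le> y \<Longrightarrow> F y - F x = (LINT t:{x..y}|lborel. g t)" .
  show "isCont F x" for x
    by (rule holder_isCont[OF antiderivative_holder[OF assms F]])
qed

lemma bump_not_AE_zero: "\<not> (AE x in lborel. bump 1 0 1 x = 0)"
proof
  assume "AE x in lborel. bump 1 0 1 x = 0"
  then obtain N where N: "N \<in> null_sets lborel" "{x. bump 1 0 1 x \<noteq> 0} \<subseteq> N"
    unfolding eventually_ae_filter by auto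
  have "{0<..<1} \<subseteq> N" using N(2) by (auto simp: bump_eq)
  then have "{0<..<1::real} \<in> null_sets lborel" by (rule null_sets_subset[OF N(1), rotated]) simp
  then show False by (simp add: null_sets_def)
qed

text \<open>Subtracting a multiple of a fixed bump \<rho> from a test function \<phi> leaves mean
  zero, hence the derivative of a test function, against which f integrates to 0. So the integral of
  f \<phi> is C times the integral of \<phi>, where C is the \<rho>-average of f.\<close>

lemma weak_deriv_0_imp_const:
  assumes f: "locally_integrable f" and 0: "\<And>\<phi>. test_function \<phi> \<Longrightarrow> (LINT x|lborel. f x * deriv \<phi> x) = 0"
  obtains C where "AE x in lborel. f x = C"
proof -
  define \<rho> where "\<rho> = bump 1 0 1"
  have \<rho>: "test_function \<rho>" unfolding \<rho>_def by (rule test_function_bump) simp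
  have int: "integrable lborel \<phi>" if "test_function \<phi>" for \<phi>
    using locally_integrable_test(1)[OF locally_integrable_const[of 1] that] by simp
  define I where "I = (LINT x|lborel. \<rho> x)"
  have "I \<noteq> 0"
    using bump_not_AE_zero integral_nonneg_eq_0_iff_AE[OF int[OF \<rho>]] bump_bounds[of 1] by (auto simp: I_def \<rho>_def)
  define C where "C = (LINT x|lborel. f x * \<rho> x) / I"
  have "AE x in lborel. f x - C = 0"
  proof (rule fundamental_lemma)
    show "locally_integrable (\<lambda>x. f x - C)"
      using f locally_integrable_const[of C] unfolding locally_integrable_def by (auto intro: set_integral_diff)
    fix \<phi> assume \<phi>: "test_function \<phi>"
    define J where "J = (LINT x|lborel. \<phi> x)"
    define \<theta> where "\<theta> x = \<phi> x + (- J / I) * \<rho> x" for x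
    have \<theta>: "test_function \<theta>"
    proof -
      obtain R1 where R1: "\<And>x. x \<notin> {-R1<..<R1} \<Longrightarrow> \<phi> x = 0" using test_function_support[OF \<phi>] by metis
      have "\<theta> x = 0" if "x \<notin> {min (-R1) 0..max R1 1}" for x
      proof -
        have "\<phi> x = 0" by (rule R1) (use that in auto)
        moreover have "\<rho> x = 0" unfolding \<rho>_def bump_eq using that by auto
        ultimately show ?thesis by (simp add: \<theta>_def)
      qed
      moreover have "smooth \<theta>" unfolding \<theta>_def
        by (intro smooth_affine_combination test_function_smooth \<phi> \<rho>)
      ultimately show ?thesis by (intro test_functionI)
    qed
    have "(LINT x|lborel. \<theta> x) = J + (- J / I) * I"
      unfolding \<theta>_def J_def I_def using int[OF \<phi>] int[OF \<rho>]
      by (subst Bochner_Integration.integral_add) auto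
    then have "(LINT x|lborel. \<theta> x) = 0" using \<open>I \<noteq> 0\<close> by simp
    then obtain \<psi> where "test_function \<psi>" "deriv \<psi> = \<theta>" using test_function_antiderivative[OF \<theta>] by blast
    then have "(LINT x|lborel. f x * \<theta> x) = 0" using 0[of \<psi>] by simp
    moreover have "(LINT x|lborel. f x * \<theta> x) = (LINT x|lborel. f x * \<phi> x + (- J / I) * (f x * \<rho> x))"
      by (simp add: \<theta>_def algebra_simps)
    moreover have "\<dots> = (LINT x|lborel. f x * \<phi> x) + (- J / I) * (LINT x|lborel. f x * \<rho> x)"
      using locally_integrable_test(1)[OF f \<phi>] locally_integrable_test(1)[OF f \<rho>]
      by (subst Bochner_Integration.integral_add) auto
    ultimately have "(LINT x|lborel. f x * \<phi> x) = C * J" by (simp add: C_def)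
    moreover have "(LINT x|lborel. (f x - C) * \<phi> x) = (LINT x|lborel. f x * \<phi> x) - C * J"
      unfolding J_def left_diff_distrib using locally_integrable_test(1)[OF f \<phi>] int[OF \<phi>]
      by (subst Bochner_Integration.integral_diff) auto
    ultimately show "(LINT x|lborel. (f x - C) * \<phi> x) = 0" by simp
  qed
  then show ?thesis by (intro that[of C]) auto
qed

lemma has_weak_deriv_unique:
  assumes "has_weak_deriv f g" "has_weak_deriv f h"
  shows "AE x in lborel. g x = h x"
proof -
  have gl: "locally_integrable g" and hl: "locally_integrable h" using assms by (auto simp: has_weak_deriv_def)
  have "AE x in lborel. g x - h x = 0"
  proof (rule fundamental_lemma)
    show "locally_integrable (\<lambda>x. g x - h x)"
      using gl hl unfolding locally_integrable_def by (auto intro: set_integral_diff)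
    fix \<phi> assume \<phi>: "test_function \<phi>"
    have "(LINT x|lborel. (g x - h x) * \<phi> x) = (LINT x|lborel. g x * \<phi> x) - (LINT x|lborel. h x * \<phi> x)"
      unfolding left_diff_distrib using locally_integrable_test(1)[OF gl \<phi>] locally_integrable_test(1)[OF hl \<phi>]
      by (subst Bochner_Integration.integral_diff) auto
    moreover have "- (LINT x|lborel. g x * \<phi> x) = - (LINT x|lborel. h x * \<phi> x)"
      using assms \<phi> unfolding has_weak_deriv_def by auto
    ultimately show "(LINT x|lborel. (g x - h x) * \<phi> x) = 0" by linarith
  qed
  then show ?thesis by simp
qed

lemma sob_imp_has_weak_deriv: "sob f g \<Longrightarrow> has_weak_deriv f g"
  by (rule has_weak_deriv_integral[OF L2_locally_integrable[OF sob_L2(2)] sob_continuous sob_diff_eq])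

text \<open>f and a primitive of g have the same weak derivative, so they differ by a constant
  almost everywhere; F absorbs that constant.\<close>

lemma has_weak_deriv_imp_antiderivative:
  assumes "has_weak_deriv f g" "g \<in> L2"
  obtains F where "\<And>x. isCont F x" "\<And>x y. x \<le> y \<Longrightarrow> F y - F x = (LINT t:{x..y}|lborel. g t)"
    "AE x in lborel. f x = F x"
proof -
  obtain G where G: "\<And>x. isCont G x" "\<And>x y. x \<le> y \<Longrightarrow> G y - G x = (LINT t:{x..y}|lborel. g t)"
    using L2_antiderivative[OF assms(2)] by blast
  have Gw: "has_weak_deriv G g"
    by (intro has_weak_deriv_integral L2_locally_integrable assms G)
  have fl: "locally_integrable f" and Gl: "locally_integrable G" using assms Gw by (auto simp: has_weak_deriv_def)
  have "\<exists>C. AE x in lborel. f x - G x = C"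
  proof (rule weak_deriv_0_imp_const[of "\<lambda>x. f x - G x"])
    show "locally_integrable (\<lambda>x. f x - G x)"
      using fl Gl unfolding locally_integrable_def by (auto intro: set_integral_diff)
    fix \<phi> assume \<phi>: "test_function \<phi>"
    have "(LINT x|lborel. (f x - G x) * deriv \<phi> x) = (LINT x|lborel. f x * deriv \<phi> x) - (LINT x|lborel. G x * deriv \<phi> x)"
      unfolding left_diff_distrib using locally_integrable_test(2)[OF fl \<phi>] locally_integrable_test(2)[OF Gl \<phi>]
      by (subst Bochner_Integration.integral_diff) auto
    then show "(LINT x|lborel. (f x - G x) * deriv \<phi> x) = 0"
      using assms(1) Gw \<phi> unfolding has_weak_deriv_def by simp
  qed blast
  then obtain C where C: "AE x in lborel. f x - G x = C" by blast
  show ?thesis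
  proof (rule that[of "\<lambda>x. G x + C"])
    show "isCont (\<lambda>x. G x + C) x" for x by (intro continuous_intros G)
    show "AE x in lborel. f x = G x + C" using C by eventually_elim simp
  qed (use G in auto)
qed

lemma has_weak_deriv_cong_AE:
  assumes "has_weak_deriv f g" "AE x in lborel. f x = f' x" "f' \<in> borel_measurable borel"
  shows "has_weak_deriv f' g"
proof -
  have [measurable]: "f \<in> borel_measurable borel" "f' \<in> borel_measurable borel"
    using assms by (auto simp: has_weak_deriv_def intro: locally_integrable_measurable)
  have "locally_integrable f'"
    unfolding locally_integrable_def set_integrable_def
  proof (intro allI)
    fix l u :: real
    have "integrable lborel (\<lambda>x. indicator {l..u} x *\<^sub>R f x)"
      using assms(1) by (auto simp: has_weak_deriv_def locally_integrable_def set_integrable_def)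
    then show "integrable lborel (\<lambda>x. indicator {l..u} x *\<^sub>R f' x)"
      by (rule integrable_cong_AE_imp) (use assms(2) in auto)
  qed
  moreover have "(LINT x|lborel. f' x * deriv \<phi> x) = (LINT x|lborel. f x * deriv \<phi> x)" if "test_function \<phi>" for \<phi>
  proof (rule integral_cong_AE)
    have [measurable]: "deriv \<phi> \<in> borel_measurable borel"
      by (intro borel_measurable_continuous_onI continuous_at_imp_continuous_on ballI smooth_isCont smooth_deriv
          test_function_smooth that)
    show "(\<lambda>x. f' x * deriv \<phi> x) \<in> borel_measurable lborel" "(\<lambda>x. f x * deriv \<phi> x) \<in> borel_measurable lborel"
      by measurable
    show "AE x in lborel. f' x * deriv \<phi> x = f x * deriv \<phi> x"
      using assms(2) by eventually_elim simp
  qed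
  ultimately show ?thesis using assms(1) unfolding has_weak_deriv_def by simp
qed

section \<open>Passing between \<open>H1\<close> with \<open>weak_deriv\<close> and pairs in
  \<open>sob\<close>\<close>

lemma sob_imp_H1:
  assumes "sob F g" "f \<in> borel_measurable borel" "AE x in lborel. f x = F x"
  shows "f \<in> H1" "AE x in lborel. weak_deriv f x = g x" "weak_deriv f \<in> borel_measurable borel"
proof -
  have "has_weak_deriv F g" using assms(1) by (rule sob_imp_has_weak_deriv)
  then have w: "has_weak_deriv f g"
    by (rule has_weak_deriv_cong_AE) (use assms in auto)
  have "f \<in> L2"
    by (rule L2_cong_AE[OF sob_L2(1)[OF assms(1)]]) (use assms in auto)
  then show "f \<in> H1" using w sob_L2(2)[OF assms(1)] by (auto simp: H1_def)
  \<comment> \<open>\<open>weak_deriv\<close> is an arbitrary choice. The witness g shows that it is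
    a weak derivative, and uniqueness then identifies it with g off a null set.\<close>
  have d: "has_weak_deriv f (weak_deriv f)" unfolding weak_deriv_def by (rule someI[of _ g]) fact
  then show "AE x in lborel. weak_deriv f x = g x" using w by (rule has_weak_deriv_unique)
  show "weak_deriv f \<in> borel_measurable borel"
    using d by (auto simp: has_weak_deriv_def intro: locally_integrable_measurable)
qed

lemma H1_imp_sob:
  assumes "f \<in> H1"
  obtains F g where "sob F g" "AE x in lborel. f x = F x" "f \<in> borel_measurable borel"
proof -
  obtain g where g: "f \<in> L2" "g \<in> L2" "has_weak_deriv f g" using assms by (auto simp: H1_def)
  obtain F where F: "\<And>x. isCont F x" "\<And>x y. x \<le> y \<Longrightarrow> F y - F x = (LINT t:{x..y}|lborel. g t)"
    "AE x in lborel. f x = F x" using has_weak_deriv_imp_antiderivative[OF g(3,2)] by blast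
  have "F \<in> borel_measurable borel"
    by (intro borel_measurable_continuous_onI continuous_at_imp_continuous_on ballI F)
  then have "F \<in> L2" by (rule L2_cong_AE[OF g(1) F(3)])
  then have "sob F g" using g F by (auto simp: sob_def)
  then show ?thesis using F(3) g(1) by (intro that) (auto dest: L2_measurable)
qed

lemma sob_test_function:
  assumes "test_function \<phi>"
  shows "sob \<phi> (deriv \<phi>)"
proof -
  note s = test_function_smooth[OF assms]
  have m: "f \<in> borel_measurable borel" if "smooth f" for f
    using that by (intro borel_measurable_continuous_onI continuous_at_imp_continuous_on ballI smooth_isCont)
  have li: "locally_integrable f" if "smooth f" for f
    unfolding locally_integrable_def
    using that by (auto intro!: borel_integrable_atLeastAtMost' continuous_at_imp_continuous_on smooth_isCont)
  obtain R where R: "\<And>x. x \<notin> {-R<..<R} \<Longrightarrow> \<phi> x = 0" "\<And>x. x \<notin> {-R<..<R} \<Longrightarrow> deriv \<phi> x = 0"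
    using test_function_support[OF assms] by metis
  have L: "f \<in> L2" if "smooth f" "\<And>x. x \<notin> {-R<..<R} \<Longrightarrow> f x = 0" for f
    by (intro L2I m locally_integrable_mult[of _ _ R] li smooth_isCont that) auto
  have "\<phi> \<in> L2" "deriv \<phi> \<in> L2"
    using R by (auto intro!: L s smooth_deriv)
  then show ?thesis
    by (intro sob_C1 smooth_field_derivative smooth_isCont smooth_deriv s)
qed

section \<open>The nonlinearity\<close>

text \<open>For p a quotient of odd numbers this is the real power s^p, an odd function. With it
  |s|^(p+1) = s s^p, and (p + 1) s^p is the derivative.\<close>

definition pow_p :: "real \<Rightarrow> real \<Rightarrow> real" where
  "pow_p p s = sgn s * \<bar>s\<bar> powr p"

lemma pow_p1_eq: "pow_p1 p s = s * pow_p p s"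
proof (cases "s = 0")
  case False
  then show ?thesis
    by (simp add: pow_p1_def pow_p_def powr_add sgn_mult_abs mult.assoc[symmetric] abs_sgn[symmetric] mult.commute)
qed (simp add: pow_p1_def pow_p_def)

lemma pow_p2_eq: "pow_p2 p s = s * pow_p1 p s"
proof (cases "s = 0")
  case False
  have "\<bar>s\<bar> powr (p + 2) = \<bar>s\<bar> * \<bar>s\<bar> powr (p + 1)"
    using False powr_add[of "\<bar>s\<bar>" 1 "p + 1"] by (simp add: add.commute)
  then show ?thesis
    by (simp add: pow_p1_def pow_p2_def mult.assoc[symmetric] sgn_mult_abs)
qed (simp add: pow_p1_def pow_p2_def)

lemma pow_p1_nonneg: "0 \<le> pow_p1 p s" by (simp add: pow_p1_def)

lemma pow_p1_scale: "c > 0 \<Longrightarrow> pow_p1 p (c * s) = c powr (p + 1) * pow_p1 p s"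
  by (simp add: pow_p1_def abs_mult powr_mult)

lemma pow_p_bound:
  assumes "p > 0" "\<bar>s\<bar> \<le> B"
  shows "\<bar>pow_p p s\<bar> \<le> B powr p"
proof -
  have "\<bar>pow_p p s\<bar> \<le> \<bar>s\<bar> powr p" by (simp add: pow_p_def abs_mult sgn_if)
  also have "\<dots> \<le> B powr p" using assms by (intro powr_mono2) auto
  finally show ?thesis .
qed

text \<open>On bounded sets the nonlinearity grows at most linearly. Together with the sup bound for
  H^1 functions this keeps it in L^2, so no higher Lebesgue spaces are required.\<close>

lemma pow_p1_bound:
  assumes "p > 0" "\<bar>s\<bar> \<le> B"
  shows "\<bar>pow_p1 p s\<bar> \<le> B powr p * \<bar>s\<bar>"
  unfolding pow_p1_eq abs_mult using mult_right_mono[OF pow_p_bound[OF assms], of "\<bar>s\<bar>"] by (simp add: mult.commute)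

lemma abs_powr_tendsto_0: "p > 0 \<Longrightarrow> ((\<lambda>h::real. \<bar>h\<bar> powr p) \<longlongrightarrow> 0) (at 0)"
proof -
  assume p: "p > 0"
  have "((\<lambda>h::real. \<bar>h\<bar> powr p) \<longlongrightarrow> \<bar>0\<bar> powr p) (at 0)"
    by (rule tendsto_powr'[OF tendsto_rabs[OF tendsto_ident_at] tendsto_const]) (use p in auto)
  then show ?thesis by simp
qed

lemma pow_p1_has_derivative:
  assumes "p > 0"
  shows "(pow_p1 p has_real_derivative (p + 1) * pow_p p s) (at s)"
proof -
  consider "s > 0" | "s < 0" | "s = 0" by linarith
  then show ?thesis
  proof cases
    case 1
    have "((\<lambda>x. x powr (p + 1)) has_real_derivative (p + 1) * pow_p p s) (at s)"
      using 1 by (auto intro!: derivative_eq_intros simp: pow_p_def)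
    then show ?thesis
      by (rule has_field_derivative_transform_within_open[of _ _ _ "{0<..}"])
        (use 1 in \<open>auto simp: pow_p1_def\<close>)
  next
    case 2
    have "((\<lambda>x. (- x) powr (p + 1)) has_real_derivative (p + 1) * pow_p p s) (at s)"
      using 2 by (auto intro!: derivative_eq_intros simp: pow_p_def)
    then show ?thesis
      by (rule has_field_derivative_transform_within_open[of _ _ _ "{..<0}"])
        (use 2 in \<open>auto simp: pow_p1_def\<close>)
  next
    case 3
    have "((\<lambda>h. pow_p1 p h / h) \<longlongrightarrow> 0) (at 0)"
    proof (rule Lim_null_comparison[OF _ abs_powr_tendsto_0[OF assms]])
      show "\<forall>\<^sub>F h in at 0. norm (pow_p1 p h / h) \<le> \<bar>h\<bar> powr p"
        by (rule always_eventually) (auto simp: pow_p1_eq pow_p_def abs_mult sgn_if)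
    qed
    then show ?thesis using 3 by (simp add: DERIV_def pow_p1_def pow_p_def)
  qed
qed

lemma isCont_pow_p1: "p > 0 \<Longrightarrow> isCont (pow_p1 p) s"
  by (rule DERIV_isCont[OF pow_p1_has_derivative])

lemma isCont_pow_p:
  assumes "p > 0"
  shows "isCont (pow_p p) s"
proof (cases "s = 0")
  case True
  have "(pow_p p \<longlongrightarrow> 0) (at 0)"
    by (rule Lim_null_comparison[OF always_eventually abs_powr_tendsto_0[OF assms]])
      (auto simp: pow_p_def abs_mult sgn_if)
  then show ?thesis using True by (simp add: isCont_def pow_p_def)
next
  case False
  then have "isCont (\<lambda>x. pow_p1 p x / x) s"
    by (intro continuous_intros isCont_pow_p1 assms)
  moreover have "\<forall>\<^sub>F x in nhds s. pow_p1 p x / x = pow_p p x"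
  proof -
    have "\<forall>\<^sub>F x in nhds s. x \<noteq> 0" using False by (rule t1_space_nhds)
    then show ?thesis by eventually_elim (simp add: pow_p1_eq)
  qed
  ultimately show ?thesis by (simp add: isCont_cong)
qed

lemma pow_p_measurable [measurable]: "p > 0 \<Longrightarrow> pow_p p \<in> borel_measurable borel"
  by (intro borel_measurable_continuous_onI continuous_at_imp_continuous_on ballI isCont_pow_p)

lemma pow_p1_measurable [measurable]: "pow_p1 p \<in> borel_measurable borel"
  unfolding pow_p1_def[abs_def] by measurable

lemma pow_p1_lipschitz:
  assumes "p > 0" "\<bar>s\<bar> \<le> B" "\<bar>t\<bar> \<le> B"
  shows "\<bar>pow_p1 p s - pow_p1 p t\<bar> \<le> (p + 1) * B powr p * \<bar>s - t\<bar>"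
proof -
  have "norm (pow_p1 p s - pow_p1 p t) \<le> ((p + 1) * B powr p) * norm (s - t)"
  proof (rule field_differentiable_bound[of "{-B..B}" _ "\<lambda>s. (p + 1) * pow_p p s"])
    show "(pow_p1 p has_field_derivative (p + 1) * pow_p p u) (at u within {- B..B})" for u
      by (rule has_field_derivative_at_within[OF pow_p1_has_derivative[OF assms(1)]])
    show "norm ((p + 1) * pow_p p u) \<le> (p + 1) * B powr p" if "u \<in> {-B..B}" for u
      using pow_p_bound[OF assms(1), of u B] that assms(1) by (auto simp: abs_mult intro!: mult_left_mono)
  qed (use assms in auto)
  then show ?thesis by simp
qed

lemma L2_pow_p1:
  assumes "p > 0" "w \<in> L2" "\<And>x. \<bar>w x\<bar> \<le> B"
  shows "(\<lambda>x. pow_p1 p (w x)) \<in> L2" "l2 (\<lambda>x. pow_p1 p (w x)) \<le> B powr p * l2 w"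
proof -
  have [measurable]: "w \<in> borel_measurable borel" using assms(2) by (rule L2_measurable)
  have m: "(\<lambda>x. pow_p1 p (w x)) \<in> borel_measurable borel" by measurable
  have b: "AE x in lborel. \<bar>pow_p1 p (w x)\<bar> \<le> B powr p * \<bar>w x\<bar>"
    using assms(3) by (intro AE_I2 pow_p1_bound assms)
  show "(\<lambda>x. pow_p1 p (w x)) \<in> L2" by (rule L2_dominated[OF assms(2) m b])
  show "l2 (\<lambda>x. pow_p1 p (w x)) \<le> B powr p * l2 w" by (rule l2_mono[OF assms(2) m b]) simp
qed

lemma L2_mult_pow_p:
  assumes "p > 0" "z \<in> L2" "\<And>x. \<bar>w x\<bar> \<le> B" "w \<in> borel_measurable borel"
  shows "(\<lambda>x. z x * pow_p p (w x)) \<in> L2" "l2 (\<lambda>x. z x * pow_p p (w x)) \<le> B powr p * l2 z"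
proof -
  note [measurable] = pow_p_measurable[OF assms(1)]
  have [measurable]: "z \<in> borel_measurable borel" "w \<in> borel_measurable borel"
    using assms by (auto intro: L2_measurable)
  have m: "(\<lambda>x. z x * pow_p p (w x)) \<in> borel_measurable borel" by measurable
  have b: "AE x in lborel. \<bar>z x * pow_p p (w x)\<bar> \<le> B powr p * \<bar>z x\<bar>"
  proof (rule AE_I2)
    fix x
    show "\<bar>z x * pow_p p (w x)\<bar> \<le> B powr p * \<bar>z x\<bar>"
      using mult_left_mono[OF pow_p_bound[OF assms(1,3)], of "\<bar>z x\<bar>" x] by (simp add: abs_mult mult.commute)
  qed
  show "(\<lambda>x. z x * pow_p p (w x)) \<in> L2" by (rule L2_dominated[OF assms(2) m b])
  show "l2 (\<lambda>x. z x * pow_p p (w x)) \<le> B powr p * l2 z" by (rule l2_mono[OF assms(2) m b]) simp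
qed

lemma pow_p1_L2_lipschitz:
  assumes "p > 0" "w \<in> L2" "u \<in> L2" "\<And>x. \<bar>w x\<bar> \<le> B" "\<And>x. \<bar>u x\<bar> \<le> B"
  shows "l2 (\<lambda>x. pow_p1 p (w x) - pow_p1 p (u x)) \<le> (p + 1) * B powr p * l2 (\<lambda>x. w x - u x)"
proof (rule l2_mono)
  have [measurable]: "w \<in> borel_measurable borel" "u \<in> borel_measurable borel"
    using assms by (auto intro: L2_measurable)
  show "(\<lambda>x. w x - u x) \<in> L2" using assms by (intro L2_diff)
  show "(\<lambda>x. pow_p1 p (w x) - pow_p1 p (u x)) \<in> borel_measurable borel" by measurable
  show "AE x in lborel. \<bar>pow_p1 p (w x) - pow_p1 p (u x)\<bar> \<le> (p + 1) * B powr p * \<bar>w x - u x\<bar>"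
    using assms by (intro AE_I2 pow_p1_lipschitz)
qed (use assms in simp)

section \<open>First variation of the constraint and stationarity\<close>

lemma constraint_has_derivative:
  assumes p: "p > 0" and L: "z \<in> L2" "w \<in> L2" "\<phi> \<in> L2" "\<psi> \<in> L2"
    and B: "\<And>x. \<bar>w x\<bar> \<le> B" "\<And>x. \<bar>\<psi> x\<bar> \<le> B"
  shows "((\<lambda>t. LINT x|lborel. (z x + t * \<phi> x) * pow_p1 p (w x + t * \<psi> x)) has_real_derivative
    ip (\<lambda>x. pow_p1 p (w x)) \<phi> + (p + 1) * ip (\<lambda>x. z x * pow_p p (w x)) \<psi>) (at 0)"
proof -
  note [measurable] = pow_p_measurable[OF p]
  have [measurable]: "z \<in> borel_measurable borel" "w \<in> borel_measurable borel"
    "\<phi> \<in> borel_measurable borel" "\<psi> \<in> borel_measurable borel"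
    using L by (auto intro: L2_measurable)
  define F where "F t x = (z x + t * \<phi> x) * pow_p1 p (w x + t * \<psi> x)" for t x
  define F' where "F' x = pow_p1 p (w x) * \<phi> x + (p + 1) * (z x * pow_p p (w x) * \<psi> x)" for x
  \<comment> \<open>For |t| \<le> 1 the perturbed argument w + t \<psi> stays below 2 B, so one
    growth and Lipschitz constant serves all difference quotients; \<open>M\<close> is the resulting
    integrable majorant.\<close>
  define K where "K = (2 * B) powr p"
  define M where "M x = K * \<bar>\<phi> x * w x\<bar> + K * \<bar>\<phi> x * \<psi> x\<bar> + (p + 1) * K * \<bar>z x * \<psi> x\<bar>" for x
  have b2: "\<bar>w x + t * \<psi> x\<bar> \<le> 2 * B" if "\<bar>t\<bar> \<le> 1" for t x
  proof -
    have "\<bar>t * \<psi> x\<bar> \<le> 1 * B" unfolding abs_mult using that B by (intro mult_mono) auto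
    then show ?thesis using B(1)[of x] by linarith
  qed
  have b1: "\<bar>w x\<bar> \<le> 2 * B" for x using b2[of 0 x] by simp
  have K0: "0 \<le> K" by (simp add: K_def)
  have Fint: "integrable lborel (F t)" if "\<bar>t\<bar> \<le> 1" for t
  proof -
    have "(\<lambda>x. pow_p1 p (w x + t * \<psi> x)) \<in> L2"
      by (rule L2_pow_p1[OF p, of _ "2 * B"]) (use L b2 that in \<open>auto intro!: L2_closed\<close>)
    then show ?thesis unfolding F_def[abs_def] by (intro L2_mult_integrable L2_closed L)
  qed
  have Fd: "((\<lambda>t. F t x) has_real_derivative F' x) (at 0)" for x
    unfolding F_def F'_def
    by (auto intro!: derivative_eq_intros DERIV_chain2[OF pow_p1_has_derivative[OF p]] simp: algebra_simps)
  have bound: "\<bar>(F t x - F 0 x) / t\<bar> \<le> M x" if "\<bar>t\<bar> \<le> 1" for t x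
  proof (cases "t = 0")
    case True
    then show ?thesis using K0 p by (auto simp: M_def intro!: add_nonneg_nonneg mult_nonneg_nonneg)
  next
    case False
    have "F t x - F 0 x = t * (\<phi> x * pow_p1 p (w x + t * \<psi> x)) + z x * (pow_p1 p (w x + t * \<psi> x) - pow_p1 p (w x))"
      by (simp add: F_def algebra_simps)
    then have "\<bar>F t x - F 0 x\<bar> \<le> \<bar>t\<bar> * (\<bar>\<phi> x\<bar> * \<bar>pow_p1 p (w x + t * \<psi> x)\<bar>) + \<bar>z x\<bar> * \<bar>pow_p1 p (w x + t * \<psi> x) - pow_p1 p (w x)\<bar>"
      by (metis abs_mult abs_triangle_ineq)
    also have "\<dots> \<le> \<bar>t\<bar> * (\<bar>\<phi> x\<bar> * (K * (\<bar>w x\<bar> + \<bar>\<psi> x\<bar>))) + \<bar>z x\<bar> * ((p + 1) * K * (\<bar>t\<bar> * \<bar>\<psi> x\<bar>))"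
    proof (intro add_mono mult_left_mono)
      have "\<bar>pow_p1 p (w x + t * \<psi> x)\<bar> \<le> K * \<bar>w x + t * \<psi> x\<bar>"
        unfolding K_def by (intro pow_p1_bound p b2 that)
      also have "\<dots> \<le> K * (\<bar>w x\<bar> + \<bar>\<psi> x\<bar>)"
      proof (intro mult_left_mono K0)
        have "\<bar>t * \<psi> x\<bar> \<le> 1 * \<bar>\<psi> x\<bar>" unfolding abs_mult using that by (intro mult_right_mono) auto
        then show "\<bar>w x + t * \<psi> x\<bar> \<le> \<bar>w x\<bar> + \<bar>\<psi> x\<bar>" by linarith
      qed
      finally show "\<bar>pow_p1 p (w x + t * \<psi> x)\<bar> \<le> K * (\<bar>w x\<bar> + \<bar>\<psi> x\<bar>)" .
      show "\<bar>pow_p1 p (w x + t * \<psi> x) - pow_p1 p (w x)\<bar> \<le> (p + 1) * K * (\<bar>t\<bar> * \<bar>\<psi> x\<bar>)"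
        using pow_p1_lipschitz[OF p b2[OF that] b1, of x x] by (simp add: K_def abs_mult)
    qed auto
    also have "\<dots> = \<bar>t\<bar> * M x"
      by (simp add: M_def abs_mult algebra_simps)
    finally show ?thesis using False by (simp add: field_simps)
  qed
  have "(\<lambda>n. ((LINT x|lborel. F (h n) x) - (LINT x|lborel. F 0 x)) / h n) \<longlonglongrightarrow> (LINT x|lborel. F' x)"
    if h: "\<And>n. h n \<noteq> 0" "h \<longlonglongrightarrow> 0" for h
  proof -
    \<comment> \<open>The majorant is valid only for |t| \<le> 1, hence the cut-off; along h tending
      to 0 it affects finitely many terms.\<close>
    define S where "S n x = (if \<bar>h n\<bar> \<le> 1 then (F (h n) x - F 0 x) / h n else 0)" for n x
    have ev: "\<forall>\<^sub>F n in sequentially. \<bar>h n\<bar> \<le> 1"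
    proof -
      have "(\<lambda>n. \<bar>h n\<bar>) \<longlonglongrightarrow> 0" using h(2) by (rule tendsto_rabs_zero)
      then have "\<forall>\<^sub>F n in sequentially. \<bar>h n\<bar> < 1" by (rule order_tendstoD) simp
      then show ?thesis by eventually_elim simp
    qed
    have "(\<lambda>n. LINT x|lborel. S n x) \<longlonglongrightarrow> (LINT x|lborel. F' x)"
    proof (rule Bochner_Integration.integral_dominated_convergence[where w = M])
      show "F' \<in> borel_measurable lborel" unfolding F'_def by measurable
      show "S n \<in> borel_measurable lborel" for n unfolding S_def F_def by measurable
      show "integrable lborel M" unfolding M_def
        by (intro Bochner_Integration.integrable_add integrable_mult_right Bochner_Integration.integrable_abs L2_mult_integrable L)
      show "AE x in lborel. norm (S n x) \<le> M x" for n
      proof (rule AE_I2)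
        fix x
        have "0 \<le> M x" using K0 p by (auto simp: M_def intro!: add_nonneg_nonneg mult_nonneg_nonneg)
        then show "norm (S n x) \<le> M x" using bound[of "h n" x] by (auto simp: S_def)
      qed
      show "AE x in lborel. (\<lambda>n. S n x) \<longlonglongrightarrow> F' x"
      proof (rule AE_I2)
        fix x
        have "((\<lambda>t. (F t x - F 0 x) / t) \<longlongrightarrow> F' x) (at 0)"
          using Fd[of x] by (simp add: DERIV_def)
        then have "(\<lambda>n. (F (h n) x - F 0 x) / h n) \<longlonglongrightarrow> F' x"
          by (rule filterlim_compose) (use h in \<open>auto simp: filterlim_at\<close>)
        then show "(\<lambda>n. S n x) \<longlonglongrightarrow> F' x"
          by (rule Lim_transform_eventually) (use ev in \<open>eventually_elim, simp add: S_def\<close>)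
      qed
    qed
    then show ?thesis
    proof (rule Lim_transform_eventually)
      show "\<forall>\<^sub>F n in sequentially. (LINT x|lborel. S n x) = ((LINT x|lborel. F (h n) x) - (LINT x|lborel. F 0 x)) / h n"
        using ev
      proof eventually_elim
        case (elim n)
        then have "(LINT x|lborel. S n x) = (LINT x|lborel. (F (h n) x - F 0 x) / h n)" by (simp add: S_def)
        also have "\<dots> = ((LINT x|lborel. F (h n) x) - (LINT x|lborel. F 0 x)) / h n"
          using Fint[OF elim] Fint[of 0] by simp
        finally show ?case .
      qed
    qed
  qed
  then have "((\<lambda>t. LINT x|lborel. F t x) has_real_derivative (LINT x|lborel. F' x)) (at 0)"
    unfolding DERIV_def by (auto simp: tendsto_at_iff_sequentially o_def)
  moreover have "(LINT x|lborel. F' x) = ip (\<lambda>x. pow_p1 p (w x)) \<phi> + (p + 1) * ip (\<lambda>x. z x * pow_p p (w x)) \<psi>"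
  proof -
    have "integrable lborel (\<lambda>x. pow_p1 p (w x) * \<phi> x)"
      using L2_pow_p1[OF p L(2) B(1)] L by (intro L2_mult_integrable)
    moreover have "integrable lborel (\<lambda>x. z x * pow_p p (w x) * \<psi> x)"
      by (intro L2_mult_integrable L2_mult_pow_p[OF p _ B(1)] L) simp
    ultimately show ?thesis by (simp add: F'_def ip_def)
  qed
  ultimately show ?thesis by (simp add: F_def)
qed

text \<open>The difference of the two sides of \<open>ge\<close> vanishes at t = 0 and is
  nonnegative wherever \<Gamma> is positive, in particular near 0. Its derivative at this local
  minimum is 0. The power r of \<Gamma> does the work of renormalising the perturbed pair.\<close>

lemma homogeneous_minimum_stationary:
  fixes \<Gamma> :: "real \<Rightarrow> real"
  assumes \<Gamma>: "(\<Gamma> has_real_derivative \<Gamma>') (at 0)" "\<Gamma> 0 = 1"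
    and ge: "\<And>t. \<Gamma> t > 0 \<Longrightarrow> A * \<Gamma> t powr r \<le> A + 2 * t * A1 + t\<^sup>2 * A2"
  shows "2 * A1 = A * r * \<Gamma>'"
proof -
  define h where "h t = A + 2 * t * A1 + t\<^sup>2 * A2 - A * \<Gamma> t powr r" for t
  have "(h has_real_derivative 2 * A1 - A * r * \<Gamma>') (at 0)"
    unfolding h_def using \<Gamma> by (auto intro!: derivative_eq_intros)
  moreover have "\<forall>\<^sub>F t in nhds 0. \<Gamma> t > 0"
  proof -
    have "isCont \<Gamma> 0" by (rule DERIV_isCont) fact
    then have "(\<Gamma> \<longlongrightarrow> \<Gamma> 0) (nhds 0)" unfolding isCont_def tendsto_at_iff_tendsto_nhds .
    then have "(\<Gamma> \<longlongrightarrow> 1) (nhds 0)" by (simp add: \<Gamma>(2))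
    then show ?thesis by (rule order_tendstoD) simp
  qed
  then obtain e where e: "e > 0" "\<And>t. \<bar>t\<bar> < e \<Longrightarrow> \<Gamma> t > 0"
    unfolding eventually_nhds_metric by (auto simp: dist_real_def)
  have "h 0 \<le> h t" if "\<bar>0 - t\<bar> < e" for t
    using ge[OF e(2)[of t]] that \<Gamma>(2) by (simp add: h_def)
  ultimately have "2 * A1 - A * r * \<Gamma>' = 0"
    using e(1) by (intro DERIV_local_min[of h]) auto
  then show ?thesis by simp
qed

section \<open>Compactness\<close>

text \<open>The functions are uniformly bounded and share a Hoelder constant of order 1/2. A
  diagonal subsequence converges at all rationals, and the common modulus makes it Cauchy
  everywhere; the limit inherits the modulus and so is continuous.\<close>

lemma sob_convergent_subsequence:
  fixes f f' :: "nat \<Rightarrow> real \<Rightarrow> real"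
  assumes "\<And>j. sob (f j) (f' j)" "\<And>j. l2 (f j) \<le> C" "\<And>j. l2 (f' j) \<le> C"
  obtains r f0 where "strict_mono (r::nat \<Rightarrow> nat)" "\<And>x. (\<lambda>j. f (r j) x) \<longlonglongrightarrow> f0 x" "\<And>x. isCont f0 x"
proof -
  have C0: "0 \<le> C" using assms(2)[of 0] l2_nonneg[of "f 0"] by linarith
  have bd: "norm (f j x) \<le> 4 * C" for j x
    using sob_bounded[OF assms(1)[of j], of x] assms(2)[of j] assms(3)[of j] by simp
  have hol: "\<bar>f j y - f j x\<bar> \<le> C * sqrt \<bar>y - x\<bar>" for j x y
    using sob_holder[OF assms(1)[of j], of y x] mult_right_mono[OF assms(3)[of j], of "sqrt \<bar>y - x\<bar>"]
    by (meson order_trans real_sqrt_ge_zero abs_ge_zero)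
  obtain r where r: "strict_mono (r::nat \<Rightarrow> nat)" "\<And>x. x \<in> \<rat> \<Longrightarrow> \<exists>l. (\<lambda>j. f (r j) x) \<longlonglongrightarrow> l"
    using function_convergent_subsequence[OF countable_rat, of f "4 * C"] bd by blast
  have "Cauchy (\<lambda>j. f (r j) x)" for x
  proof (rule metric_CauchyI)
    fix e :: real assume e: "e > 0"
    \<comment> \<open>Within distance h the Hoelder bound is at most C e/(3 (C + 1)), strictly below
      e/3; the denominator C + 1 covers C = 0.\<close>
    define h where "h = (e / (3 * (C + 1)))\<^sup>2"
    have "h > 0" using e C0 by (simp add: h_def)
    then obtain t where t: "t \<in> \<rat>" "x < t" "t < x + h" using Rats_dense_in_real[of x "x + h"] by auto
    have "sqrt \<bar>x - t\<bar> \<le> sqrt h" using t by simp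
    also have "\<dots> = e / (3 * (C + 1))" using e C0 by (simp add: h_def)
    finally have "C * sqrt \<bar>x - t\<bar> \<le> C * (e / (3 * (C + 1)))" using C0 by (intro mult_left_mono)
    also have "\<dots> < (C + 1) * (e / (3 * (C + 1)))" using e C0 by (intro mult_strict_right_mono) auto
    finally have lt: "C * sqrt \<bar>x - t\<bar> < (C + 1) * (e / (3 * (C + 1)))" .
    have "K * (e / (3 * K)) = e / 3" if "K > 0" for K :: real using that by (simp add: field_simps)
    from this[of "C + 1"] have eq: "(C + 1) * (e / (3 * (C + 1))) = e / 3" using C0 by simp
    have small: "C * sqrt \<bar>x - t\<bar> < e / 3" using lt unfolding eq .
    obtain l where "(\<lambda>j. f (r j) t) \<longlonglongrightarrow> l" using r(2)[OF t(1)] by blast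
    then have "Cauchy (\<lambda>j. f (r j) t)" by (rule LIMSEQ_imp_Cauchy)
    then obtain M where M: "\<And>m n. m \<ge> M \<Longrightarrow> n \<ge> M \<Longrightarrow> dist (f (r m) t) (f (r n) t) < e / 3"
      using e unfolding Cauchy_def by (meson divide_pos_pos zero_less_numeral)
    show "\<exists>M. \<forall>m\<ge>M. \<forall>n\<ge>M. dist (f (r m) x) (f (r n) x) < e"
    proof (intro exI allI impI)
      fix m n assume "m \<ge> M" "n \<ge> M"
      then show "dist (f (r m) x) (f (r n) x) < e"
        using M[of m n] hol[of "r m" x t] hol[of "r n" x t] small unfolding dist_real_def by linarith
    qed
  qed
  then have "\<forall>x. \<exists>l. (\<lambda>j. f (r j) x) \<longlonglongrightarrow> l"
    using Cauchy_convergent_iff convergent_def by blast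
  then obtain f0 where f0: "\<And>x. (\<lambda>j. f (r j) x) \<longlonglongrightarrow> f0 x" by metis
  have hol0: "\<bar>f0 y - f0 x\<bar> \<le> C * sqrt \<bar>y - x\<bar>" for x y
  proof (rule LIMSEQ_le_const2)
    show "(\<lambda>j. \<bar>f (r j) y - f (r j) x\<bar>) \<longlonglongrightarrow> \<bar>f0 y - f0 x\<bar>" by (intro tendsto_intros f0)
  qed (use hol in auto)
  have "isCont f0 x" for x by (rule holder_isCont[OF hol0])
  then show ?thesis using that r(1) f0 by blast
qed

section \<open>Lower semicontinuity and strong convergence in L^2\<close>

lemma nn_integral_eq_ip: "f \<in> L2 \<Longrightarrow> (\<integral>\<^sup>+x. ennreal ((f x)\<^sup>2) \<partial>lborel) = ennreal (ip f f)"
  unfolding ip_def power2_eq_square by (rule nn_integral_eq_integral) (auto intro: L2_square_integrable)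

text \<open>Fatou's lemma for the squares. Lower semicontinuity is phrased as eventual strict
  inequalities, which serve for real sequences that are bounded but not known to converge.\<close>

lemma L2_Fatou:
  fixes f :: "nat \<Rightarrow> real \<Rightarrow> real"
  assumes L: "\<And>j. f j \<in> L2" and lim: "\<And>x. (\<lambda>j. f j x) \<longlonglongrightarrow> f0 x" and C: "\<And>j. ip (f j) (f j) \<le> C"
  shows "f0 \<in> L2" "\<And>c. c < ip f0 f0 \<Longrightarrow> \<forall>\<^sub>F j in sequentially. c < ip (f j) (f j)"
proof -
  have [measurable]: "f j \<in> borel_measurable borel" for j using L by (rule L2_measurable)
  have [measurable]: "f0 \<in> borel_measurable borel" by (rule borel_measurable_LIMSEQ_real[OF lim]) measurable
  have "(\<integral>\<^sup>+x. ennreal ((f0 x)\<^sup>2) \<partial>lborel) = (\<integral>\<^sup>+x. liminf (\<lambda>j. ennreal ((f j x)\<^sup>2)) \<partial>lborel)"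
  proof (rule nn_integral_cong)
    fix x
    have "(\<lambda>j. ennreal ((f j x)\<^sup>2)) \<longlonglongrightarrow> ennreal ((f0 x)\<^sup>2)"
      by (intro tendsto_ennrealI tendsto_intros lim)
    then show "ennreal ((f0 x)\<^sup>2) = liminf (\<lambda>j. ennreal ((f j x)\<^sup>2))"
      using lim_imp_Liminf trivial_limit_sequentially by metis
  qed
  also have "\<dots> \<le> liminf (\<lambda>j. \<integral>\<^sup>+x. ennreal ((f j x)\<^sup>2) \<partial>lborel)"
    by (rule nn_integral_liminf) measurable
  also have "\<dots> = liminf (\<lambda>j. ennreal (ip (f j) (f j)))" by (simp add: nn_integral_eq_ip L)
  finally have le: "(\<integral>\<^sup>+x. ennreal ((f0 x)\<^sup>2) \<partial>lborel) \<le> liminf (\<lambda>j. ennreal (ip (f j) (f j)))" .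
  also have "\<dots> \<le> liminf (\<lambda>j::nat. ennreal C)"
    by (intro Liminf_mono always_eventually) (use C in \<open>auto intro: ennreal_leI\<close>)
  also have "\<dots> < \<infinity>" by (simp add: Liminf_const)
  finally have fin: "(\<integral>\<^sup>+x. ennreal ((f0 x)\<^sup>2) \<partial>lborel) < \<infinity>" .
  show f0: "f0 \<in> L2"
  proof (rule L2I)
    show "integrable lborel (\<lambda>x. f0 x * f0 x)"
      unfolding integrable_iff_bounded using fin by (simp add: power2_eq_square)
  qed measurable
  fix c assume c: "c < ip f0 f0"
  show "\<forall>\<^sub>F j in sequentially. c < ip (f j) (f j)"
  proof (cases "c < 0")
    case True
    then show ?thesis by (intro always_eventually allI) (meson ip_self_nonneg less_le_trans)
  next
    case False
    then have "ennreal c < ennreal (ip f0 f0)" using c by (simp add: ennreal_less_iff)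
    also have "\<dots> \<le> liminf (\<lambda>j. ennreal (ip (f j) (f j)))" using le by (simp add: nn_integral_eq_ip f0)
    finally have "\<forall>\<^sub>F j in sequentially. ennreal c < ennreal (ip (f j) (f j))" by (rule less_LiminfD)
    then show ?thesis by eventually_elim (use False in \<open>simp add: ennreal_less_iff\<close>)
  qed
qed

lemma L2_Fatou_limit:
  fixes f :: "nat \<Rightarrow> real \<Rightarrow> real"
  assumes L: "\<And>j. f j \<in> L2" and lim: "\<And>x. (\<lambda>j. f j x) \<longlonglongrightarrow> f0 x" and A: "(\<lambda>j. ip (f j) (f j)) \<longlonglongrightarrow> A"
  shows "f0 \<in> L2" "ip f0 f0 \<le> A"
proof -
  obtain C where C: "\<And>j. ip (f j) (f j) \<le> C"
    using convergent_imp_Bseq[OF convergentI[OF A]] unfolding Bseq_def real_norm_def by (metis abs_le_D1)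
  show "f0 \<in> L2" by (rule L2_Fatou[OF L lim C])
  show "ip f0 f0 \<le> A"
  proof (rule ccontr)
    assume "\<not> ip f0 f0 \<le> A"
    then obtain c where c: "A < c" "c < ip f0 f0" using dense by (auto simp: not_le)
    have "\<forall>\<^sub>F j in sequentially. c < ip (f j) (f j)" by (rule L2_Fatou(2)[OF L lim C c(2)])
    moreover have "\<forall>\<^sub>F j in sequentially. ip (f j) (f j) < c" using A c(1) by (rule order_tendstoD)
    ultimately have "\<forall>\<^sub>F j in sequentially. False" by eventually_elim simp
    then show False by simp
  qed
qed

text \<open>Fatou's lemma for \<open>f j + f0\<close> bounds \<open>ip (f j) f0\<close> from below, Cauchy-Schwarz from above.\<close>
lemma L2_strong_convergence:
  fixes f :: "nat \<Rightarrow> real \<Rightarrow> real"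
  assumes L: "\<And>j. f j \<in> L2" and lim: "\<And>x. (\<lambda>j. f j x) \<longlonglongrightarrow> f0 x" and A: "(\<lambda>j. ip (f j) (f j)) \<longlonglongrightarrow> ip f0 f0"
  shows "(\<lambda>j. l2 (\<lambda>x. f j x - f0 x)) \<longlonglongrightarrow> 0"
proof -
  have f0: "f0 \<in> L2" by (rule L2_Fatou_limit[OF L lim A])
  obtain C where C: "\<And>j. \<bar>ip (f j) (f j)\<bar> \<le> C"
    using convergent_imp_Bseq[OF convergentI[OF A]] unfolding Bseq_def real_norm_def by blast
  have sum: "ip (\<lambda>x. f j x + f0 x) (\<lambda>x. f j x + f0 x) = ip (f j) (f j) + 2 * ip (f j) f0 + ip f0 f0" for j
    using L f0 by (simp add: ip_linear L2_closed ip_commute[of f0 "f j"])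
  have diff: "ip (\<lambda>x. f j x - f0 x) (\<lambda>x. f j x - f0 x) = ip (f j) (f j) - 2 * ip (f j) f0 + ip f0 f0" for j
    using L f0 by (simp add: ip_linear L2_closed ip_commute[of f0 "f j"])
  have CS: "\<bar>2 * ip (f j) f0\<bar> \<le> ip (f j) (f j) + ip f0 f0" for j
    using ip_self_nonneg[of "\<lambda>x. f j x - f0 x"] ip_self_nonneg[of "\<lambda>x. f j x + f0 x"] unfolding sum diff by linarith
  have four: "ip (\<lambda>x. f0 x + f0 x) (\<lambda>x. f0 x + f0 x) = 4 * ip f0 f0"
    using f0 by (simp add: ip_linear L2_closed)
  have "(\<lambda>j. ip (\<lambda>x. f j x - f0 x) (\<lambda>x. f j x - f0 x)) \<longlonglongrightarrow> 0"
  proof (rule LIMSEQ_I)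
    fix e :: real assume e: "e > 0"
    \<comment> \<open>By the parallelogram law |f j - f0|^2 = 2 |f j|^2 + 2 |f0|^2 - |f j + f0|^2.
      The share e/2 here and twice the share e/4 below add up to e.\<close>
    have "\<forall>\<^sub>F j in sequentially. 4 * ip f0 f0 - e / 2 < ip (\<lambda>x. f j x + f0 x) (\<lambda>x. f j x + f0 x)"
    proof (rule L2_Fatou(2)[of "\<lambda>j x. f j x + f0 x" "\<lambda>x. f0 x + f0 x" "2 * (C + ip f0 f0)"])
      show "ip (\<lambda>x. f j x + f0 x) (\<lambda>x. f j x + f0 x) \<le> 2 * (C + ip f0 f0)" for j
        unfolding sum using abs_le_D1[OF CS[of j]] abs_le_D1[OF C[of j]] by argo
      show "(\<lambda>x. f j x + f0 x) \<in> L2" for j by (rule L2_add[OF L f0])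
      show "(\<lambda>j. f j x + f0 x) \<longlonglongrightarrow> f0 x + f0 x" for x by (rule tendsto_add[OF lim tendsto_const])
      show "4 * ip f0 f0 - e / 2 < ip (\<lambda>x. f0 x + f0 x) (\<lambda>x. f0 x + f0 x)" unfolding four using e by simp
    qed
    moreover have "\<forall>\<^sub>F j in sequentially. ip (f j) (f j) < ip f0 f0 + e / 4"
      using A by (rule order_tendstoD) (use e in simp)
    ultimately have "\<forall>\<^sub>F j in sequentially. norm (ip (\<lambda>x. f j x - f0 x) (\<lambda>x. f j x - f0 x) - 0) < e"
    proof eventually_elim
      case (elim j)
      then show ?case using ip_self_nonneg[of "\<lambda>x. f j x - f0 x"] unfolding sum diff by simp
    qed
    then show "\<exists>no. \<forall>j\<ge>no. norm (ip (\<lambda>x. f j x - f0 x) (\<lambda>x. f j x - f0 x) - 0) < e"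
      by (simp add: eventually_sequentially)
  qed
  then have "(\<lambda>j. sqrt (ip (\<lambda>x. f j x - f0 x) (\<lambda>x. f j x - f0 x))) \<longlonglongrightarrow> sqrt 0" by (rule tendsto_real_sqrt)
  then show ?thesis by (simp add: l2_def)
qed

lemma bounded_set_integral_convergence:
  fixes f :: "nat \<Rightarrow> real \<Rightarrow> real"
  assumes [measurable]: "\<And>j. f j \<in> borel_measurable borel"
    and lim: "\<And>x. (\<lambda>j. f j x) \<longlonglongrightarrow> f0 x" and B: "\<And>j x. \<bar>f j x\<bar> \<le> B"
  shows "(\<lambda>j. LINT t:{x..y}|lborel. f j t) \<longlonglongrightarrow> (LINT t:{x..y}|lborel. f0 t)"
  unfolding set_lebesgue_integral_def
proof (rule Bochner_Integration.integral_dominated_convergence[where w = "\<lambda>t. indicator {x..y} t *\<^sub>R B"])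
  have [measurable]: "f0 \<in> borel_measurable borel" by (rule borel_measurable_LIMSEQ_real[OF lim]) measurable
  show "(\<lambda>t. indicator {x..y} t *\<^sub>R f0 t) \<in> borel_measurable lborel"
    "\<And>j. (\<lambda>t. indicator {x..y} t *\<^sub>R f j t) \<in> borel_measurable lborel" by measurable
  show "integrable lborel (\<lambda>t. indicator {x..y} t *\<^sub>R B)"
    by (intro integrable_scaleR_left integrable_real_indicator) (auto simp: emeasure_lborel_Icc_eq)
  show "AE t in lborel. (\<lambda>j. indicator {x..y} t *\<^sub>R f j t) \<longlonglongrightarrow> indicator {x..y} t *\<^sub>R f0 t"
    by (intro AE_I2 tendsto_intros lim)
  show "AE t in lborel. norm (indicator {x..y} t *\<^sub>R f j t) \<le> indicator {x..y} t *\<^sub>R B" for j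
    using B by (auto simp: indicator_def)
qed

section \<open>Classical derivatives and integration by parts on the line\<close>

lemma sob_has_derivative:
  assumes "\<And>x y. x \<le> y \<Longrightarrow> f y - f x = (LINT t:{x..y}|lborel. f' t)" "\<And>x. isCont f' x"
  shows "(f has_real_derivative f' x) (at x)"
proof -
  obtain G where G: "\<And>x. (G has_real_derivative f' x) (at x)" using continuous_antiderivative[OF assms(2)] by blast
  have "f y - G y = f 0 - G 0" for y
    using assms(1)[of 0 y] derivative_integral[of 0 y G f'] assms(1)[of y 0] derivative_integral[of y 0 G f'] G assms(2)
    by (cases "0 \<le> y") auto
  then have "f = (\<lambda>y. G y + (f 0 - G 0))" by (auto simp: fun_eq_iff algebra_simps)
  moreover have "((\<lambda>y. G y + (f 0 - G 0)) has_real_derivative f' x) (at x)"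
    by (auto intro!: derivative_eq_intros G)
  ultimately show ?thesis by simp
qed

text \<open>The product f g has the integrable derivative h. Its integral over [-n, n] is a boundary
  term that tends to 0, since H^1 functions decay at infinity, and it also tends to the full
  integral.\<close>

lemma sob_integration_by_parts:
  assumes f: "sob f f'" and g: "sob g g'" and c: "\<And>x. isCont f' x" "\<And>x. isCont g' x"
  shows "ip f g' = - ip f' g"
proof -
  define h where "h x = f' x * g x + f x * g' x" for x
  have df: "(f has_real_derivative f' x) (at x)" for x by (rule sob_has_derivative[OF sob_diff_eq[OF f] c(1)])
  have dg: "(g has_real_derivative g' x) (at x)" for x by (rule sob_has_derivative[OF sob_diff_eq[OF g] c(2)])
  have dh: "((\<lambda>x. f x * g x) has_real_derivative h x) (at x)" for x
    unfolding h_def by (auto intro!: derivative_eq_intros df dg)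
  have ch: "isCont h x" for x
    unfolding h_def by (intro continuous_intros c sob_continuous[OF f] sob_continuous[OF g])
  have ih: "integrable lborel h" unfolding h_def[abs_def]
    using f g by (intro Bochner_Integration.integrable_add L2_mult_integrable) (auto dest: sob_L2)
  have ev: "\<forall>\<^sub>F n in sequentially. x \<in> {- real n..real n}" for x
  proof -
    obtain N where "\<bar>x\<bar> \<le> real N" using real_arch_simple by blast
    then show ?thesis by (intro eventually_sequentiallyI[of N]) auto
  qed
  have [measurable]: "h \<in> borel_measurable borel" using ih by (simp add: integrable_iff_bounded)
  have "(\<lambda>n. LINT t:{- real n..real n}|lborel. h t) \<longlonglongrightarrow> (LINT t|lborel. h t)"
    unfolding set_lebesgue_integral_def
  proof (rule Bochner_Integration.integral_dominated_convergence[where w = "\<lambda>t. \<bar>h t\<bar>"])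
    show "AE t in lborel. (\<lambda>n. indicator {- real n..real n} t *\<^sub>R h t) \<longlonglongrightarrow> h t"
    proof (rule AE_I2, rule tendsto_eventually)
      fix t show "\<forall>\<^sub>F n in sequentially. indicator {- real n..real n} t *\<^sub>R h t = h t"
        using ev[of t] by eventually_elim simp
    qed
    show "AE t in lborel. norm (indicator {- real n..real n} t *\<^sub>R h t) \<le> \<bar>h t\<bar>" for n
      by (auto simp: indicator_def)
  qed (use ih in auto)
  moreover have "(\<lambda>n. LINT t:{- real n..real n}|lborel. h t) \<longlonglongrightarrow> 0"
  proof -
    have eq: "(LINT t:{- real n..real n}|lborel. h t) = f (real n) * g (real n) - f (- real n) * g (- real n)" for n
      by (rule derivative_integral[OF _ dh ch]) simp
    have lim: "(\<lambda>n. k (real n)) \<longlonglongrightarrow> 0" "(\<lambda>n. k (- real n)) \<longlonglongrightarrow> 0" if "sob k k'" for k k'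
    proof -
      have up: "\<forall>\<^sub>F n in sequentially. x < real n" for x
        using filterlim_real_sequentially unfolding filterlim_at_top_dense by blast
      show "(\<lambda>n. k (real n)) \<longlonglongrightarrow> 0"
      proof (rule sob_tendsto_0[OF that])
        show "\<forall>\<^sub>F n in sequentially. x < real n \<or> real n + 1 < x" for x
          by (rule eventually_mono[OF up[of x]]) simp
      qed
      have down: "\<forall>\<^sub>F n in sequentially. - real n + 1 < x" for x
      proof -
        have "\<forall>\<^sub>F n in sequentially. 1 - x < real n" by (rule up)
        then show ?thesis by eventually_elim simp
      qed
      show "(\<lambda>n. k (- real n)) \<longlonglongrightarrow> 0"
      proof (rule sob_tendsto_0[OF that])
        show "\<forall>\<^sub>F n in sequentially. x < - real n \<or> - real n + 1 < x" for x
          by (rule eventually_mono[OF down[of x]]) simp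
      qed
    qed
    have "(\<lambda>n. f (real n) * g (real n) - f (- real n) * g (- real n)) \<longlonglongrightarrow> 0 * 0 - 0 * 0"
      by (intro tendsto_intros lim[OF f] lim[OF g])
    then show ?thesis by (simp add: eq)
  qed
  ultimately have "(LINT t|lborel. h t) = 0" by (rule LIMSEQ_unique)
  moreover have "(LINT t|lborel. h t) = ip f' g + ip f g'"
    unfolding h_def ip_def using f g
    by (intro Bochner_Integration.integral_add L2_mult_integrable) (auto dest: sob_L2)
  ultimately show ?thesis by simp
qed

section \<open>The energy in decoupled coordinates\<close>

text \<open>A constant of its own, so that z = \<open>lin \<mu> q d\<close> and w =
  \<open>lin (- \<nu>) q d\<close> remain atoms in inner products.\<close>

definition lin :: "real \<Rightarrow> (real \<Rightarrow> real) \<Rightarrow> (real \<Rightarrow> real) \<Rightarrow> real \<Rightarrow> real" where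
  "lin c f g x = f x + c * g x"

lemma L2_lin: "f \<in> L2 \<Longrightarrow> g \<in> L2 \<Longrightarrow> lin c f g \<in> L2"
  unfolding lin_def[abs_def] by (intro L2_closed)

lemma sob_lin: "sob f f' \<Longrightarrow> sob g g' \<Longrightarrow> sob (lin c f g) (lin c f' g')"
  unfolding lin_def[abs_def] by (intro sob_add sob_scale)

lemma ip_lin_left: "f \<in> L2 \<Longrightarrow> g \<in> L2 \<Longrightarrow> h \<in> L2 \<Longrightarrow> ip (lin c f g) h = ip f h + c * ip g h"
  unfolding lin_def[abs_def] by (simp add: ip_linear L2_closed)

lemma ip_lin_right: "f \<in> L2 \<Longrightarrow> g \<in> L2 \<Longrightarrow> h \<in> L2 \<Longrightarrow> ip h (lin c f g) = ip h f + c * ip h g"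
  unfolding lin_def[abs_def] by (simp add: ip_linear L2_closed)

lemma l2_lin:
  assumes "f \<in> L2" "g \<in> L2"
  shows "l2 (lin c f g) \<le> l2 f + \<bar>c\<bar> * l2 g"
  unfolding lin_def[abs_def] using l2_triangle[OF assms(1) L2_scale[OF assms(2), of c]] by (simp add: l2_scale)

text \<open>
  In the coordinates \<open>z = q + \<mu> d\<close>, \<open>w = q - \<nu> d\<close> the derivative part of the limiting energy
  is \<open>\<gamma> (q')\<^sup>2 + (D/\<gamma>) (d')\<^sup>2\<close> with \<open>\<gamma> = \<sigma> - 1/3\<close> and \<open>D = a c - b\<^sup>2\<close>, which may vanish.
\<close>
locale abcb_system =
  fixes \<gamma> b D \<mu> \<nu> p :: real
  assumes p: "p > 0" and \<gamma>: "\<gamma> > 0" and b: "b > 0" and D: "D \<ge> 0"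
    and mn: "\<mu> + \<nu> = 1" and mn_prod: "- (\<mu> * \<nu>) * \<gamma>\<^sup>2 = b * \<gamma> - D"

lemma (in abcb_system) ip_zw:
  assumes "f \<in> L2" "g \<in> L2"
  shows "ip (lin \<mu> f g) (lin (- \<nu>) f g) = ip f f + (\<mu> - \<nu>) * ip f g - \<mu> * \<nu> * ip g g"
  using assms by (simp add: ip_lin_left ip_lin_right L2_lin ip_commute[of g f] algebra_simps)

text \<open>The right-hand side is the full coefficient of (d')^2 in the energy. Inserting
  \<mu>\<nu> = (D - b\<gamma>)/\<gamma>^2 splits it, up to the factor 1/\<gamma>^2, into D (\<gamma>
  - 2\<kappa>\<delta>b), nonnegative for small \<delta>, and 2\<kappa>\<delta>b^2\<gamma>, at least
  \<delta>b^2\<gamma>. So control of order \<delta> remains even when D = 0.\<close>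

lemma (in abcb_system) derivative_coefficient:
  assumes \<delta>: "\<delta> > 0" "2 * \<delta> * b \<le> \<gamma>" and \<kappa>: "1 / 2 \<le> \<kappa>" "\<kappa> \<le> 1"
  shows "b\<^sup>2 * \<delta> / \<gamma> \<le> D / \<gamma> - 2 * \<kappa> * \<delta> * b * (\<mu> * \<nu>)"
proof -
  have e: "\<mu> * \<nu> = (D - b * \<gamma>) / \<gamma>\<^sup>2" using mn_prod \<gamma> by (simp add: field_simps)
  have "0 \<le> D * (\<gamma> - 2 * \<kappa> * \<delta> * b)"
  proof (intro mult_nonneg_nonneg D)
    have "2 * \<delta> * b * \<kappa> \<le> 2 * \<delta> * b * 1" using \<delta> b \<kappa> by (intro mult_left_mono) auto
    then show "0 \<le> \<gamma> - 2 * \<kappa> * \<delta> * b" using \<delta>(2) unfolding mult_1_right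
      by (simp only: mult_ac diff_ge_0_iff_ge)
  qed
  moreover have "\<delta> * b\<^sup>2 * \<gamma> * 1 \<le> \<delta> * b\<^sup>2 * \<gamma> * (2 * \<kappa>)" using \<delta> \<gamma> \<kappa> by (intro mult_left_mono) auto
  ultimately have "0 \<le> D * \<gamma> - 2 * \<kappa> * \<delta> * b * (D - b * \<gamma>) - b\<^sup>2 * \<delta> * \<gamma>"
    by (simp add: algebra_simps power2_eq_square)
  then have "0 \<le> (D * \<gamma> - 2 * \<kappa> * \<delta> * b * (D - b * \<gamma>) - b\<^sup>2 * \<delta> * \<gamma>) / \<gamma>\<^sup>2" by simp
  also have "\<dots> = D / \<gamma> - 2 * \<kappa> * \<delta> * b * (\<mu> * \<nu>) - b\<^sup>2 * \<delta> / \<gamma>"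
    unfolding e using \<gamma> by (simp add: field_simps power2_eq_square)
  finally show ?thesis by simp
qed

text \<open>A, B, C, E stand for the norms of q, q', d, d', and S, T for the products of q with d
  and of q' with d'. Each mixed term is absorbed by Young's inequality at the cost of half the
  weight of the squares. The smallness of \<delta> lets half of C^2/\<delta> outweigh all bounded
  multiples of C^2 that arise.\<close>

lemma (in abcb_system) energy_coercive:
  assumes \<delta>: "\<delta> > 0" "\<delta> * (4 * (\<mu> - \<nu>)\<^sup>2 + 4 * \<bar>\<mu> * \<nu>\<bar>) \<le> 1" "2 * \<delta> * b \<le> \<gamma>"
    and \<kappa>: "1 / 2 \<le> \<kappa>" "\<kappa> \<le> 1" and S: "\<bar>S\<bar> \<le> A * C" and T: "\<bar>T\<bar> \<le> B * E"
    and nn: "0 \<le> A" "0 \<le> B" "0 \<le> C" "0 \<le> E"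
  shows "A\<^sup>2 / 2 + C\<^sup>2 / (2 * \<delta>) + \<gamma> * B\<^sup>2 / 2 + b\<^sup>2 * \<delta> / (2 * \<gamma>) * E\<^sup>2 \<le>
    C\<^sup>2 / \<delta> + \<gamma> * B\<^sup>2 + D / \<gamma> * E\<^sup>2 + 2 * \<kappa> * (A\<^sup>2 + (\<mu> - \<nu>) * S - \<mu> * \<nu> * C\<^sup>2)
      + 2 * \<kappa> * \<delta> * b * (B\<^sup>2 + (\<mu> - \<nu>) * T - \<mu> * \<nu> * E\<^sup>2)"
proof -
  define m where "m = \<mu> - \<nu>"
  define n where "n = \<mu> * \<nu>"
  have h1: "- (A\<^sup>2 / 2 + 2 * m\<^sup>2 * C\<^sup>2) \<le> 2 * \<kappa> * (m * S)"
  proof -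
    have "\<bar>2 * \<kappa> * (m * S)\<bar> = 2 * \<kappa> * (\<bar>m\<bar> * \<bar>S\<bar>)" using \<kappa> by (simp add: abs_mult)
    also have "\<dots> \<le> 2 * (\<bar>m\<bar> * (A * C))"
      using \<kappa> S by (intro mult_mono) auto
    also have "\<dots> \<le> A\<^sup>2 / 2 + 2 * m\<^sup>2 * C\<^sup>2"
    proof -
      have "0 \<le> (A - 2 * \<bar>m\<bar> * C)\<^sup>2" by simp
      then show ?thesis by (simp add: power2_diff power_mult_distrib algebra_simps)
    qed
    finally show ?thesis by linarith
  qed
  have h2: "- (2 * \<bar>n\<bar> * C\<^sup>2) \<le> 2 * \<kappa> * (- n * C\<^sup>2)"
  proof -
    have "\<bar>2 * \<kappa> * (n * C\<^sup>2)\<bar> = 2 * \<kappa> * (\<bar>n\<bar> * C\<^sup>2)" using \<kappa> by (simp add: abs_mult)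
    also have "\<dots> \<le> 2 * (\<bar>n\<bar> * C\<^sup>2)" using \<kappa> by (intro mult_right_mono) auto
    finally show ?thesis by (simp add: abs_le_iff)
  qed
  have h3: "C\<^sup>2 / (2 * \<delta>) + (2 * m\<^sup>2 + 2 * \<bar>n\<bar>) * C\<^sup>2 \<le> C\<^sup>2 / \<delta>"
  proof -
    have "(2 * m\<^sup>2 + 2 * \<bar>n\<bar>) * C\<^sup>2 \<le> 1 / (2 * \<delta>) * C\<^sup>2"
      using \<delta> by (intro mult_right_mono) (auto simp: m_def n_def field_simps)
    moreover have "C\<^sup>2 / \<delta> = C\<^sup>2 / (2 * \<delta>) + 1 / (2 * \<delta>) * C\<^sup>2" using \<delta>(1) by (simp add: field_simps)
    ultimately show ?thesis by linarith
  qed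
  have h4: "b\<^sup>2 * \<delta> / \<gamma> * E\<^sup>2 \<le> (D / \<gamma> - 2 * \<kappa> * \<delta> * b * n) * E\<^sup>2"
    using derivative_coefficient[OF \<delta>(1,3) \<kappa>] by (intro mult_right_mono) (auto simp: n_def)
  have h5: "- (b\<^sup>2 * \<delta> / (2 * \<gamma>) * E\<^sup>2 + \<gamma> * B\<^sup>2 / 2) \<le> 2 * \<kappa> * \<delta> * b * (m * T)"
  proof -
    have "\<bar>2 * \<kappa> * \<delta> * b * (m * T)\<bar> = 2 * \<kappa> * (\<delta> * b * (\<bar>m\<bar> * \<bar>T\<bar>))" using \<kappa> \<delta> b by (simp add: abs_mult)
    also have "\<dots> \<le> 2 * (\<delta> * b * (\<bar>m\<bar> * (B * E)))"
      using \<kappa> T \<delta> b by (intro mult_mono mult_nonneg_nonneg) auto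
    also have "\<dots> \<le> b\<^sup>2 * \<delta> / (2 * \<gamma>) * E\<^sup>2 + 2 * \<gamma> * \<delta> * m\<^sup>2 * B\<^sup>2"
    proof -
      \<comment> \<open>The weight spends exactly half of the b^2\<delta>/\<gamma> that
        \<open>h4\<close> secures for E^2. The other square, 2\<gamma>\<delta>m^2 B^2, costs at most
        half of \<gamma> B^2 because 4\<delta>m^2 \<le> 1.\<close>
      have "0 \<le> \<delta> / (2 * \<gamma>) * (b * E - 2 * \<gamma> * \<bar>m\<bar> * B)\<^sup>2" using \<delta> \<gamma> by simp
      also have "\<dots> = b\<^sup>2 * \<delta> / (2 * \<gamma>) * E\<^sup>2 + 2 * \<gamma> * \<delta> * m\<^sup>2 * B\<^sup>2 - 2 * (\<delta> * b * (\<bar>m\<bar> * (B * E)))"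
        using \<gamma> by (simp add: power2_diff power_mult_distrib field_simps) (simp add: power2_eq_square)
      finally show ?thesis by simp
    qed
    also have "2 * \<gamma> * \<delta> * m\<^sup>2 * B\<^sup>2 \<le> \<gamma> * B\<^sup>2 / 2"
    proof -
      have "\<delta> * (4 * m\<^sup>2) \<le> 1"
      proof -
        have "\<delta> * (4 * m\<^sup>2) \<le> \<delta> * (4 * m\<^sup>2 + 4 * \<bar>n\<bar>)" using \<delta> by (intro mult_left_mono) auto
        then show ?thesis using \<delta>(2) by (simp add: m_def n_def)
      qed
      then have "(\<gamma> * B\<^sup>2 / 2) * (\<delta> * (4 * m\<^sup>2)) \<le> (\<gamma> * B\<^sup>2 / 2) * 1" using \<gamma> by (intro mult_left_mono) auto
      then show ?thesis by (simp add: algebra_simps)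
    qed
    finally show ?thesis by linarith
  qed
  have h6: "A\<^sup>2 \<le> 2 * \<kappa> * A\<^sup>2" using mult_right_mono[of 1 "2 * \<kappa>" "A\<^sup>2"] \<kappa> by simp
  have h7: "0 \<le> 2 * \<kappa> * \<delta> * b * B\<^sup>2" using \<kappa> \<delta> b by simp
  have h8: "b\<^sup>2 * \<delta> / (2 * \<gamma>) * E\<^sup>2 + b\<^sup>2 * \<delta> / (2 * \<gamma>) * E\<^sup>2 = b\<^sup>2 * \<delta> / \<gamma> * E\<^sup>2"
    using \<gamma> by (simp add: field_simps)
  have "C\<^sup>2 / \<delta> + \<gamma> * B\<^sup>2 + D / \<gamma> * E\<^sup>2 + 2 * \<kappa> * (A\<^sup>2 + m * S - n * C\<^sup>2) + 2 * \<kappa> * \<delta> * b * (B\<^sup>2 + m * T - n * E\<^sup>2)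
    = C\<^sup>2 / \<delta> + \<gamma> * B\<^sup>2 + (D / \<gamma> - 2 * \<kappa> * \<delta> * b * n) * E\<^sup>2 + 2 * \<kappa> * A\<^sup>2 + 2 * \<kappa> * (m * S) + 2 * \<kappa> * (- n * C\<^sup>2)
      + 2 * \<kappa> * \<delta> * b * B\<^sup>2 + 2 * \<kappa> * \<delta> * b * (m * T)"
    by (simp add: algebra_simps)
  moreover have "A\<^sup>2 / 2 + C\<^sup>2 / (2 * \<delta>) + \<gamma> * B\<^sup>2 / 2 + b\<^sup>2 * \<delta> / (2 * \<gamma>) * E\<^sup>2 \<le> \<dots>"
    using h1 h2 h3 h4 h5 h6 h7 h8 unfolding distrib_right by linarith
  ultimately show ?thesis unfolding m_def n_def by simp
qed

text \<open>The Lagrange multiplier up to sign: half of l times the exponent 2/(p + 2) of scale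
  invariant minimality times the factor 2/(p + 1) of the constraint. The half comes from
  differentiating a quadratic energy.\<close>

definition mult_const :: "real \<Rightarrow> real \<Rightarrow> real" where
  "mult_const p l = 2 * l / ((p + 1) * (p + 2))"

section \<open>Scale invariant minimality and the Euler-Lagrange equations\<close>

context abcb_system
begin

text \<open>Derivatives are separate arguments, so that expanding the quadratic form is pure
  bilinear algebra, with no reference to how q' and d' arise.\<close>

definition energy_form :: "real \<Rightarrow> real \<Rightarrow> (real \<Rightarrow> real) \<Rightarrow> (real \<Rightarrow> real) \<Rightarrow> (real \<Rightarrow> real) \<Rightarrow> (real \<Rightarrow> real) \<Rightarrow> real" where
  "energy_form \<delta> \<kappa> q q' d d' = ip d d / \<delta> + \<gamma> * ip q' q' + D / \<gamma> * ip d' d'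
      + 2 * \<kappa> * ip (lin \<mu> q d) (lin (- \<nu>) q d) + 2 * \<kappa> * \<delta> * b * ip (lin \<mu> q' d') (lin (- \<nu>) q' d')"

text \<open>The sign is opposite to that of \<open>G\<close>: admissible pairs have the value 1, and
  real powers of the constraint make sense near them.\<close>

definition constraint_form :: "(real \<Rightarrow> real) \<Rightarrow> (real \<Rightarrow> real) \<Rightarrow> real" where
  "constraint_form q d = - (2 / (p + 1)) * ip (lin \<mu> q d) (\<lambda>x. pow_p1 p (lin (- \<nu>) q d x))"

text \<open>Minimality for a constraint of degree \<open>p + 2\<close> and a quadratic energy, in scale invariant form.\<close>
definition energy_min :: "real \<Rightarrow> real \<Rightarrow> real \<Rightarrow> bool" where
  "energy_min \<delta> \<kappa> l \<longleftrightarrow> (\<forall>u u' v v'. sob u u' \<longrightarrow> sob v v' \<longrightarrow> constraint_form u v > 0 \<longrightarrow>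
     l * constraint_form u v powr (2 / (p + 2)) \<le> energy_form \<delta> \<kappa> u u' v v')"

lemma energy_form_scale: "energy_form \<delta> \<kappa> (\<lambda>x. s * q x) (\<lambda>x. s * q' x) (\<lambda>x. s * d x) (\<lambda>x. s * d' x) = s\<^sup>2 * energy_form \<delta> \<kappa> q q' d d'"
proof -
  have l: "lin c (\<lambda>x. s * f x) (\<lambda>x. s * g x) = (\<lambda>x. s * lin c f g x)" for c f g by (simp add: lin_def fun_eq_iff algebra_simps)
  show ?thesis unfolding energy_form_def l ip_scale_left ip_scale_right by (simp add: algebra_simps power2_eq_square)
qed

lemma energy_form_nonneg:
  assumes "\<delta> > 0" "\<delta> * (4 * (\<mu> - \<nu>)\<^sup>2 + 4 * \<bar>\<mu> * \<nu>\<bar>) \<le> 1" "2 * \<delta> * b \<le> \<gamma>" "1 / 2 \<le> \<kappa>" "\<kappa> \<le> 1"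
    and s: "sob q q'" "sob d d'"
  shows "0 \<le> energy_form \<delta> \<kappa> q q' d d'"
proof -
  have L: "q \<in> L2" "q' \<in> L2" "d \<in> L2" "d' \<in> L2" using s by (auto dest: sob_L2)
  have "0 \<le> (l2 q)\<^sup>2 / 2 + (l2 d)\<^sup>2 / (2 * \<delta>) + \<gamma> * (l2 q')\<^sup>2 / 2 + b\<^sup>2 * \<delta> / (2 * \<gamma>) * (l2 d')\<^sup>2"
    using assms(1) \<gamma> by (intro add_nonneg_nonneg) auto
  also have "\<dots> \<le> energy_form \<delta> \<kappa> q q' d d'"
    using energy_coercive[OF assms(1-5) ip_Cauchy_Schwarz[OF L(1,3)] ip_Cauchy_Schwarz[OF L(2,4)] l2_nonneg l2_nonneg l2_nonneg l2_nonneg]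
    unfolding energy_form_def ip_zw[OF L(1,3)] ip_zw[OF L(2,4)] by (simp add: l2_sq)
  finally show ?thesis .
qed

text \<open>Along q + t\<phi>, d + t\<psi> the energy is l + 2t A1 + t^2 A2, where A1 is the
  left-hand side, and the constraint is differentiable at t = 0.
  \<open>homogeneous_minimum_stationary\<close> with exponent 2/(p + 2) then gives the
  equation.\<close>

lemma euler_lagrange:
  assumes s: "sob q q'" "sob d d'" and l: "energy_form \<delta> \<kappa> q q' d d' = l" and c: "constraint_form q d = 1"
    and min: "energy_min \<delta> \<kappa> l"
    and \<phi>: "sob \<phi> \<phi>'" and \<psi>: "sob \<psi> \<psi>'"
  shows "ip d \<psi> / \<delta> + \<gamma> * ip q' \<phi>' + D / \<gamma> * ip d' \<psi>'
      + \<kappa> * (ip (lin \<mu> q d) (lin (- \<nu>) \<phi> \<psi>) + ip (lin (- \<nu>) q d) (lin \<mu> \<phi> \<psi>))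
      + \<kappa> * \<delta> * b * (ip (lin \<mu> q' d') (lin (- \<nu>) \<phi>' \<psi>') + ip (lin (- \<nu>) q' d') (lin \<mu> \<phi>' \<psi>'))
    = - mult_const p l * (ip (\<lambda>x. pow_p1 p (lin (- \<nu>) q d x)) (lin \<mu> \<phi> \<psi>)
        + (p + 1) * ip (\<lambda>x. lin \<mu> q d x * pow_p p (lin (- \<nu>) q d x)) (lin (- \<nu>) \<phi> \<psi>))"
    (is "?A1 = - mult_const p l * ?N")
proof -
  have L [simp]: "q \<in> L2" "q' \<in> L2" "d \<in> L2" "d' \<in> L2" "\<phi> \<in> L2" "\<phi>' \<in> L2" "\<psi> \<in> L2" "\<psi>' \<in> L2"
    using s \<phi> \<psi> by (auto dest: sob_L2)
  have Ll [simp]: "lin c q d \<in> L2" "lin c q' d' \<in> L2" "lin c \<phi> \<psi> \<in> L2" "lin c \<phi>' \<psi>' \<in> L2" for c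
    by (simp_all add: L2_lin)
  have shift: "lin c (\<lambda>x. f x + t * g x) (\<lambda>x. h x + t * k x) = (\<lambda>x. lin c f h x + t * lin c g k x)" for c f g h k t
    by (simp add: lin_def fun_eq_iff algebra_simps)
  have expand: "ip (\<lambda>x. f x + t * g x) (\<lambda>x. h x + t * k x) = ip f h + t * (ip f k + ip g h) + t\<^sup>2 * ip g k"
    if "f \<in> L2" "g \<in> L2" "h \<in> L2" "k \<in> L2" for f g h k t
    using that by (simp add: ip_linear L2_closed algebra_simps power2_eq_square)
  define A2 where "A2 = energy_form \<delta> \<kappa> \<phi> \<phi>' \<psi> \<psi>'"
  have En: "energy_form \<delta> \<kappa> (\<lambda>x. q x + t * \<phi> x) (\<lambda>x. q' x + t * \<phi>' x) (\<lambda>x. d x + t * \<psi> x) (\<lambda>x. d' x + t * \<psi>' x)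
      = l + 2 * t * ?A1 + t\<^sup>2 * A2" for t
    unfolding A2_def l[symmetric] energy_form_def shift
    by (simp add: expand ip_commute[of \<phi>' q'] ip_commute[of \<psi> d] ip_commute[of \<psi>' d']
        ip_commute[of "lin \<mu> \<phi> \<psi>" "lin (- \<nu>) q d"] ip_commute[of "lin \<mu> \<phi>' \<psi>'" "lin (- \<nu>) q' d'"])
      (simp add: algebra_simps add_divide_distrib)
  define \<Gamma> where "\<Gamma> t = - (2 / (p + 1)) * (LINT x|lborel. (lin \<mu> q d x + t * lin \<mu> \<phi> \<psi> x) * pow_p1 p (lin (- \<nu>) q d x + t * lin (- \<nu>) \<phi> \<psi> x))" for t
  have \<Gamma>_eq: "\<Gamma> t = constraint_form (\<lambda>x. q x + t * \<phi> x) (\<lambda>x. d x + t * \<psi> x)" for t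
    unfolding \<Gamma>_def constraint_form_def shift ip_def ..
  obtain B where B: "\<And>x. \<bar>lin (- \<nu>) q d x\<bar> \<le> B" "\<And>x. \<bar>lin (- \<nu>) \<phi> \<psi> x\<bar> \<le> B"
  proof -
    have "\<exists>B. \<forall>x. \<bar>f x\<bar> \<le> B" if "sob f f'" for f f' using sob_bounded[OF that] by blast
    then obtain B1 B2 where "\<forall>x. \<bar>lin (- \<nu>) q d x\<bar> \<le> B1" "\<forall>x. \<bar>lin (- \<nu>) \<phi> \<psi> x\<bar> \<le> B2"
      using sob_lin[OF s] sob_lin[OF \<phi> \<psi>] by metis
    then show ?thesis by (intro that[of "max B1 B2"]) (auto simp: le_max_iff_disj)
  qed
  have "(\<Gamma> has_real_derivative - (2 / (p + 1)) * ?N) (at 0)"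
    unfolding \<Gamma>_def by (intro DERIV_cmult constraint_has_derivative[OF p Ll(1) Ll(1) Ll(3) Ll(3) B])
  then have A: "2 * ?A1 = l * (2 / (p + 2)) * (- (2 / (p + 1)) * ?N)"
  proof (rule homogeneous_minimum_stationary)
    show "\<Gamma> 0 = 1" using c by (simp add: \<Gamma>_eq)
    show "l * \<Gamma> t powr (2 / (p + 2)) \<le> l + 2 * t * ?A1 + t\<^sup>2 * A2" if "\<Gamma> t > 0" for t
      unfolding En[symmetric] using that unfolding \<Gamma>_eq
      by (intro min[unfolded energy_min_def, rule_format] sob_add sob_scale s \<phi> \<psi>)
  qed
  have B: "l * (2 / (p + 2)) * (- (2 / (p + 1)) * n) = 2 * (- mult_const p l * n)" for n
    unfolding mult_const_def using p by (simp add: divide_simps)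
  have half: "2 * x = 2 * n \<Longrightarrow> x = n" for x n :: real by simp
  show ?thesis by (rule half[OF A[unfolded B]])
qed

text \<open>The integral is homogeneous of degree p + 2 and has the sign of the multiplier, so a
  negative multiple -t of a nonnegative bump works, with t^(p+2) = (p + 1)/(2K).\<close>

lemma admissible_exists: "\<exists>\<phi> \<phi>'. sob \<phi> \<phi>' \<and> ip \<phi> (\<lambda>x. pow_p1 p (\<phi> x)) = - (p + 1) / 2"
proof -
  define \<rho> where "\<rho> = bump 1 0 1"
  have s: "sob \<rho> (deriv \<rho>)" unfolding \<rho>_def by (intro sob_test_function test_function_bump) simp
  have pos: "0 \<le> \<rho> x" for x unfolding \<rho>_def by (rule bump_bounds) simp
  have NL: "(\<lambda>x. pow_p1 p (\<rho> x)) \<in> L2"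
    by (rule L2_pow_p1(1)[OF p sob_L2(1)[OF s] sob_bounded[OF s]])
  define K where "K = ip \<rho> (\<lambda>x. pow_p1 p (\<rho> x))"
  have "K \<noteq> 0"
  proof
    assume "K = 0"
    then have "AE x in lborel. \<rho> x * pow_p1 p (\<rho> x) = 0"
      using integral_nonneg_eq_0_iff_AE[OF L2_mult_integrable[OF sob_L2(1)[OF s] NL]] pos pow_p1_nonneg
      by (simp add: K_def ip_def)
    then have "AE x in lborel. bump 1 0 1 x = 0"
      by eventually_elim (auto simp: \<rho>_def pow_p1_def)
    then show False using bump_not_AE_zero by blast
  qed
  moreover have "0 \<le> K" unfolding K_def ip_def using pos pow_p1_nonneg by simp
  ultimately have K: "K > 0" by simp
  define t where "t = ((p + 1) / (2 * K)) powr (1 / (p + 2))"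
  have q: "(p + 1) / (2 * K) > 0" using K p by simp
  have t: "t > 0" unfolding t_def powr_gt_zero by (rule less_imp_neq[OF q, symmetric])
  have tp: "t * t powr (p + 1) = (p + 1) / (2 * K)"
  proof -
    have "t * t powr (p + 1) = t powr (1 + (p + 1))" using t by (simp only: powr_add powr_one)
    also have "\<dots> = ((p + 1) / (2 * K)) powr (1 / (p + 2) * (1 + (p + 1)))" unfolding t_def by (rule powr_powr)
    also have "1 / (p + 2) * (1 + (p + 1)) = 1" using p by (simp add: field_simps)
    also have "((p + 1) / (2 * K)) powr 1 = (p + 1) / (2 * K)" by (rule powr_one[OF less_imp_le[OF q]])
    finally show ?thesis .
  qed
  have "ip (\<lambda>x. - t * \<rho> x) (\<lambda>x. pow_p1 p (- t * \<rho> x)) = - t * (t powr (p + 1) * K)"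
  proof -
    have "pow_p1 p (- t * \<rho> x) = t powr (p + 1) * pow_p1 p (\<rho> x)" for x
      using pow_p1_scale[OF t, of p "\<rho> x"] by (simp add: pow_p1_def)
    then show ?thesis unfolding K_def by (simp only: ip_scale_left ip_scale_right)
  qed
  also have "\<dots> = - (p + 1) / 2" using tp K by (simp add: mult.assoc[symmetric]) (simp add: field_simps)
  finally show ?thesis using sob_scale[OF s, of "- t"] by blast
qed

end

text \<open>The directions (\<phi>, 0) and (0, \<phi>) in the coordinates (q, d), that is (\<phi>,
  \<phi>) and (\<mu>\<phi>, -\<nu>\<phi>) in (z, w). Only the second one sees the singular
  term.\<close>

lemma (in abcb_system) euler_lagrange_components:
  assumes s: "sob q q'" "sob d d'" and l: "energy_form \<delta> \<kappa> q q' d d' = l" and c: "constraint_form q d = 1"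
    and min: "energy_min \<delta> \<kappa> l"
    and \<phi>: "sob \<phi> \<phi>'"
  shows "\<gamma> * ip q' \<phi>' + \<kappa> * (ip (lin \<mu> q d) \<phi> + ip (lin (- \<nu>) q d) \<phi>)
      + \<kappa> * \<delta> * b * (ip (lin \<mu> q' d') \<phi>' + ip (lin (- \<nu>) q' d') \<phi>')
      = - mult_const p l * (ip (\<lambda>x. pow_p1 p (lin (- \<nu>) q d x)) \<phi>
          + (p + 1) * ip (\<lambda>x. lin \<mu> q d x * pow_p p (lin (- \<nu>) q d x)) \<phi>)"
    and "ip d \<phi> / \<delta> + D / \<gamma> * ip d' \<phi>'
      + \<kappa> * (\<mu> * ip (lin (- \<nu>) q d) \<phi> - \<nu> * ip (lin \<mu> q d) \<phi>)
      + \<kappa> * \<delta> * b * (\<mu> * ip (lin (- \<nu>) q' d') \<phi>' - \<nu> * ip (lin \<mu> q' d') \<phi>')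
      = - mult_const p l * (\<mu> * ip (\<lambda>x. pow_p1 p (lin (- \<nu>) q d x)) \<phi>
          - \<nu> * (p + 1) * ip (\<lambda>x. lin \<mu> q d x * pow_p p (lin (- \<nu>) q d x)) \<phi>)"
proof -
  have lz: "lin s f (\<lambda>x. 0) = f" "lin s (\<lambda>x. 0) f = (\<lambda>x. s * f x)" for s f by (auto simp: lin_def)
  have ipz: "ip f (\<lambda>x. 0) = 0" for f by (simp add: ip_def)
  note EL = euler_lagrange[OF s l c min]
  show "\<gamma> * ip q' \<phi>' + \<kappa> * (ip (lin \<mu> q d) \<phi> + ip (lin (- \<nu>) q d) \<phi>)
      + \<kappa> * \<delta> * b * (ip (lin \<mu> q' d') \<phi>' + ip (lin (- \<nu>) q' d') \<phi>')
      = - mult_const p l * (ip (\<lambda>x. pow_p1 p (lin (- \<nu>) q d x)) \<phi>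
          + (p + 1) * ip (\<lambda>x. lin \<mu> q d x * pow_p p (lin (- \<nu>) q d x)) \<phi>)"
    using EL[OF \<phi> sob_zero] unfolding lz ipz by simp
  show "ip d \<phi> / \<delta> + D / \<gamma> * ip d' \<phi>'
      + \<kappa> * (\<mu> * ip (lin (- \<nu>) q d) \<phi> - \<nu> * ip (lin \<mu> q d) \<phi>)
      + \<kappa> * \<delta> * b * (\<mu> * ip (lin (- \<nu>) q' d') \<phi>' - \<nu> * ip (lin \<mu> q' d') \<phi>')
      = - mult_const p l * (\<mu> * ip (\<lambda>x. pow_p1 p (lin (- \<nu>) q d x)) \<phi>
          - \<nu> * (p + 1) * ip (\<lambda>x. lin \<mu> q d x * pow_p p (lin (- \<nu>) q d x)) \<phi>)"
    using EL[OF sob_zero \<phi>] unfolding lz ipz ip_scale_right by (simp add: algebra_simps)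
qed

section \<open>Sequences of minimizers: uniform bounds and the momentum\<close>

locale minimizing_sequence = abcb_system +
  fixes \<delta> \<kappa> lam :: "nat \<Rightarrow> real" and q q' d d' :: "nat \<Rightarrow> real \<Rightarrow> real"
  assumes sq: "\<And>j. sob (q j) (q' j)" and sd: "\<And>j. sob (d j) (d' j)"
    and \<delta>_pos: "\<And>j. 0 < \<delta> j"
    and \<delta>_small: "\<And>j. \<delta> j * (4 * (\<mu> - \<nu>)\<^sup>2 + 4 * \<bar>\<mu> * \<nu>\<bar>) \<le> 1" "\<And>j. 2 * \<delta> j * b \<le> \<gamma>"
    and \<delta>_lim: "\<delta> \<longlonglongrightarrow> 0"
    and \<kappa>_bounds: "\<And>j. 1 / 2 \<le> \<kappa> j" "\<And>j. \<kappa> j \<le> 1" and \<kappa>_lim: "\<kappa> \<longlonglongrightarrow> 1 / 2"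
    and energy: "\<And>j. energy_form (\<delta> j) (\<kappa> j) (q j) (q' j) (d j) (d' j) = lam j"
    and constraint: "\<And>j. constraint_form (q j) (d j) = 1"
    and minimal: "\<And>j. energy_min (\<delta> j) (\<kappa> j) (lam j)"

lemma minimizing_sequence_subseq:
  assumes "minimizing_sequence \<gamma> b D \<mu> \<nu> p \<delta> \<kappa> lam q q' d d'" "strict_mono r"
  shows "minimizing_sequence \<gamma> b D \<mu> \<nu> p (\<lambda>j. \<delta> (r j)) (\<lambda>j. \<kappa> (r j)) (\<lambda>j. lam (r j))
    (\<lambda>j. q (r j)) (\<lambda>j. q' (r j)) (\<lambda>j. d (r j)) (\<lambda>j. d' (r j))"
proof -
  interpret minimizing_sequence \<gamma> b D \<mu> \<nu> p \<delta> \<kappa> lam q q' d d' by fact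
  have l: "(\<lambda>j. \<delta> (r j)) \<longlonglongrightarrow> 0" "(\<lambda>j. \<kappa> (r j)) \<longlonglongrightarrow> 1 / 2"
    using LIMSEQ_subseq_LIMSEQ[OF \<delta>_lim assms(2)] LIMSEQ_subseq_LIMSEQ[OF \<kappa>_lim assms(2)] by (simp_all add: o_def)
  show ?thesis
    by unfold_locales (fact sq sd \<delta>_pos \<delta>_small l \<kappa>_bounds energy constraint minimal)+
qed

lemma lin_translate: "lin c (\<lambda>x. f (x + y)) (\<lambda>x. g (x + y)) = (\<lambda>x. lin c f g (x + y))"
  by (simp add: lin_def fun_eq_iff)

lemma minimizing_sequence_translate:
  assumes "minimizing_sequence \<gamma> b D \<mu> \<nu> p \<delta> \<kappa> lam q q' d d'"
  shows "minimizing_sequence \<gamma> b D \<mu> \<nu> p \<delta> \<kappa> lam (\<lambda>j x. q j (x + y j)) (\<lambda>j x. q' j (x + y j))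
     (\<lambda>j x. d j (x + y j)) (\<lambda>j x. d' j (x + y j))"
proof -
  interpret minimizing_sequence \<gamma> b D \<mu> \<nu> p \<delta> \<kappa> lam q q' d d' by fact
  have E: "energy_form s k (\<lambda>x. f (x + t)) (\<lambda>x. f' (x + t)) (\<lambda>x. g (x + t)) (\<lambda>x. g' (x + t)) = energy_form s k f f' g g'"
    for s k t f f' g g' unfolding energy_form_def lin_translate ip_translate ..
  have C: "constraint_form (\<lambda>x. f (x + t)) (\<lambda>x. g (x + t)) = constraint_form f g" for t f g
    using ip_translate[of "lin \<mu> f g" t "\<lambda>x. pow_p1 p (lin (- \<nu>) f g x)"] unfolding constraint_form_def lin_translate by simp
  show ?thesis
    by (unfold_locales, unfold E C)
      (fact sob_translate[OF sq] sob_translate[OF sd] \<delta>_pos \<delta>_small \<delta>_lim \<kappa>_bounds \<kappa>_lim energy constraint minimal)+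
qed

text \<open>The terms of the first Euler-Lagrange equation that multiply \<phi> rather than \<phi>'.
  The equation says that this is the weak derivative of the momentum.\<close>

definition force :: "real \<Rightarrow> real \<Rightarrow> real \<Rightarrow> (real \<Rightarrow> real) \<Rightarrow> (real \<Rightarrow> real) \<Rightarrow> real \<Rightarrow> real" where
  "force p \<kappa> l z w x = \<kappa> * (z x + w x) + mult_const p l * (pow_p1 p (w x) + (p + 1) * (z x * pow_p p (w x)))"

context minimizing_sequence
begin

abbreviation "z j \<equiv> lin \<mu> (q j) (d j)"
abbreviation "w j \<equiv> lin (- \<nu>) (q j) (d j)"
abbreviation "z' j \<equiv> lin \<mu> (q' j) (d' j)"
abbreviation "w' j \<equiv> lin (- \<nu>) (q' j) (d' j)"
abbreviation "\<Lambda> j \<equiv> mult_const p (lam j)"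

lemma L [simp]: "q j \<in> L2" "q' j \<in> L2" "d j \<in> L2" "d' j \<in> L2"
  using sq[of j] sd[of j] by (auto dest: sob_L2)

lemma Lzw [simp]: "z j \<in> L2" "w j \<in> L2" "z' j \<in> L2" "w' j \<in> L2"
  by (simp_all add: L2_lin)

lemma energy_eq: "ip (d j) (d j) / \<delta> j + \<gamma> * ip (q' j) (q' j) + D / \<gamma> * ip (d' j) (d' j)
    + 2 * \<kappa> j * ip (z j) (w j) + 2 * \<kappa> j * \<delta> j * b * ip (z' j) (w' j) = lam j"
  using energy[of j] unfolding energy_form_def .

lemma constraint_eq: "ip (z j) (\<lambda>x. pow_p1 p (w j x)) = - (p + 1) / 2"
  using constraint[of j] p by (simp add: constraint_form_def field_simps)

lemmas EL1 = euler_lagrange_components(1)[OF sq sd energy constraint minimal]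
lemmas EL2 = euler_lagrange_components(2)[OF sq sd energy constraint minimal]

text \<open>The competitor z = w = \<phi> has d = 0 and avoids the singular term. A fixed \<phi>
  bounds all minimal values, and in the limit the bound becomes the energy of the limiting
  problem.\<close>

lemma lam_le:
  assumes "sob \<phi> \<phi>'" "ip \<phi> (\<lambda>x. pow_p1 p (\<phi> x)) = - (p + 1) / 2"
  shows "lam j \<le> (\<gamma> + 2 * \<kappa> j * \<delta> j * b) * ip \<phi>' \<phi>' + 2 * \<kappa> j * ip \<phi> \<phi>"
proof -
  have l: "lin s f (\<lambda>x. 0) = f" for s f by (simp add: lin_def fun_eq_iff)
  have "constraint_form \<phi> (\<lambda>x. 0) = 1" unfolding constraint_form_def l assms(2) using p by (simp add: field_simps)
  then show ?thesis
    using minimal[of j, unfolded energy_min_def, rule_format, OF assms(1) sob_zero] unfolding energy_form_def l by (simp add: ip_def algebra_simps)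
qed

text \<open>A fixed competitor bounds \<open>lam\<close> from above, and coercivity turns this into
  bounds for the norms. The sup bound of d is the delicate one: |d| is of order sqrt \<delta> and
  |d'| at most of order 1/sqrt \<delta>, so the interpolation inequality, being a product, still
  gives a bound independent of j.\<close>

lemma uniform_bounds:
  obtains R where "R > 0" "\<And>j. l2 (q j) \<le> R" "\<And>j. l2 (q' j) \<le> R" "\<And>j. (l2 (d j))\<^sup>2 \<le> R * \<delta> j"
    "\<And>j. \<delta> j * (l2 (d' j))\<^sup>2 \<le> R" "\<And>j x. \<bar>q j x\<bar> \<le> R" "\<And>j x. \<bar>d j x\<bar> \<le> R"
    "\<And>j x. \<bar>z j x\<bar> \<le> R" "\<And>j x. \<bar>w j x\<bar> \<le> R" "\<And>j. 0 \<le> lam j" "\<And>j. lam j \<le> R"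
proof -
  obtain \<phi> \<phi>' where \<phi>: "sob \<phi> \<phi>'" "ip \<phi> (\<lambda>x. pow_p1 p (\<phi> x)) = - (p + 1) / 2" using admissible_exists by blast
  define K where "K = 2 * \<gamma> * ip \<phi>' \<phi>' + 2 * ip \<phi> \<phi> + 1"
  have K1: "K \<ge> 1" using \<gamma> by (simp add: K_def ip_self_nonneg)
  have lamK: "lam j \<le> K" for j
  proof -
    have "\<kappa> j * (2 * \<delta> j * b) \<le> 1 * \<gamma>"
      using \<kappa>_bounds[of j] \<delta>_small(2)[of j] \<delta>_pos[of j] b by (intro mult_mono) auto
    then have "(\<gamma> + 2 * \<kappa> j * \<delta> j * b) * ip \<phi>' \<phi>' \<le> (2 * \<gamma>) * ip \<phi>' \<phi>'"
      by (intro mult_right_mono ip_self_nonneg) (simp add: mult_ac)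
    moreover have "2 * \<kappa> j * ip \<phi> \<phi> \<le> 2 * ip \<phi> \<phi>"
      using \<kappa>_bounds[of j] by (intro mult_right_mono ip_self_nonneg) auto
    ultimately show ?thesis using lam_le[OF \<phi>, of j] by (simp add: K_def)
  qed
  have coer: "(l2 (q j))\<^sup>2 / 2 + (l2 (d j))\<^sup>2 / (2 * \<delta> j) + \<gamma> * (l2 (q' j))\<^sup>2 / 2 + b\<^sup>2 * \<delta> j / (2 * \<gamma>) * (l2 (d' j))\<^sup>2 \<le> lam j" for j
    using energy_coercive[OF \<delta>_pos[of j] \<delta>_small[of j] \<kappa>_bounds[of j] ip_Cauchy_Schwarz ip_Cauchy_Schwarz, of "q j" "d j" "q' j" "d' j"]
      energy_eq[of j] by (simp add: ip_zw l2_sq l2_nonneg)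
  have nn: "0 \<le> (l2 (d j))\<^sup>2 / (2 * \<delta> j)" "0 \<le> \<gamma> * (l2 (q' j))\<^sup>2 / 2" "0 \<le> b\<^sup>2 * \<delta> j / (2 * \<gamma>) * (l2 (d' j))\<^sup>2"
     "0 \<le> (l2 (q j))\<^sup>2 / 2" for j
    using \<delta>_pos[of j] \<gamma> by auto
  have lam0: "0 \<le> lam j" for j using coer[of j] nn[of j] by linarith
  define K2 where "K2 = 2 * K + 2 * K / \<gamma> + 2 * \<gamma> * K / b\<^sup>2"
  have K2: "2 * K \<le> K2" "2 * K / \<gamma> \<le> K2" "2 * \<gamma> * K / b\<^sup>2 \<le> K2" "0 \<le> K2"
    using K1 \<gamma> by (auto simp: K2_def)
  have q2: "(l2 (q j))\<^sup>2 \<le> K2" for j using coer[of j] nn[of j] lamK[of j] K2(1) by linarith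
  have q'2: "(l2 (q' j))\<^sup>2 \<le> K2" for j
  proof -
    have "\<gamma> * (l2 (q' j))\<^sup>2 / 2 \<le> K" using coer[of j] nn[of j] lamK[of j] by linarith
    then have "(l2 (q' j))\<^sup>2 \<le> 2 * K / \<gamma>" using \<gamma> by (simp add: field_simps)
    then show ?thesis using K2(2) by simp
  qed
  have d2: "(l2 (d j))\<^sup>2 \<le> K2 * \<delta> j" for j
  proof -
    have "(l2 (d j))\<^sup>2 / (2 * \<delta> j) \<le> K" using coer[of j] nn[of j] lamK[of j] by linarith
    then have "(l2 (d j))\<^sup>2 \<le> 2 * K * \<delta> j" using \<delta>_pos[of j] by (simp add: field_simps)
    also have "\<dots> \<le> K2 * \<delta> j" using K2(1) less_imp_le[OF \<delta>_pos[of j]] by (intro mult_right_mono)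
    finally show ?thesis .
  qed
  have d'2: "\<delta> j * (l2 (d' j))\<^sup>2 \<le> K2" for j
  proof -
    have "b\<^sup>2 * \<delta> j / (2 * \<gamma>) * (l2 (d' j))\<^sup>2 \<le> K" using coer[of j] nn[of j] lamK[of j] by linarith
    then have "\<delta> j * (l2 (d' j))\<^sup>2 \<le> 2 * \<gamma> * K / b\<^sup>2" using \<gamma> b by (simp add: field_simps)
    then show ?thesis using K2(3) by simp
  qed
  \<comment> \<open>Since K3 \<ge> 1, a bound t^2 \<le> K2 implies t^2 \<le> K3^2; this avoids
    square roots of K2.\<close>
  define K3 where "K3 = K2 + 1"
  have le3: "t \<le> K3" if "t\<^sup>2 \<le> K2" for t :: real
  proof (rule power2_le_imp_le)
    have "1 * K3 \<le> K3 * K3" using K2 by (intro mult_right_mono) (auto simp: K3_def)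
    then show "t\<^sup>2 \<le> K3\<^sup>2" using that by (simp add: power2_eq_square K3_def)
  qed (use K2 in \<open>simp add: K3_def\<close>)
  have qx: "\<bar>q j x\<bar> \<le> 4 * K3" for j x
    using sob_bounded[OF sq[of j], of x] le3[OF q2[of j]] le3[OF q'2[of j]] by argo
  have dx: "\<bar>d j x\<bar> \<le> 2 * K3" for j x
  proof -
    have "(l2 (d j) * l2 (d' j))\<^sup>2 \<le> (K2 * \<delta> j) * (l2 (d' j))\<^sup>2"
      unfolding power_mult_distrib by (intro mult_right_mono d2) simp
    also have "\<dots> = K2 * (\<delta> j * (l2 (d' j))\<^sup>2)" by simp
    also have "\<dots> \<le> K2 * K2" by (intro mult_left_mono d'2 K2)
    finally have "(l2 (d j) * l2 (d' j))\<^sup>2 \<le> K2\<^sup>2" by (simp add: power2_eq_square)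
    then have "l2 (d j) * l2 (d' j) \<le> K2" by (rule power2_le_imp_le) fact
    then have "(d j x)\<^sup>2 \<le> 4 * K2" using sob_sup_interpolation[OF sd[of j], of x] by linarith
    also have "\<dots> \<le> (2 * K3)\<^sup>2"
      unfolding power_mult_distrib K3_def using K2(4) by (simp add: power2_eq_square algebra_simps)
    finally have "\<bar>d j x\<bar>\<^sup>2 \<le> (2 * K3)\<^sup>2" by simp
    then show ?thesis by (rule power2_le_imp_le) (use K2 in \<open>simp add: K3_def\<close>)
  qed
  define M1 where "M1 = \<bar>\<mu>\<bar> * (2 * K3)"
  define M2 where "M2 = \<bar>\<nu>\<bar> * (2 * K3)"
  define R where "R = 4 * K3 + M1 + M2 + K"
  have K3p: "K3 > 0" using K2 by (simp add: K3_def)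
  have mun: "0 \<le> M1" "0 \<le> M2" using K3p by (auto simp: M1_def M2_def)
  have RK: "K2 \<le> R" "K3 \<le> R" "4 * K3 \<le> R" "2 * K3 \<le> R" "K \<le> R" "R > 0"
    using mun K1 K3p unfolding R_def K3_def by auto
  have zx: "\<bar>z j x\<bar> \<le> R" "\<bar>w j x\<bar> \<le> R" for j x
  proof -
    have "\<bar>\<mu> * d j x\<bar> \<le> M1" "\<bar>- \<nu> * d j x\<bar> \<le> M2"
      unfolding M1_def M2_def abs_mult abs_minus_cancel by (intro mult_left_mono dx; simp)+
    then show "\<bar>z j x\<bar> \<le> R" "\<bar>w j x\<bar> \<le> R"
      using qx[of j x] mun K1 unfolding lin_def R_def by linarith+
  qed
  show ?thesis
  proof (rule that[OF RK(6)])
    show "l2 (q j) \<le> R" "l2 (q' j) \<le> R" "lam j \<le> R" for j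
      using le3[OF q2[of j]] le3[OF q'2[of j]] lamK[of j] RK by auto
    show "(l2 (d j))\<^sup>2 \<le> R * \<delta> j" for j
      by (rule order_trans[OF d2 mult_right_mono[OF RK(1) less_imp_le[OF \<delta>_pos]]])
    show "\<delta> j * (l2 (d' j))\<^sup>2 \<le> R" for j using d'2[of j] RK(1) by simp
    show "\<bar>q j x\<bar> \<le> R" "\<bar>d j x\<bar> \<le> R" for j x using qx[of j x] dx[of j x] RK by auto
  qed (fact zx lam0)+
qed

lemma l2_d_tendsto: "(\<lambda>j. l2 (d j)) \<longlonglongrightarrow> 0"
proof -
  obtain R where R: "\<And>j. (l2 (d j))\<^sup>2 \<le> R * \<delta> j" using uniform_bounds by metis
  have "(\<lambda>j. R * \<delta> j) \<longlonglongrightarrow> R * 0" by (intro tendsto_intros \<delta>_lim)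
  then have "(\<lambda>j. (l2 (d j))\<^sup>2) \<longlonglongrightarrow> 0"
    by (intro tendsto_sandwich[where f = "\<lambda>n. 0" and g = "\<lambda>j. (l2 (d j))\<^sup>2", OF _ _ tendsto_const] always_eventually)
      (use R in auto)
  then have "(\<lambda>j. sqrt ((l2 (d j))\<^sup>2)) \<longlonglongrightarrow> sqrt 0" by (rule tendsto_real_sqrt)
  then show ?thesis by (simp add: l2_nonneg)
qed

lemma delta_l2_d'_tendsto: "(\<lambda>j. \<delta> j * l2 (d' j)) \<longlonglongrightarrow> 0"
proof -
  obtain R where R: "\<And>j. \<delta> j * (l2 (d' j))\<^sup>2 \<le> R" using uniform_bounds by metis
  have "(\<lambda>j. \<delta> j * R) \<longlonglongrightarrow> 0 * R" by (intro tendsto_intros \<delta>_lim)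
  moreover have "(\<delta> j * l2 (d' j))\<^sup>2 \<le> \<delta> j * R" for j
    using mult_left_mono[OF R[of j], of "\<delta> j"] \<delta>_pos[of j] by (simp add: power2_eq_square mult_ac)
  ultimately have "(\<lambda>j. (\<delta> j * l2 (d' j))\<^sup>2) \<longlonglongrightarrow> 0"
    by (intro tendsto_sandwich[where f = "\<lambda>n. 0" and g = "\<lambda>j. (\<delta> j * l2 (d' j))\<^sup>2", OF _ _ tendsto_const] always_eventually) auto
  then have "(\<lambda>j. sqrt ((\<delta> j * l2 (d' j))\<^sup>2)) \<longlonglongrightarrow> sqrt 0" by (rule tendsto_real_sqrt)
  moreover have "sqrt ((\<delta> j * l2 (d' j))\<^sup>2) = \<delta> j * l2 (d' j)" for j
    using \<delta>_pos[of j] l2_nonneg[of "d' j"] by simp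
  ultimately show ?thesis by simp
qed

text \<open>Replacing (z, w) by (q, q) in the constraint changes the integral by O(|d|), eventually
  less than 1/4. If |q| were below c everywhere, the integral for (q, q) would be at most c^p R^2 =
  1/4, which fixes c. Together this stays below 1/2, but the constraint prescribes the modulus (p +
  1)/2.\<close>

lemma nonvanishing: "\<exists>c>0. \<forall>\<^sub>F j in sequentially. \<exists>y. c \<le> \<bar>q j y\<bar>"
proof -
  obtain R where R: "R > 0" "\<And>j. l2 (q j) \<le> R" "\<And>j x. \<bar>q j x\<bar> \<le> R" "\<And>j x. \<bar>w j x\<bar> \<le> R"
    using uniform_bounds by metis
  define N where "N j x = pow_p1 p (w j x)" for j x
  define M where "M j x = pow_p1 p (q j x)" for j x
  have NL: "N j \<in> L2" "M j \<in> L2" for j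
    unfolding N_def M_def using L2_pow_p1(1)[OF p Lzw(2) R(4)] L2_pow_p1(1)[OF p L(1) R(3)] by simp_all
  have Nl: "l2 (N j) \<le> R powr p * l2 (w j)" for j
    unfolding N_def by (intro L2_pow_p1[OF p] R Lzw)
  have diff: "\<bar>ip (z j) (N j) - ip (q j) (M j)\<bar> \<le> (\<bar>\<mu>\<bar> * (R powr p * (R + \<bar>\<nu>\<bar> * l2 (d j))) + R * ((p + 1) * R powr p * \<bar>\<nu>\<bar>)) * l2 (d j)" for j
  proof -
    have wl: "l2 (w j) \<le> R + \<bar>\<nu>\<bar> * l2 (d j)"
      using l2_lin[of "q j" "d j" "- \<nu>"] R(2)[of j] by simp
    have "ip (z j) (N j) - ip (q j) (M j) = \<mu> * ip (d j) (N j) + ip (q j) (\<lambda>x. N j x - M j x)"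
      using NL by (simp add: ip_lin_left ip_diff_right)
    also have "\<bar>\<dots>\<bar> \<le> \<bar>\<mu>\<bar> * \<bar>ip (d j) (N j)\<bar> + \<bar>ip (q j) (\<lambda>x. N j x - M j x)\<bar>"
      by (metis abs_mult abs_triangle_ineq)
    also have "\<dots> \<le> \<bar>\<mu>\<bar> * (l2 (d j) * l2 (N j)) + l2 (q j) * l2 (\<lambda>x. N j x - M j x)"
      by (intro add_mono mult_left_mono ip_Cauchy_Schwarz L NL L2_diff) auto
    also have "\<dots> \<le> \<bar>\<mu>\<bar> * (l2 (d j) * (R powr p * (R + \<bar>\<nu>\<bar> * l2 (d j)))) + R * ((p + 1) * R powr p * (\<bar>\<nu>\<bar> * l2 (d j)))"
    proof (intro add_mono mult_left_mono mult_mono)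
      show "l2 (N j) \<le> R powr p * (R + \<bar>\<nu>\<bar> * l2 (d j))"
        using Nl[of j] mult_left_mono[OF wl, of "R powr p"] by simp
      have "l2 (\<lambda>x. N j x - M j x) \<le> (p + 1) * R powr p * l2 (\<lambda>x. w j x - q j x)"
        unfolding N_def M_def by (intro pow_p1_L2_lipschitz p R L Lzw)
      also have "(\<lambda>x. w j x - q j x) = (\<lambda>x. - \<nu> * d j x)" by (simp add: lin_def fun_eq_iff)
      finally show "l2 (\<lambda>x. N j x - M j x) \<le> (p + 1) * R powr p * (\<bar>\<nu>\<bar> * l2 (d j))"
        by (simp add: l2_scale[of "- \<nu>", simplified])
    qed (use R l2_nonneg in auto)
    also have "\<dots> = (\<bar>\<mu>\<bar> * (R powr p * (R + \<bar>\<nu>\<bar> * l2 (d j))) + R * ((p + 1) * R powr p * \<bar>\<nu>\<bar>)) * l2 (d j)"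
      by (simp add: algebra_simps)
    finally show ?thesis .
  qed
  have "(\<lambda>j. (\<bar>\<mu>\<bar> * (R powr p * (R + \<bar>\<nu>\<bar> * l2 (d j))) + R * ((p + 1) * R powr p * \<bar>\<nu>\<bar>)) * l2 (d j)) \<longlonglongrightarrow>
      (\<bar>\<mu>\<bar> * (R powr p * (R + \<bar>\<nu>\<bar> * 0)) + R * ((p + 1) * R powr p * \<bar>\<nu>\<bar>)) * 0"
    by (intro tendsto_intros l2_d_tendsto)
  then have small: "\<forall>\<^sub>F j in sequentially. (\<bar>\<mu>\<bar> * (R powr p * (R + \<bar>\<nu>\<bar> * l2 (d j))) + R * ((p + 1) * R powr p * \<bar>\<nu>\<bar>)) * l2 (d j) < 1 / 4"
    by (rule order_tendstoD) simp
  define c where "c = (1 / (4 * R\<^sup>2)) powr (1 / p)"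
  have c: "c > 0" "c powr p = 1 / (4 * R\<^sup>2)" using R(1) p by (auto simp: c_def powr_powr)
  have "\<forall>\<^sub>F j in sequentially. \<exists>y. c \<le> \<bar>q j y\<bar>"
    using small
  proof eventually_elim
    case (elim j)
    show ?case
    proof (rule ccontr)
      assume "\<nexists>y. c \<le> \<bar>q j y\<bar>"
      then have qc: "\<And>y. \<bar>q j y\<bar> \<le> c" by (auto simp: not_le intro: less_imp_le)
      have "\<bar>ip (q j) (M j)\<bar> \<le> l2 (q j) * l2 (M j)" by (intro ip_Cauchy_Schwarz L NL)
      also have "\<dots> \<le> l2 (q j) * (c powr p * l2 (q j))"
        unfolding M_def by (intro mult_left_mono L2_pow_p1[OF p] L qc l2_nonneg)
      also have "\<dots> = c powr p * (l2 (q j))\<^sup>2" by (simp add: power2_eq_square)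
      also have "\<dots> \<le> c powr p * R\<^sup>2" by (intro mult_left_mono power_mono R l2_nonneg) auto
      also have "\<dots> = 1 / 4" using R(1) by (simp add: c)
      finally have "\<bar>ip (z j) (N j)\<bar> < 1 / 2" using diff[of j] elim by linarith
      moreover have "ip (z j) (N j) = - (p + 1) / 2" using constraint_eq[of j] by (simp add: N_def[abs_def])
      ultimately show False using p by simp
    qed
  qed
  then show ?thesis using c(1) by blast
qed

text \<open>L^2 bounds alone give no pointwise convergence of q'. The combination P of q', z' and w'
  occurring in the first equation is better: tested with all \<phi>, the equation says that P has a
  weak derivative in L^2, so P has a representative to which compactness applies.\<close>

lemma momentum_representative:
  "\<exists>P. sob P (force p (\<kappa> j) (lam j) (z j) (w j)) \<and>
    (AE x in lborel. P x = \<gamma> * q' j x + \<kappa> j * \<delta> j * b * (z' j x + w' j x))"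
proof -
  obtain R where R: "\<And>j x. \<bar>w j x\<bar> \<le> R" using uniform_bounds by metis
  define r where "r = force p (\<kappa> j) (lam j) (z j) (w j)"
  define P where "P x = \<gamma> * q' j x + \<kappa> j * \<delta> j * b * (z' j x + w' j x)" for x
  have NL: "(\<lambda>x. pow_p1 p (w j x)) \<in> L2" by (rule L2_pow_p1(1)[OF p Lzw(2) R])
  have zML: "(\<lambda>x. z j x * pow_p p (w j x)) \<in> L2"
    by (rule L2_mult_pow_p(1)[OF p Lzw(1) R L2_measurable[OF Lzw(2)]])
  have rL: "r \<in> L2" unfolding r_def force_def[abs_def] by (intro L2_closed NL zML Lzw)
  have PL: "P \<in> L2" unfolding P_def[abs_def] by (intro L2_closed Lzw L)
  have "has_weak_deriv P r"
    unfolding has_weak_deriv_def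
  proof (intro conjI allI impI L2_locally_integrable rL PL)
    fix \<phi> assume "test_function \<phi>"
    then have s: "sob \<phi> (deriv \<phi>)" by (rule sob_test_function)
    then have \<phi>: "\<phi> \<in> L2" "deriv \<phi> \<in> L2" by (auto dest: sob_L2)
    have "ip P (deriv \<phi>) = - ip r \<phi>"
      using EL1[OF s, of j] \<phi> NL zML unfolding P_def[abs_def] r_def force_def[abs_def]
      by (simp add: ip_linear L2_closed algebra_simps)
    then show "(LINT x|lborel. P x * deriv \<phi> x) = - (LINT x|lborel. r x * \<phi> x)" by (simp add: ip_def)
  qed
  then obtain F where F: "\<And>x. isCont F x" "\<And>x y. x \<le> y \<Longrightarrow> F y - F x = (LINT t:{x..y}|lborel. r t)"
    "AE x in lborel. P x = F x" using has_weak_deriv_imp_antiderivative[OF _ rL] by blast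
  have "F \<in> borel_measurable borel"
    by (intro borel_measurable_continuous_onI continuous_at_imp_continuous_on ballI F)
  then have "F \<in> L2" by (rule L2_cong_AE[OF PL F(3)])
  then have "sob F r" using F rL by (auto simp: sob_def)
  moreover have "AE x in lborel. F x = P x" using F(3) by eventually_elim simp
  ultimately show ?thesis unfolding r_def P_def by blast
qed

text \<open>For P the contribution of d' is harmless, as it carries the factor \<delta>. For the
  force, the sup bound on w makes the nonlinear terms linear in z and w. The bound covers every
  representative P, since one is chosen only afterwards.\<close>

lemma momentum_bounds:
  obtains R where "R > 0" "\<And>j P. sob P (force p (\<kappa> j) (lam j) (z j) (w j)) \<Longrightarrow>
    AE x in lborel. P x = \<gamma> * q' j x + \<kappa> j * \<delta> j * b * (z' j x + w' j x) \<Longrightarrow>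
    l2 P \<le> R \<and> l2 (force p (\<kappa> j) (lam j) (z j) (w j)) \<le> R"
proof -
  obtain R where R: "R > 0" "\<And>j. l2 (q j) \<le> R" "\<And>j. l2 (q' j) \<le> R" "\<And>j x. \<bar>w j x\<bar> \<le> R"
    "\<And>j. 0 \<le> lam j" "\<And>j. lam j \<le> R" using uniform_bounds by metis
  obtain R1 where R1: "\<And>j. l2 (d j) \<le> R1"
    using convergent_imp_Bseq[OF convergentI[OF l2_d_tendsto]] unfolding Bseq_def real_norm_def
    by (metis abs_le_D1)
  obtain R2 where R2: "\<And>j. \<delta> j * l2 (d' j) \<le> R2"
    using convergent_imp_Bseq[OF convergentI[OF delta_l2_d'_tendsto]] unfolding Bseq_def real_norm_def
    by (metis abs_le_D1)
  have R10: "0 \<le> R1" using R1[of 0] l2_nonneg[of "d 0"] by linarith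
  have R20: "0 \<le> R2"
  proof -
    have "0 \<le> \<delta> 0 * l2 (d' 0)" using \<delta>_pos[of 0] l2_nonneg[of "d' 0"] by simp
    then show ?thesis using R2[of 0] by linarith
  qed
  define Z where "Z = (R + \<bar>\<mu>\<bar> * R1) + (R + \<bar>\<nu>\<bar> * R1)"
  have Zz: "l2 (z j) \<le> Z" "l2 (w j) \<le> Z" for j
  proof -
    have "l2 (z j) \<le> R + \<bar>\<mu>\<bar> * R1"
      using l2_lin[OF L(1,3), of \<mu> j j] R(2)[of j] mult_left_mono[OF R1[of j], of "\<bar>\<mu>\<bar>"] by linarith
    moreover have "l2 (w j) \<le> R + \<bar>\<nu>\<bar> * R1"
      using l2_lin[OF L(1,3), of "- \<nu>" j j] R(2)[of j] mult_left_mono[OF R1[of j], of "\<bar>\<nu>\<bar>"] by simp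
    moreover have "0 \<le> R + \<bar>\<mu>\<bar> * R1" "0 \<le> R + \<bar>\<nu>\<bar> * R1" using R(1) R10 by (simp_all add: add_nonneg_nonneg)
    ultimately show "l2 (z j) \<le> Z" "l2 (w j) \<le> Z" unfolding Z_def by linarith+
  qed
  have Z0: "0 \<le> Z" using Zz(1)[of 0] l2_nonneg[of "z 0"] by linarith
  define Lm where "Lm = mult_const p R"
  have Lm: "0 \<le> \<Lambda> j" "\<Lambda> j \<le> Lm" for j
    using R(5,6)[of j] p by (auto simp: Lm_def mult_const_def intro!: divide_right_mono)
  have Lm0: "0 \<le> Lm" using Lm[of 0] by linarith
  define B1 where "B1 = \<gamma> * R + (\<gamma> * R + b * (\<bar>\<mu> - \<nu>\<bar> * R2))"
  define B2 where "B2 = (Z + Z) + Lm * (R powr p * Z + (p + 1) * (R powr p * Z))"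
  have B2: "l2 (force p (\<kappa> j) (lam j) (z j) (w j)) \<le> B2" for j
  proof -
    have NL: "(\<lambda>x. pow_p1 p (w j x)) \<in> L2" "l2 (\<lambda>x. pow_p1 p (w j x)) \<le> R powr p * l2 (w j)"
      using L2_pow_p1[OF p Lzw(2) R(4)] by auto
    have zML: "(\<lambda>x. z j x * pow_p p (w j x)) \<in> L2" "l2 (\<lambda>x. z j x * pow_p p (w j x)) \<le> R powr p * l2 (z j)"
      using L2_mult_pow_p[OF p Lzw(1) R(4) L2_measurable[OF Lzw(2)]] by auto
    have n1: "l2 (\<lambda>x. pow_p1 p (w j x)) \<le> R powr p * Z" "l2 (\<lambda>x. z j x * pow_p p (w j x)) \<le> R powr p * Z"
      using NL(2) zML(2) mult_left_mono[OF Zz(1)[of j], of "R powr p"] mult_left_mono[OF Zz(2)[of j], of "R powr p"] by auto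
    have "l2 (force p (\<kappa> j) (lam j) (z j) (w j))
      \<le> l2 (\<lambda>x. \<kappa> j * (z j x + w j x)) + l2 (\<lambda>x. \<Lambda> j * (pow_p1 p (w j x) + (p + 1) * (z j x * pow_p p (w j x))))"
      unfolding force_def[abs_def] by (intro l2_triangle L2_closed Lzw NL zML)
    also have "\<dots> = \<kappa> j * l2 (\<lambda>x. z j x + w j x) + \<Lambda> j * l2 (\<lambda>x. pow_p1 p (w j x) + (p + 1) * (z j x * pow_p p (w j x)))"
      using \<kappa>_bounds(1)[of j] Lm(1)[of j] by (simp add: l2_scale)
    also have "\<dots> \<le> 1 * (Z + Z) + Lm * (R powr p * Z + (p + 1) * (R powr p * Z))"
    proof (intro add_mono mult_mono)
      show "l2 (\<lambda>x. z j x + w j x) \<le> Z + Z"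
        using l2_triangle[OF Lzw(1,2), of j j] Zz[of j] by linarith
      have "l2 (\<lambda>x. pow_p1 p (w j x) + (p + 1) * (z j x * pow_p p (w j x))) \<le> l2 (\<lambda>x. pow_p1 p (w j x)) + \<bar>p + 1\<bar> * l2 (\<lambda>x. z j x * pow_p p (w j x))"
        using l2_triangle[OF NL(1) L2_scale[OF zML(1), of "p + 1"]] by (simp only: l2_scale)
      also have "\<dots> \<le> R powr p * Z + (p + 1) * (R powr p * Z)"
        using p by (intro add_mono mult_mono n1 l2_nonneg) auto
      finally show "l2 (\<lambda>x. pow_p1 p (w j x) + (p + 1) * (z j x * pow_p p (w j x))) \<le> R powr p * Z + (p + 1) * (R powr p * Z)" .
    qed (use \<kappa>_bounds(2)[of j] Lm[of j] Lm0 Z0 l2_nonneg in auto)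
    finally show ?thesis by (simp add: B2_def)
  qed
  have B1: "l2 P \<le> B1" if "sob P (force p (\<kappa> j) (lam j) (z j) (w j))"
    "AE x in lborel. P x = \<gamma> * q' j x + \<kappa> j * \<delta> j * b * (z' j x + w' j x)" for j P
  proof -
    have zw: "(\<lambda>x. z' j x + w' j x) = (\<lambda>x. 2 * q' j x + (\<mu> - \<nu>) * d' j x)" by (auto simp: lin_def algebra_simps)
    have "l2 P = l2 (\<lambda>x. \<gamma> * q' j x + \<kappa> j * \<delta> j * b * (z' j x + w' j x))"
      by (rule l2_cong_AE[OF that(2)]) (intro L2_measurable L2_closed Lzw L sob_L2(1)[OF that(1)])+
    also have "\<dots> \<le> l2 (\<lambda>x. \<gamma> * q' j x) + l2 (\<lambda>x. \<kappa> j * \<delta> j * b * (z' j x + w' j x))"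
      by (intro l2_triangle L2_closed Lzw L)
    also have "\<dots> = \<gamma> * l2 (q' j) + \<kappa> j * (\<delta> j * b * l2 (\<lambda>x. z' j x + w' j x))"
      using \<gamma> b \<delta>_pos[of j] \<kappa>_bounds(1)[of j] by (simp add: l2_scale abs_mult mult.assoc)
    also have "\<dots> \<le> \<gamma> * R + 1 * (\<delta> j * b * (2 * R + \<bar>\<mu> - \<nu>\<bar> * l2 (d' j)))"
    proof (intro add_mono mult_mono)
      have "l2 (\<lambda>x. z' j x + w' j x) \<le> l2 (\<lambda>x. 2 * q' j x) + l2 (\<lambda>x. (\<mu> - \<nu>) * d' j x)"
        unfolding zw by (intro l2_triangle L2_closed L)
      then show "l2 (\<lambda>x. z' j x + w' j x) \<le> 2 * R + \<bar>\<mu> - \<nu>\<bar> * l2 (d' j)"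
        using R(3)[of j] by (simp add: l2_scale)
    qed (use R(3)[of j] \<kappa>_bounds[of j] \<gamma> b \<delta>_pos[of j] l2_nonneg R(1) in auto)
    also have "\<dots> = \<gamma> * R + (2 * \<delta> j * b) * R + b * (\<bar>\<mu> - \<nu>\<bar> * (\<delta> j * l2 (d' j)))"
      by (simp add: algebra_simps)
    also have "\<dots> \<le> \<gamma> * R + \<gamma> * R + b * (\<bar>\<mu> - \<nu>\<bar> * R2)"
      using \<delta>_small(2)[of j] R(1) R2[of j] b by (intro add_mono mult_mono order_refl mult_nonneg_nonneg) (use \<gamma> in \<open>auto simp: R20 l2_nonneg less_imp_le[OF \<delta>_pos]\<close>)
    also have "\<dots> = B1" using b by (simp add: B1_def field_simps)
    finally show ?thesis .
  qed
  show ?thesis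
  proof (rule that[of "max 1 (max B1 B2)"])
    fix j P
    assume "sob P (force p (\<kappa> j) (lam j) (z j) (w j))"
      "AE x in lborel. P x = \<gamma> * q' j x + \<kappa> j * \<delta> j * b * (z' j x + w' j x)"
    from B1[OF this] B2[of j]
    show "l2 P \<le> max 1 (max B1 B2) \<and> l2 (force p (\<kappa> j) (lam j) (z j) (w j)) \<le> max 1 (max B1 B2)"
      by auto
  qed simp
qed

end

section \<open>Passage to the limit\<close>

lemma ip_tendsto_0:
  assumes "\<And>j. f j \<in> L2" "g \<in> L2" "(\<lambda>j. l2 (f j)) \<longlonglongrightarrow> 0"
  shows "(\<lambda>j. ip (f j) g) \<longlonglongrightarrow> 0"
proof (rule Lim_null_comparison[of _ "\<lambda>j. l2 (f j) * l2 g"])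
  show "\<forall>\<^sub>F j in sequentially. norm (ip (f j) g) \<le> l2 (f j) * l2 g"
    using ip_Cauchy_Schwarz[OF assms(1,2)] by simp
  show "(\<lambda>j. l2 (f j) * l2 g) \<longlonglongrightarrow> 0" using tendsto_mult_left_zero[OF assms(3)] .
qed

lemma l2_tendsto_0I:
  assumes "h \<longlonglongrightarrow> 0" "\<And>j. l2 (f j) \<le> h j"
  shows "(\<lambda>j. l2 (f j)) \<longlonglongrightarrow> 0"
  by (rule tendsto_sandwich[OF always_eventually always_eventually tendsto_const assms(1)])
    (use assms(2) l2_nonneg in auto)

lemma ip_tendsto:
  assumes "\<And>j. f j \<in> L2" "f0 \<in> L2" "g \<in> L2" "(\<lambda>j. l2 (\<lambda>x. f j x - f0 x)) \<longlonglongrightarrow> 0"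
  shows "(\<lambda>j. ip (f j) g) \<longlonglongrightarrow> ip f0 g"
proof -
  have "(\<lambda>j. ip (\<lambda>x. f j x - f0 x) g) \<longlonglongrightarrow> 0"
    by (rule ip_tendsto_0) (use assms in \<open>auto intro: L2_diff\<close>)
  then show ?thesis
    using assms by (simp add: ip_diff_left LIM_zero_cancel)
qed

lemma l2_tendsto:
  assumes "\<And>j. f j \<in> L2" "\<And>j. g j \<in> L2" "(\<lambda>j. l2 (\<lambda>x. f j x - g j x)) \<longlonglongrightarrow> 0" "(\<lambda>j. l2 (g j)) \<longlonglongrightarrow> A"
  shows "(\<lambda>j. l2 (f j)) \<longlonglongrightarrow> A"
proof -
  have "\<bar>l2 (f j) - l2 (g j)\<bar> \<le> l2 (\<lambda>x. f j x - g j x)" for j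
  proof -
    have "l2 (f j) \<le> l2 (\<lambda>x. f j x - g j x) + l2 (g j)"
      using l2_triangle[OF L2_diff[OF assms(1,2)] assms(2), of j j j] by simp
    moreover have "l2 (g j) \<le> l2 (\<lambda>x. f j x - g j x) + l2 (f j)"
      using l2_triangle_diff[OF assms(1) L2_diff[OF assms(1,2)], of j j j] by simp
    ultimately show ?thesis by linarith
  qed
  then have "(\<lambda>j. l2 (f j) - l2 (g j)) \<longlonglongrightarrow> 0"
    by (intro Lim_null_comparison[OF _ assms(3)] always_eventually) auto
  from tendsto_add[OF this assms(4)] show ?thesis by simp
qed

text \<open>\<open>A\<close> and \<open>A1\<close> are the limits of the squared norms of q and P,
  not yet the squared norms of the limits; a positive difference would be mass lost in the limit.
  The condition at 0 is what the choice of translations achieves.\<close>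

locale convergent_sequence = minimizing_sequence +
  fixes P :: "nat \<Rightarrow> real \<Rightarrow> real" and q0 P0 :: "real \<Rightarrow> real" and l0 A A1 :: real
  assumes sP: "\<And>j. sob (P j) (force p (\<kappa> j) (lam j) (z j) (w j))"
    and P_AE: "\<And>j. AE x in lborel. P j x = \<gamma> * q' j x + \<kappa> j * \<delta> j * b * (z' j x + w' j x)"
    and q_lim: "\<And>x. (\<lambda>j. q j x) \<longlonglongrightarrow> q0 x" and P_lim: "\<And>x. (\<lambda>j. P j x) \<longlonglongrightarrow> P0 x"
    and q0_cont: "\<And>x. isCont q0 x" and P0_cont: "\<And>x. isCont P0 x"
    and lam_lim: "lam \<longlonglongrightarrow> l0" and A_lim: "(\<lambda>j. ip (q j) (q j)) \<longlonglongrightarrow> A" and A1_lim: "(\<lambda>j. ip (P j) (P j)) \<longlonglongrightarrow> A1"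
    and q0_nz: "q0 0 \<noteq> 0"
begin

abbreviation "\<Lambda>0 \<equiv> mult_const p l0"

lemma \<Lambda>_lim: "\<Lambda> \<longlonglongrightarrow> \<Lambda>0"
  unfolding mult_const_def using p by (intro tendsto_intros lam_lim) auto

lemma PL [simp]: "P j \<in> L2"
  using sP[of j] by (rule sob_L2)

lemma q0_L2 [simp]: "q0 \<in> L2" and q0_le: "ip q0 q0 \<le> A"
  using L2_Fatou_limit[OF L(1) q_lim A_lim] by auto

lemma P0_L2 [simp]: "P0 \<in> L2" and P0_le: "ip P0 P0 \<le> A1"
  using L2_Fatou_limit[OF PL P_lim A1_lim] by auto

text \<open>The difference is \<kappa>\<delta>b (z' + w'), of size O(\<delta>) + O(\<delta>|d'|),
  and \<delta>|d'| is of order sqrt \<delta>. Hence limits established for P carry over to \<gamma>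
  q'.\<close>

lemma momentum_error: "(\<lambda>j. l2 (\<lambda>x. P j x - \<gamma> * q' j x)) \<longlonglongrightarrow> 0"
proof -
  obtain R where R: "\<And>j. l2 (q' j) \<le> R" using uniform_bounds by metis
  have zw: "(\<lambda>x. z' j x + w' j x) = (\<lambda>x. 2 * q' j x + (\<mu> - \<nu>) * d' j x)" for j by (auto simp: lin_def algebra_simps)
  have "(\<lambda>j. b * (2 * (\<delta> j * R) + \<bar>\<mu> - \<nu>\<bar> * (\<delta> j * l2 (d' j)))) \<longlonglongrightarrow> b * (2 * (0 * R) + \<bar>\<mu> - \<nu>\<bar> * 0)"
    by (intro tendsto_intros \<delta>_lim delta_l2_d'_tendsto)
  then have lim: "(\<lambda>j. b * (2 * (\<delta> j * R) + \<bar>\<mu> - \<nu>\<bar> * (\<delta> j * l2 (d' j)))) \<longlonglongrightarrow> 0" by simp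
  show ?thesis
  proof (rule l2_tendsto_0I[OF lim])
    fix j
    have "l2 (\<lambda>x. P j x - \<gamma> * q' j x) = l2 (\<lambda>x. \<kappa> j * \<delta> j * b * (z' j x + w' j x))"
    proof (rule l2_cong_AE)
      show "AE x in lborel. P j x - \<gamma> * q' j x = \<kappa> j * \<delta> j * b * (z' j x + w' j x)"
        using P_AE[of j] by eventually_elim simp
    qed (intro L2_measurable L2_closed Lzw L PL)+
    also have "\<dots> = \<kappa> j * (\<delta> j * b * l2 (\<lambda>x. z' j x + w' j x))"
      using \<gamma> b \<delta>_pos[of j] \<kappa>_bounds(1)[of j] by (simp add: l2_scale abs_mult mult.assoc)
    also have "\<dots> \<le> 1 * (\<delta> j * b * (2 * R + \<bar>\<mu> - \<nu>\<bar> * l2 (d' j)))"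
    proof (intro add_mono mult_mono)
      have "l2 (\<lambda>x. z' j x + w' j x) \<le> l2 (\<lambda>x. 2 * q' j x) + l2 (\<lambda>x. (\<mu> - \<nu>) * d' j x)"
        unfolding zw by (intro l2_triangle L2_closed L)
      then show "l2 (\<lambda>x. z' j x + w' j x) \<le> 2 * R + \<bar>\<mu> - \<nu>\<bar> * l2 (d' j)"
        using R[of j] by (simp add: l2_scale)
    qed (use \<kappa>_bounds[of j] b \<delta>_pos[of j] l2_nonneg in auto)
    also have "\<dots> = b * (2 * (\<delta> j * R) + \<bar>\<mu> - \<nu>\<bar> * (\<delta> j * l2 (d' j)))" by (simp add: algebra_simps)
    finally show "l2 (\<lambda>x. P j x - \<gamma> * q' j x) \<le> b * (2 * (\<delta> j * R) + \<bar>\<mu> - \<nu>\<bar> * (\<delta> j * l2 (d' j)))" .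
  qed
qed

lemma P_bounded: obtains B where "\<And>j x. \<bar>P j x\<bar> \<le> B"
proof -
  obtain R where R: "R > 0" "\<And>j P. sob P (force p (\<kappa> j) (lam j) (z j) (w j)) \<Longrightarrow>
    AE x in lborel. P x = \<gamma> * q' j x + \<kappa> j * \<delta> j * b * (z' j x + w' j x) \<Longrightarrow>
    l2 P \<le> R \<and> l2 (force p (\<kappa> j) (lam j) (z j) (w j)) \<le> R"
    by (rule momentum_bounds) blast
  have "\<bar>P j x\<bar> \<le> 2 * (R + R)" for j x
    by (rule order_trans[OF sob_bounded[OF sP]]) (use R(2)[OF sP P_AE, of j] in \<open>auto intro: add_mono\<close>)
  then show ?thesis by (rule that)
qed

lemma dM_L2 [simp]: "(\<lambda>x. d j x * pow_p p (w j x)) \<in> L2"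
proof -
  obtain R where R: "\<And>j x. \<bar>w j x\<bar> \<le> R" using uniform_bounds by metis
  show ?thesis by (rule L2_mult_pow_p(1)[OF p L(3) R L2_measurable[OF Lzw(2)]])
qed

lemma Nw_L2 [simp]: "(\<lambda>x. pow_p1 p (w j x)) \<in> L2" and Nq_L2 [simp]: "(\<lambda>x. pow_p1 p (q j x)) \<in> L2"
proof -
  obtain R where R: "\<And>j x. \<bar>w j x\<bar> \<le> R" "\<And>j x. \<bar>q j x\<bar> \<le> R" using uniform_bounds by metis
  show "(\<lambda>x. pow_p1 p (w j x)) \<in> L2" by (rule L2_pow_p1(1)[OF p Lzw(2) R(1)])
  show "(\<lambda>x. pow_p1 p (q j x)) \<in> L2" by (rule L2_pow_p1(1)[OF p L(1) R(2)])
qed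

lemma q0_bounded: obtains R where "\<And>x. \<bar>q0 x\<bar> \<le> R" "\<And>j x. \<bar>w j x\<bar> \<le> R" "\<And>j x. \<bar>q j x\<bar> \<le> R"
proof -
  obtain R where R: "\<And>j x. \<bar>w j x\<bar> \<le> R" "\<And>j x. \<bar>q j x\<bar> \<le> R" using uniform_bounds by metis
  have "\<bar>q0 x\<bar> \<le> R" for x
    by (rule LIMSEQ_le_const2[OF tendsto_rabs[OF q_lim]]) (use R in auto)
  then show ?thesis using that R by blast
qed

lemma N0_L2 [simp]: "(\<lambda>x. pow_p1 p (q0 x)) \<in> L2"
proof -
  obtain R where R: "\<And>x. \<bar>q0 x\<bar> \<le> R" using q0_bounded by metis
  show ?thesis by (rule L2_pow_p1(1)[OF p q0_L2 R])
qed

lemma dM_tendsto: "(\<lambda>j. l2 (\<lambda>x. d j x * pow_p p (w j x))) \<longlonglongrightarrow> 0"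
proof -
  obtain R where R: "\<And>j x. \<bar>w j x\<bar> \<le> R" using uniform_bounds by metis
  have "(\<lambda>j. R powr p * l2 (d j)) \<longlonglongrightarrow> R powr p * 0" by (intro tendsto_intros l2_d_tendsto)
  then have "(\<lambda>j. R powr p * l2 (d j)) \<longlonglongrightarrow> 0" by simp
  then show ?thesis
    by (rule l2_tendsto_0I) (rule L2_mult_pow_p(2)[OF p L(3) R L2_measurable[OF Lzw(2)]])
qed

lemma Nw_Nq_tendsto: "(\<lambda>j. l2 (\<lambda>x. pow_p1 p (w j x) - pow_p1 p (q j x))) \<longlonglongrightarrow> 0"
proof -
  obtain R where R: "\<And>j x. \<bar>w j x\<bar> \<le> R" "\<And>j x. \<bar>q j x\<bar> \<le> R" using uniform_bounds by metis
  have wq: "(\<lambda>x. w j x - q j x) = (\<lambda>x. - \<nu> * d j x)" for j by (simp add: lin_def fun_eq_iff)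
  have "(\<lambda>j. (p + 1) * R powr p * (\<bar>- \<nu>\<bar> * l2 (d j))) \<longlonglongrightarrow> (p + 1) * R powr p * (\<bar>- \<nu>\<bar> * 0)"
    by (intro tendsto_intros l2_d_tendsto)
  then have "(\<lambda>j. (p + 1) * R powr p * (\<bar>- \<nu>\<bar> * l2 (d j))) \<longlonglongrightarrow> 0" by simp
  then show ?thesis
  proof (rule l2_tendsto_0I)
    show "l2 (\<lambda>x. pow_p1 p (w j x) - pow_p1 p (q j x)) \<le> (p + 1) * R powr p * (\<bar>- \<nu>\<bar> * l2 (d j))" for j
      using pow_p1_L2_lipschitz[OF p Lzw(2) L(1) R, of j j] unfolding wq l2_scale .
  qed
qed

text \<open>By z = w + d the two nonlinear terms of the equations differ by d w^p only, which tends
  to 0 in L^2; both have the same limit.\<close>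

lemma zM_split: "(\<lambda>x. z j x * pow_p p (w j x)) = (\<lambda>x. pow_p1 p (w j x) + d j x * pow_p p (w j x))"
proof
  fix x
  have "z j x = w j x + d j x" using mn by (simp add: lin_def algebra_simps flip: distrib_right)
  then show "z j x * pow_p p (w j x) = pow_p1 p (w j x) + d j x * pow_p p (w j x)"
    by (simp add: pow_p1_eq distrib_right)
qed

text \<open>The first bracket depends on q alone and converges pointwise and boundedly; the second
  is an error that tends to 0 in L^2. The two are passed to the limit by different
  arguments.\<close>

lemma force_split:
  "force p (\<kappa> j) (lam j) (z j) (w j) =
   (\<lambda>x. (2 * \<kappa> j * q j x + \<Lambda> j * (p + 2) * pow_p1 p (q j x)) + (\<kappa> j * (\<mu> - \<nu>) * d j x
      + \<Lambda> j * (p + 2) * (pow_p1 p (w j x) - pow_p1 p (q j x)) + \<Lambda> j * (p + 1) * (d j x * pow_p p (w j x))))"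
proof
  fix x
  note e1 = fun_cong[OF zM_split, of j x]
  have e2: "z j x + w j x = 2 * q j x + (\<mu> - \<nu>) * d j x" by (simp add: lin_def algebra_simps)
  show "force p (\<kappa> j) (lam j) (z j) (w j) x =
    (2 * \<kappa> j * q j x + \<Lambda> j * (p + 2) * pow_p1 p (q j x)) + (\<kappa> j * (\<mu> - \<nu>) * d j x
      + \<Lambda> j * (p + 2) * (pow_p1 p (w j x) - pow_p1 p (q j x)) + \<Lambda> j * (p + 1) * (d j x * pow_p p (w j x)))"
    unfolding force_def e1 e2 by (simp add: algebra_simps)
qed

lemma error_tendsto: "(\<lambda>j. l2 (\<lambda>x. \<kappa> j * (\<mu> - \<nu>) * d j x
      + \<Lambda> j * (p + 2) * (pow_p1 p (w j x) - pow_p1 p (q j x)) + \<Lambda> j * (p + 1) * (d j x * pow_p p (w j x)))) \<longlonglongrightarrow> 0"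
proof -
  have "(\<lambda>j. \<bar>\<kappa> j * (\<mu> - \<nu>)\<bar> * l2 (d j) + \<bar>\<Lambda> j * (p + 2)\<bar> * l2 (\<lambda>x. pow_p1 p (w j x) - pow_p1 p (q j x))
      + \<bar>\<Lambda> j * (p + 1)\<bar> * l2 (\<lambda>x. d j x * pow_p p (w j x)))
     \<longlonglongrightarrow> \<bar>1 / 2 * (\<mu> - \<nu>)\<bar> * 0 + \<bar>\<Lambda>0 * (p + 2)\<bar> * 0 + \<bar>\<Lambda>0 * (p + 1)\<bar> * 0"
    by (intro tendsto_intros \<kappa>_lim \<Lambda>_lim l2_d_tendsto Nw_Nq_tendsto dM_tendsto)
  then have lim: "(\<lambda>j. \<bar>\<kappa> j * (\<mu> - \<nu>)\<bar> * l2 (d j) + \<bar>\<Lambda> j * (p + 2)\<bar> * l2 (\<lambda>x. pow_p1 p (w j x) - pow_p1 p (q j x))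
      + \<bar>\<Lambda> j * (p + 1)\<bar> * l2 (\<lambda>x. d j x * pow_p p (w j x))) \<longlonglongrightarrow> 0" by simp
  show ?thesis
  proof (rule l2_tendsto_0I[OF lim])
    fix j
    show "l2 (\<lambda>x. \<kappa> j * (\<mu> - \<nu>) * d j x
      + \<Lambda> j * (p + 2) * (pow_p1 p (w j x) - pow_p1 p (q j x)) + \<Lambda> j * (p + 1) * (d j x * pow_p p (w j x)))
     \<le> \<bar>\<kappa> j * (\<mu> - \<nu>)\<bar> * l2 (d j) + \<bar>\<Lambda> j * (p + 2)\<bar> * l2 (\<lambda>x. pow_p1 p (w j x) - pow_p1 p (q j x))
      + \<bar>\<Lambda> j * (p + 1)\<bar> * l2 (\<lambda>x. d j x * pow_p p (w j x))"
      unfolding l2_scale[symmetric]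
      by (intro order_trans[OF l2_triangle] add_mono order_refl L2_closed L Nw_L2 Nq_L2 dM_L2)
  qed
qed

section \<open>The differential equation of the limit profile\<close>

abbreviation "r0 \<equiv> \<lambda>x. q0 x + \<Lambda>0 * (p + 2) * pow_p1 p (q0 x)"

text \<open>On a bounded interval P converges by dominated convergence, and P - \<gamma> q'
  contributes nothing in the limit by Cauchy-Schwarz. Thus \<gamma> (q j y - q j x) has both sides
  of the claim, times \<gamma>, as limits.\<close>

lemma q0_diff: "x \<le> y \<Longrightarrow> q0 y - q0 x = (LINT t:{x..y}|lborel. P0 t / \<gamma>)"
proof -
  assume xy: "x \<le> y"
  obtain B where B: "\<And>j x. \<bar>P j x\<bar> \<le> B" using P_bounded by blast
  have "(\<lambda>j. LINT t:{x..y}|lborel. P j t) \<longlonglongrightarrow> (LINT t:{x..y}|lborel. P0 t)"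
    by (rule bounded_set_integral_convergence[OF L2_measurable[OF PL] P_lim B])
  moreover have "(\<lambda>j. LINT t:{x..y}|lborel. (P j t - \<gamma> * q' j t)) \<longlonglongrightarrow> 0"
    unfolding set_integral_eq_ip ip_commute[of "indicator {x..y}"]
    by (rule ip_tendsto_0) (auto intro!: L2_closed L2_indicator momentum_error)
  ultimately have "(\<lambda>j. (LINT t:{x..y}|lborel. P j t) - (LINT t:{x..y}|lborel. (P j t - \<gamma> * q' j t)))
      \<longlonglongrightarrow> (LINT t:{x..y}|lborel. P0 t) - 0" by (rule tendsto_diff)
  moreover have "(LINT t:{x..y}|lborel. P j t) - (LINT t:{x..y}|lborel. (P j t - \<gamma> * q' j t)) = \<gamma> * (q j y - q j x)" for j
  proof -
    have "(LINT t:{x..y}|lborel. (P j t - \<gamma> * q' j t)) = (LINT t:{x..y}|lborel. P j t) - \<gamma> * (LINT t:{x..y}|lborel. q' j t)"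
      unfolding set_integral_eq_ip by (simp add: ip_linear L2_closed L2_indicator)
    then show ?thesis using sob_diff_eq[OF sq xy] by simp
  qed
  ultimately have "(\<lambda>j. \<gamma> * (q j y - q j x)) \<longlonglongrightarrow> (LINT t:{x..y}|lborel. P0 t)" by simp
  moreover have "(\<lambda>j. \<gamma> * (q j y - q j x)) \<longlonglongrightarrow> \<gamma> * (q0 y - q0 x)" by (intro tendsto_intros q_lim)
  ultimately have "\<gamma> * (q0 y - q0 x) = (LINT t:{x..y}|lborel. P0 t)" by (rule LIMSEQ_unique[rotated])
  then show ?thesis using \<gamma> by (simp add: field_simps)
qed

lemma r0_L2 [simp]: "r0 \<in> L2"
  by (intro L2_closed q0_L2 N0_L2)

lemma r0_cont: "isCont r0 x"
  by (intro continuous_intros q0_cont isCont_o2[OF q0_cont isCont_pow_p1[OF p]])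

lemma P0_diff: "x \<le> y \<Longrightarrow> P0 y - P0 x = (LINT t:{x..y}|lborel. r0 t)"
proof -
  assume xy: "x \<le> y"
  obtain R where R: "\<And>j x. \<bar>q j x\<bar> \<le> R" using uniform_bounds by metis
  obtain K where K: "\<And>j. \<bar>\<Lambda> j\<bar> \<le> K"
    using convergent_imp_Bseq[OF convergentI[OF \<Lambda>_lim]] unfolding Bseq_def real_norm_def by blast
  let ?f = "\<lambda>j x. 2 * \<kappa> j * q j x + \<Lambda> j * (p + 2) * pow_p1 p (q j x)"
  let ?e = "\<lambda>j x. \<kappa> j * (\<mu> - \<nu>) * d j x
      + \<Lambda> j * (p + 2) * (pow_p1 p (w j x) - pow_p1 p (q j x)) + \<Lambda> j * (p + 1) * (d j x * pow_p p (w j x))"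
  have fL: "?f j \<in> L2" and eL: "?e j \<in> L2" for j by (intro L2_closed L Nq_L2 Nw_L2 dM_L2)+
  have "(\<lambda>j. LINT t:{x..y}|lborel. ?f j t) \<longlonglongrightarrow> (LINT t:{x..y}|lborel. r0 t)"
  proof (rule bounded_set_integral_convergence)
    show "(\<lambda>j. ?f j t) \<longlonglongrightarrow> r0 t" for t
    proof -
      have "(\<lambda>j. ?f j t) \<longlonglongrightarrow> 2 * (1 / 2) * q0 t + \<Lambda>0 * (p + 2) * pow_p1 p (q0 t)"
        by (intro tendsto_intros \<kappa>_lim \<Lambda>_lim q_lim isCont_tendsto_compose[OF isCont_pow_p1[OF p]])
      then show ?thesis by simp
    qed
    show "\<bar>?f j t\<bar> \<le> 2 * 1 * R + K * (p + 2) * (R powr p * R)" for j t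
    proof -
      have "\<bar>?f j t\<bar> \<le> \<bar>2 * \<kappa> j * q j t\<bar> + \<bar>\<Lambda> j * (p + 2) * pow_p1 p (q j t)\<bar>" by (rule abs_triangle_ineq)
      also have "\<dots> = 2 * \<kappa> j * \<bar>q j t\<bar> + \<bar>\<Lambda> j\<bar> * (p + 2) * \<bar>pow_p1 p (q j t)\<bar>"
        using \<kappa>_bounds(1)[of j] p by (simp add: abs_mult)
      also have "\<dots> \<le> 2 * 1 * R + K * (p + 2) * (R powr p * R)"
      proof (intro add_mono mult_mono)
        have "\<bar>pow_p1 p (q j t)\<bar> \<le> R powr p * \<bar>q j t\<bar>" by (rule pow_p1_bound[OF p R])
        also have "\<dots> \<le> R powr p * R" by (intro mult_left_mono R) simp
        finally show "\<bar>pow_p1 p (q j t)\<bar> \<le> R powr p * R" .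
      qed (use order_trans[OF _ \<kappa>_bounds(1)[of j], of 0] \<kappa>_bounds(2)[of j] R K[of j] p abs_ge_zero[of "\<Lambda> j"] in \<open>auto intro: mult_nonneg_nonneg order_trans\<close>)
      finally show ?thesis .
    qed
  qed (rule L2_measurable[OF fL])
  moreover have "(\<lambda>j. LINT t:{x..y}|lborel. ?e j t) \<longlonglongrightarrow> 0"
    unfolding set_integral_eq_ip ip_commute[of "indicator {x..y}"]
    by (rule ip_tendsto_0[OF eL L2_indicator error_tendsto])
  ultimately have "(\<lambda>j. (LINT t:{x..y}|lborel. ?f j t) + (LINT t:{x..y}|lborel. ?e j t)) \<longlonglongrightarrow> (LINT t:{x..y}|lborel. r0 t) + 0"
    by (rule tendsto_add)
  moreover have "(LINT t:{x..y}|lborel. ?f j t) + (LINT t:{x..y}|lborel. ?e j t) = P j y - P j x" for j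
    unfolding sob_diff_eq[OF sP xy] force_split set_integral_eq_ip
    by (rule ip_add_right[OF fL eL L2_indicator, symmetric])
  ultimately have "(\<lambda>j. P j y - P j x) \<longlonglongrightarrow> (LINT t:{x..y}|lborel. r0 t)" by simp
  moreover have "(\<lambda>j. P j y - P j x) \<longlonglongrightarrow> P0 y - P0 x" by (intro tendsto_intros P_lim)
  ultimately show ?thesis by (rule LIMSEQ_unique[rotated])
qed

abbreviation "q0' \<equiv> \<lambda>x. P0 x / \<gamma>"

lemma q0'_L2 [simp]: "q0' \<in> L2"
  using L2_scale[OF P0_L2, of "1 / \<gamma>"] by simp

lemma sob_q0: "sob q0 q0'"
  unfolding sob_def using q0_diff by simp

lemma sob_P0: "sob P0 r0"
  unfolding sob_def using P0_diff by simp

lemma q0'_cont: "isCont q0' x"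
  using \<gamma> by (intro continuous_intros P0_cont) auto

lemma q0_deriv: "(q0 has_real_derivative q0' x) (at x)"
  by (rule sob_has_derivative[OF q0_diff q0'_cont])

lemma P0_deriv: "(P0 has_real_derivative r0 x) (at x)"
  by (rule sob_has_derivative[OF P0_diff r0_cont])

section \<open>No loss of energy\<close>

definition J :: real where "J = ip q0 q0 + \<gamma> * ip q0' q0'"

lemma J_eq: "J = ip q0 q0 + ip P0 P0 / \<gamma>"
  using \<gamma> ip_scale_left[of "1 / \<gamma>" P0 q0'] ip_scale_right[of P0 "1 / \<gamma>" P0]
  by (simp add: J_def)

lemma J_identity: "J = - 2 * l0 / (p + 1) * ip q0 (\<lambda>x. pow_p1 p (q0 x))"
proof -
  have "ip q0 r0 = - ip q0' P0" by (rule sob_integration_by_parts[OF sob_q0 sob_P0 q0'_cont r0_cont])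
  moreover have "ip q0' P0 = ip P0 P0 / \<gamma>" using ip_scale_left[of "1 / \<gamma>" P0 P0] by simp
  moreover have "ip q0 r0 = ip q0 q0 + \<Lambda>0 * (p + 2) * ip q0 (\<lambda>x. pow_p1 p (q0 x))"
    by (simp add: ip_linear L2_closed)
  moreover have "\<Lambda>0 * (p + 2) = 2 * l0 / (p + 1)" using p by (simp add: mult_const_def)
  ultimately show ?thesis by (simp add: J_eq)
qed

text \<open>Nonvanishing at 0 enters here, through the interpolation inequality at that
  point.\<close>

lemma J_pos: "J > 0"
proof -
  have "0 < (q0 0)\<^sup>2" using q0_nz by simp
  then have "0 < 4 * l2 q0 * l2 q0'" using sob_sup_interpolation[OF sob_q0, of 0] by linarith
  then have "l2 q0 \<noteq> 0" by auto
  then have "ip q0 q0 > 0" using l2_sq[of q0] by (metis ip_self_nonneg less_eq_real_def power2_eq_square zero_eq_power2)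
  moreover have "0 \<le> \<gamma> * ip q0' q0'" using \<gamma> ip_self_nonneg[of q0'] by simp
  ultimately show ?thesis by (simp add: J_def)
qed

lemma l0_nonneg: "0 \<le> l0"
proof -
  have "\<And>j. 0 \<le> lam j" using uniform_bounds by metis
  then show ?thesis by (intro LIMSEQ_le_const[OF lam_lim]) auto
qed

lemma l0_le:
  assumes "sob \<phi> \<phi>'" "ip \<phi> (\<lambda>x. pow_p1 p (\<phi> x)) = - (p + 1) / 2"
  shows "l0 \<le> ip \<phi> \<phi> + \<gamma> * ip \<phi>' \<phi>'"
proof -
  have "(\<lambda>j. (\<gamma> + 2 * \<kappa> j * \<delta> j * b) * ip \<phi>' \<phi>' + 2 * \<kappa> j * ip \<phi> \<phi>)
      \<longlonglongrightarrow> (\<gamma> + 2 * (1 / 2) * 0 * b) * ip \<phi>' \<phi>' + 2 * (1 / 2) * ip \<phi> \<phi>"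
    by (intro tendsto_intros \<kappa>_lim \<delta>_lim)
  then have "(\<lambda>j. (\<gamma> + 2 * \<kappa> j * \<delta> j * b) * ip \<phi>' \<phi>' + 2 * \<kappa> j * ip \<phi> \<phi>) \<longlonglongrightarrow> \<gamma> * ip \<phi>' \<phi>' + ip \<phi> \<phi>" by simp
  then have "l0 \<le> \<gamma> * ip \<phi>' \<phi>' + ip \<phi> \<phi>"
    by (rule LIMSEQ_le[OF lam_lim]) (use lam_le[OF assms] in auto)
  then show ?thesis by simp
qed

lemma q'_energy_lim: "(\<lambda>j. \<gamma> * ip (q' j) (q' j)) \<longlonglongrightarrow> A1 / \<gamma>"
proof -
  have "(\<lambda>j. sqrt (ip (P j) (P j))) \<longlonglongrightarrow> sqrt A1" by (intro tendsto_intros A1_lim)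
  then have 1: "(\<lambda>j. l2 (P j)) \<longlonglongrightarrow> sqrt A1" by (simp add: l2_def)
  have "(\<lambda>j. l2 (\<lambda>x. \<gamma> * q' j x)) \<longlonglongrightarrow> sqrt A1"
  proof (rule l2_tendsto[OF _ PL _ 1])
    have "l2 (\<lambda>x. \<gamma> * q' j x - P j x) = l2 (\<lambda>x. P j x - \<gamma> * q' j x)" for j
      using l2_uminus[of "\<lambda>x. P j x - \<gamma> * q' j x"] by simp
    then show "(\<lambda>j. l2 (\<lambda>x. \<gamma> * q' j x - P j x)) \<longlonglongrightarrow> 0" using momentum_error by simp
  qed (intro L2_closed L)
  then have "(\<lambda>j. (l2 (\<lambda>x. \<gamma> * q' j x))\<^sup>2) \<longlonglongrightarrow> (sqrt A1)\<^sup>2" by (rule tendsto_power)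
  moreover have "0 \<le> A1" using P0_le ip_self_nonneg[of P0] by linarith
  ultimately have "(\<lambda>j. \<gamma>\<^sup>2 * ip (q' j) (q' j)) \<longlonglongrightarrow> A1"
    by (simp add: l2_sq ip_scale_left ip_scale_right power2_eq_square[of \<gamma>] mult.assoc)
  then have "(\<lambda>j. (1 / \<gamma>) * (\<gamma>\<^sup>2 * ip (q' j) (q' j))) \<longlonglongrightarrow> (1 / \<gamma>) * A1" by (intro tendsto_intros)
  then show ?thesis using \<gamma> by (simp add: power2_eq_square)
qed

text \<open>Apart from |q|^2 + \<gamma> |q'|^2, the energy consists of nonnegative terms, which are
  dropped, and of terms bounded by multiples of |d|, |d|^2 or \<delta>|d'|, which tend to 0. The
  bound concerns the limits of the norms and so includes any mass lost at infinity.\<close>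

lemma energy_lower_limit: "A + A1 / \<gamma> \<le> l0"
proof -
  obtain R where R: "\<And>j. l2 (q j) \<le> R" "\<And>j. l2 (q' j) \<le> R" using uniform_bounds by metis
  let ?err = "\<lambda>j. 2 * \<bar>\<mu> - \<nu>\<bar> * (R * l2 (d j)) + 2 * \<bar>\<mu> * \<nu>\<bar> * (l2 (d j) * l2 (d j)) + 2 * b * \<bar>\<mu> - \<nu>\<bar> * (R * (\<delta> j * l2 (d' j)))"
  have bound: "ip (q j) (q j) + \<gamma> * ip (q' j) (q' j) - ?err j \<le> lam j" for j
  proof -
    define x1 where "x1 = 2 * (\<bar>\<mu> - \<nu>\<bar> * (R * l2 (d j)))"
    define x2 where "x2 = 2 * (\<bar>\<mu> * \<nu>\<bar> * (l2 (d j) * l2 (d j)))"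
    define x3 where "x3 = 2 * (\<delta> j * b * (\<bar>\<mu> - \<nu>\<bar> * (R * l2 (d' j))))"
    have k: "0 \<le> 2 * \<kappa> j" "2 * \<kappa> j \<le> 2" "1 \<le> 2 * \<kappa> j" using \<kappa>_bounds[of j] by auto
    have S: "\<bar>ip (q j) (d j)\<bar> \<le> R * l2 (d j)"
      using ip_Cauchy_Schwarz[OF L(1,3), of j j] mult_right_mono[OF R(1)[of j] l2_nonneg[of "d j"]] by linarith
    have T: "\<bar>ip (q' j) (d' j)\<bar> \<le> R * l2 (d' j)"
      using ip_Cauchy_Schwarz[OF L(2,4), of j j] mult_right_mono[OF R(2)[of j] l2_nonneg[of "d' j"]] by linarith
    have dd: "ip (d j) (d j) = l2 (d j) * l2 (d j)" using l2_sq[of "d j"] by (simp add: power2_eq_square)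
    have e1: "- x1 \<le> 2 * \<kappa> j * ((\<mu> - \<nu>) * ip (q j) (d j))"
    proof -
      have "\<bar>2 * \<kappa> j * ((\<mu> - \<nu>) * ip (q j) (d j))\<bar> \<le> x1"
        unfolding abs_mult x1_def using k S by (intro mult_mono) auto
      then show ?thesis by (simp only: abs_le_iff) linarith
    qed
    have e2: "- x2 \<le> 2 * \<kappa> j * (- (\<mu> * \<nu> * ip (d j) (d j)))"
    proof -
      have "\<bar>2 * \<kappa> j * (\<mu> * \<nu> * ip (d j) (d j))\<bar> \<le> x2"
        unfolding x2_def dd abs_mult[of "2 * \<kappa> j"] abs_mult[of "\<mu> * \<nu>"] using k by (intro mult_mono) (auto simp: l2_nonneg)
      then show ?thesis by (simp only: abs_le_iff mult_minus_right) linarith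
    qed
    have e3: "- x3 \<le> 2 * \<kappa> j * (\<delta> j * b * ((\<mu> - \<nu>) * ip (q' j) (d' j)))"
    proof -
      have "\<bar>2 * \<kappa> j * (\<delta> j * b * ((\<mu> - \<nu>) * ip (q' j) (d' j)))\<bar> = 2 * \<kappa> j * (\<delta> j * b * (\<bar>\<mu> - \<nu>\<bar> * \<bar>ip (q' j) (d' j)\<bar>))"
        using k \<delta>_pos[of j] b by (simp add: abs_mult)
      also have "\<dots> \<le> x3"
        unfolding x3_def using k T \<delta>_pos[of j] b by (intro mult_mono mult_nonneg_nonneg) auto
      finally show ?thesis by (simp only: abs_le_iff) linarith
    qed
    \<comment> \<open>Only the sign of this coefficient is used, so D = 0 and D > 0 are treated
      alike.\<close>
    have e4: "0 \<le> (D / \<gamma> - 2 * \<kappa> j * \<delta> j * b * (\<mu> * \<nu>)) * ip (d' j) (d' j)"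
    proof (intro mult_nonneg_nonneg ip_self_nonneg)
      have "0 \<le> b\<^sup>2 * \<delta> j / \<gamma>" using \<gamma> \<delta>_pos[of j] by simp
      then show "0 \<le> D / \<gamma> - 2 * \<kappa> j * \<delta> j * b * (\<mu> * \<nu>)"
        using derivative_coefficient[OF \<delta>_pos[of j] \<delta>_small(2)[of j] \<kappa>_bounds[of j]] by linarith
    qed
    have e5: "0 \<le> ip (d j) (d j) / \<delta> j" using \<delta>_pos[of j] ip_self_nonneg[of "d j"] by simp
    have e6: "0 \<le> 2 * \<kappa> j * (\<delta> j * b * ip (q' j) (q' j))"
      using k \<delta>_pos[of j] b ip_self_nonneg[of "q' j"] by simp
    have e7: "ip (q j) (q j) \<le> 2 * \<kappa> j * ip (q j) (q j)"
      using mult_right_mono[OF k(3) ip_self_nonneg[of "q j"]] by simp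
    have "lam j = ip (d j) (d j) / \<delta> j + \<gamma> * ip (q' j) (q' j) + (D / \<gamma> - 2 * \<kappa> j * \<delta> j * b * (\<mu> * \<nu>)) * ip (d' j) (d' j)
       + 2 * \<kappa> j * ip (q j) (q j) + 2 * \<kappa> j * ((\<mu> - \<nu>) * ip (q j) (d j)) + 2 * \<kappa> j * (- (\<mu> * \<nu> * ip (d j) (d j)))
       + 2 * \<kappa> j * (\<delta> j * b * ip (q' j) (q' j)) + 2 * \<kappa> j * (\<delta> j * b * ((\<mu> - \<nu>) * ip (q' j) (d' j)))"
      unfolding energy_eq[of j, symmetric] by (simp add: ip_zw algebra_simps)
    moreover have err: "?err j = x1 + x2 + x3"
      by (simp add: x1_def x2_def x3_def algebra_simps)
    ultimately show ?thesis unfolding err using e1 e2 e3 e4 e5 e6 e7 by linarith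
  qed
  have "(\<lambda>j. ip (q j) (q j) + \<gamma> * ip (q' j) (q' j) - ?err j) \<longlonglongrightarrow> A + A1 / \<gamma> - (2 * \<bar>\<mu> - \<nu>\<bar> * (R * 0) + 2 * \<bar>\<mu> * \<nu>\<bar> * (0 * 0) + 2 * b * \<bar>\<mu> - \<nu>\<bar> * (R * 0))"
    by (intro tendsto_intros A_lim q'_energy_lim l2_d_tendsto delta_l2_d'_tendsto)
  then have "(\<lambda>j. ip (q j) (q j) + \<gamma> * ip (q' j) (q' j) - ?err j) \<longlonglongrightarrow> A + A1 / \<gamma>" by simp
  then show ?thesis by (rule LIMSEQ_le[OF _ lam_lim]) (use bound in auto)
qed

text \<open>Rescaling q0 to an admissible function gives l0 \<le> s^2 J = l0 \<theta>^(p/(p+2)), and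
  p > 0 makes this \<theta> \<ge> 1. Conversely l0 \<theta> = J \<le> A + A1/\<gamma> \<le> l0. With
  \<theta> = 1 the last chain consists of equalities, so both of the inequalities
  \<open>q0_le\<close> and \<open>P0_le\<close> are equalities too.\<close>

theorem limit_is_minimizer: "ip q0 (\<lambda>x. pow_p1 p (q0 x)) = - (p + 1) / 2" "J = l0" "l0 > 0" "A = ip q0 q0" "A1 = ip P0 P0"
proof -
  define \<theta> where "\<theta> = - (2 / (p + 1)) * ip q0 (\<lambda>x. pow_p1 p (q0 x))"
  have "- 2 * l0 / (p + 1) * c = l0 * (- (2 / (p + 1)) * c)" for c :: real by simp
  then have J\<theta>: "J = l0 * \<theta>" unfolding \<theta>_def J_identity .
  then have "0 < l0 * \<theta>" using J_pos by simp
  then have pos: "l0 > 0" "\<theta> > 0" using l0_nonneg by (auto simp: zero_less_mult_iff)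
  \<comment> \<open>The constraint integral is homogeneous of degree p + 2, so multiplying q0 by
    this s divides it by \<theta>.\<close>
  define s where "s = \<theta> powr (- 1 / (p + 2))"
  have s: "s > 0" using pos by (simp add: s_def)
  have sob_s: "sob (\<lambda>x. s * q0 x) (\<lambda>x. s * q0' x)" by (rule sob_scale[OF sob_q0])
  have "ip (\<lambda>x. s * q0 x) (\<lambda>x. pow_p1 p (s * q0 x)) = s * s powr (p + 1) * ip q0 (\<lambda>x. pow_p1 p (q0 x))"
    unfolding pow_p1_scale[OF s] ip_scale_left ip_scale_right by simp
  also have "s * s powr (p + 1) = 1 / \<theta>"
  proof -
    have "s * s powr (p + 1) = s powr (1 + (p + 1))" using s by (simp only: powr_add powr_one)
    also have "\<dots> = \<theta> powr (- 1 / (p + 2) * (1 + (p + 1)))" unfolding s_def by (rule powr_powr)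
    also have "- 1 / (p + 2) * (1 + (p + 1)) = - 1" using p by (simp add: field_simps)
    finally show ?thesis using pos by (simp add: powr_minus_divide)
  qed
  also have "1 / \<theta> * ip q0 (\<lambda>x. pow_p1 p (q0 x)) = - (p + 1) / 2"
  proof -
    have "c = - (p + 1) / 2 * (- (2 / (p + 1)) * c)" for c using p by (simp add: field_simps)
    then have "ip q0 (\<lambda>x. pow_p1 p (q0 x)) = - (p + 1) / 2 * \<theta>" unfolding \<theta>_def .
    then show ?thesis using pos by simp
  qed
  finally have "l0 \<le> ip (\<lambda>x. s * q0 x) (\<lambda>x. s * q0 x) + \<gamma> * ip (\<lambda>x. s * q0' x) (\<lambda>x. s * q0' x)"
    by (rule l0_le[OF sob_s])
  also have "\<dots> = s\<^sup>2 * J" unfolding J_def ip_scale_left ip_scale_right by algebra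
  also have "\<dots> = l0 * (s\<^sup>2 * \<theta>)" unfolding J\<theta> by algebra
  finally have "l0 * 1 \<le> l0 * (s\<^sup>2 * \<theta>)" by simp
  then have "1 \<le> s\<^sup>2 * \<theta>" using pos by simp
  also have "s\<^sup>2 = \<theta> powr (- 2 / (p + 2))" using pos by (simp add: s_def powr_power)
  also have "\<dots> * \<theta> = \<theta> powr (- 2 / (p + 2) + 1)" unfolding powr_add using pos by simp
  also have "- 2 / (p + 2) + 1 = p / (p + 2)" using p by (simp add: field_simps)
  finally have "1 \<le> \<theta> powr (p / (p + 2))" .
  have ge: "1 \<le> \<theta>"
  proof (rule ccontr)
    assume "\<not> 1 \<le> \<theta>"
    then have "\<theta> powr (p / (p + 2)) < 1 powr (p / (p + 2))" using pos p by (intro powr_less_mono2) auto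
    then show False using \<open>1 \<le> \<theta> powr (p / (p + 2))\<close> by simp
  qed
  have JA: "J \<le> A + A1 / \<gamma>"
    unfolding J_eq using q0_le P0_le \<gamma> by (intro add_mono divide_right_mono) auto
  then have "l0 * \<theta> \<le> l0 * 1" using energy_lower_limit unfolding J\<theta> by linarith
  then have "\<theta> \<le> 1" using pos by simp
  then have th: "\<theta> = 1" using ge by simp
  show "ip q0 (\<lambda>x. pow_p1 p (q0 x)) = - (p + 1) / 2" using th p by (simp add: \<theta>_def field_simps)
  show Jl: "J = l0" using J\<theta> th by simp
  show "l0 > 0" by (rule pos)
  have "A + A1 / \<gamma> \<le> ip q0 q0 + ip P0 P0 / \<gamma>" using energy_lower_limit Jl by (simp add: J_eq)
  moreover have "ip P0 P0 / \<gamma> \<le> A1 / \<gamma>" using P0_le \<gamma> by (intro divide_right_mono) auto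
  ultimately have "A = ip q0 q0" "A1 / \<gamma> = ip P0 P0 / \<gamma>" using q0_le by linarith+
  then show "A = ip q0 q0" "A1 = ip P0 P0" using \<gamma> by auto
qed

section \<open>Strong convergence of q and q'\<close>

lemma q_strong: "(\<lambda>j. l2 (\<lambda>x. q j x - q0 x)) \<longlonglongrightarrow> 0"
  using L2_strong_convergence[OF L(1) q_lim] A_lim limit_is_minimizer(4) by simp

lemma Nw_N0_tendsto: "(\<lambda>j. l2 (\<lambda>x. pow_p1 p (w j x) - pow_p1 p (q0 x))) \<longlonglongrightarrow> 0"
proof -
  obtain R where R: "\<And>x. \<bar>q0 x\<bar> \<le> R" "\<And>j x. \<bar>w j x\<bar> \<le> R" using q0_bounded by metis
  have "(\<lambda>j. (p + 1) * R powr p * (l2 (\<lambda>x. q j x - q0 x) + \<bar>\<nu>\<bar> * l2 (d j))) \<longlonglongrightarrow> (p + 1) * R powr p * (0 + \<bar>\<nu>\<bar> * 0)"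
    by (intro tendsto_intros q_strong l2_d_tendsto)
  then have "(\<lambda>j. (p + 1) * R powr p * (l2 (\<lambda>x. q j x - q0 x) + \<bar>\<nu>\<bar> * l2 (d j))) \<longlonglongrightarrow> 0" by simp
  then show ?thesis
  proof (rule l2_tendsto_0I)
    fix j
    have "l2 (\<lambda>x. pow_p1 p (w j x) - pow_p1 p (q0 x)) \<le> (p + 1) * R powr p * l2 (\<lambda>x. w j x - q0 x)"
      by (rule pow_p1_L2_lipschitz[OF p Lzw(2) q0_L2 R(2) R(1)])
    also have "(\<lambda>x. w j x - q0 x) = lin (- \<nu>) (\<lambda>x. q j x - q0 x) (d j)" by (simp add: lin_def fun_eq_iff)
    also have "l2 \<dots> \<le> l2 (\<lambda>x. q j x - q0 x) + \<bar>\<nu>\<bar> * l2 (d j)"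
      using l2_lin[OF L2_diff[OF L(1) q0_L2] L(3), of "- \<nu>" j j] by simp
    finally show "l2 (\<lambda>x. pow_p1 p (w j x) - pow_p1 p (q0 x)) \<le> (p + 1) * R powr p * (l2 (\<lambda>x. q j x - q0 x) + \<bar>\<nu>\<bar> * l2 (d j))"
      using p by (simp add: mult_left_mono)
  qed
qed

lemma P_strong: "(\<lambda>j. l2 (\<lambda>x. P j x - P0 x)) \<longlonglongrightarrow> 0"
  using L2_strong_convergence[OF PL P_lim] A1_lim limit_is_minimizer(5) by simp

lemma q'_strong: "(\<lambda>j. l2 (\<lambda>x. q' j x - q0' x)) \<longlonglongrightarrow> 0"
proof -
  have "(\<lambda>j. (1 / \<gamma>) * (l2 (\<lambda>x. P j x - P0 x) + l2 (\<lambda>x. P j x - \<gamma> * q' j x))) \<longlonglongrightarrow> (1 / \<gamma>) * (0 + 0)"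
    by (intro tendsto_intros P_strong momentum_error)
  then have "(\<lambda>j. (1 / \<gamma>) * (l2 (\<lambda>x. P j x - P0 x) + l2 (\<lambda>x. P j x - \<gamma> * q' j x))) \<longlonglongrightarrow> 0" by simp
  then show ?thesis
  proof (rule l2_tendsto_0I)
    fix j
    have "(\<lambda>x. q' j x - q0' x) = (\<lambda>x. (1 / \<gamma>) * ((P j x - P0 x) - (P j x - \<gamma> * q' j x)))"
      using \<gamma> by (auto simp: field_simps)
    then have "l2 (\<lambda>x. q' j x - q0' x) = \<bar>1 / \<gamma>\<bar> * l2 (\<lambda>x. (P j x - P0 x) - (P j x - \<gamma> * q' j x))"
      by (simp only: l2_scale)
    also have "\<dots> \<le> \<bar>1 / \<gamma>\<bar> * (l2 (\<lambda>x. P j x - P0 x) + l2 (\<lambda>x. P j x - \<gamma> * q' j x))"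
      by (intro mult_left_mono l2_triangle_diff L2_closed L PL P0_L2) simp
    finally show "l2 (\<lambda>x. q' j x - q0' x) \<le> (1 / \<gamma>) * (l2 (\<lambda>x. P j x - P0 x) + l2 (\<lambda>x. P j x - \<gamma> * q' j x))"
      using \<gamma> by simp
  qed
qed

end

section \<open>Strong convergence of the difference\<close>

context convergent_sequence
begin

text \<open>Needed for test functions whose derivative is merely in L^2, such as e in
  \<open>d'_strong\<close>, whereas \<open>sob_integration_by_parts\<close> asks for continuous
  derivatives. The equation is therefore obtained as the limit of those satisfied by q.\<close>

lemma q0_weak_equation:
  assumes s: "sob \<phi> \<phi>'"
  shows "\<gamma> * ip q0' \<phi>' + ip q0 \<phi> = - \<Lambda>0 * (p + 2) * ip (\<lambda>x. pow_p1 p (q0 x)) \<phi>"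
proof -
  have \<phi> [simp]: "\<phi> \<in> L2" "\<phi>' \<in> L2" using s by (auto dest: sob_L2)
  have N_lim: "(\<lambda>j. l2 (\<lambda>x. pow_p1 p (w j x) - pow_p1 p (q0 x))) \<longlonglongrightarrow> 0" by (rule Nw_N0_tendsto)
  have lhs: "\<gamma> * ip (q' j) \<phi>' + \<kappa> j * (ip (z j) \<phi> + ip (w j) \<phi>) + \<kappa> j * \<delta> j * b * (ip (z' j) \<phi>' + ip (w' j) \<phi>')
     = \<gamma> * ip (q' j) \<phi>' + \<kappa> j * (2 * ip (q j) \<phi> + (\<mu> - \<nu>) * ip (d j) \<phi>)
       + \<kappa> j * b * (2 * \<delta> j * ip (q' j) \<phi>' + (\<mu> - \<nu>) * (\<delta> j * ip (d' j) \<phi>'))" for j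
    by (simp add: ip_lin_left) (simp add: algebra_simps)
  have dd': "(\<lambda>j. \<delta> j * ip (d' j) \<phi>') \<longlonglongrightarrow> 0"
  proof (rule Lim_null_comparison[of _ "\<lambda>j. (\<delta> j * l2 (d' j)) * l2 \<phi>'"])
    show "\<forall>\<^sub>F j in sequentially. norm (\<delta> j * ip (d' j) \<phi>') \<le> (\<delta> j * l2 (d' j)) * l2 \<phi>'"
    proof (intro always_eventually allI)
      fix j
      show "norm (\<delta> j * ip (d' j) \<phi>') \<le> (\<delta> j * l2 (d' j)) * l2 \<phi>'"
        using mult_left_mono[OF ip_Cauchy_Schwarz[OF L(4)[of j] \<phi>(2)], of "\<delta> j"] \<delta>_pos[of j]
        by (simp add: abs_mult mult.assoc)
    qed
    show "(\<lambda>j. (\<delta> j * l2 (d' j)) * l2 \<phi>') \<longlonglongrightarrow> 0"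
      by (rule tendsto_mult_left_zero[OF delta_l2_d'_tendsto])
  qed
  have "(\<lambda>j. \<gamma> * ip (q' j) \<phi>' + \<kappa> j * (2 * ip (q j) \<phi> + (\<mu> - \<nu>) * ip (d j) \<phi>)
       + \<kappa> j * b * (2 * \<delta> j * ip (q' j) \<phi>' + (\<mu> - \<nu>) * (\<delta> j * ip (d' j) \<phi>')))
    \<longlonglongrightarrow> \<gamma> * ip q0' \<phi>' + 1 / 2 * (2 * ip q0 \<phi> + (\<mu> - \<nu>) * 0)
       + 1 / 2 * b * (2 * 0 * ip q0' \<phi>' + (\<mu> - \<nu>) * 0)"
    by (intro tendsto_intros \<kappa>_lim \<delta>_lim dd' ip_tendsto[OF L(2) q0'_L2 \<phi>(2) q'_strong]
        ip_tendsto[OF L(1) q0_L2 \<phi>(1) q_strong] ip_tendsto_0[OF L(3) \<phi>(1) l2_d_tendsto])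
  then have l: "(\<lambda>j. \<gamma> * ip (q' j) \<phi>' + \<kappa> j * (ip (z j) \<phi> + ip (w j) \<phi>) + \<kappa> j * \<delta> j * b * (ip (z' j) \<phi>' + ip (w' j) \<phi>'))
    \<longlonglongrightarrow> \<gamma> * ip q0' \<phi>' + ip q0 \<phi>" unfolding lhs by simp
  have zM: "ip (\<lambda>x. z j x * pow_p p (w j x)) \<phi> = ip (\<lambda>x. pow_p1 p (w j x)) \<phi> + ip (\<lambda>x. d j x * pow_p p (w j x)) \<phi>" for j
    unfolding zM_split by (simp add: ip_add_left)
  have "(\<lambda>j. - \<Lambda> j * (ip (\<lambda>x. pow_p1 p (w j x)) \<phi> + (p + 1) * (ip (\<lambda>x. pow_p1 p (w j x)) \<phi> + ip (\<lambda>x. d j x * pow_p p (w j x)) \<phi>)))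
    \<longlonglongrightarrow> - \<Lambda>0 * (ip (\<lambda>x. pow_p1 p (q0 x)) \<phi> + (p + 1) * (ip (\<lambda>x. pow_p1 p (q0 x)) \<phi> + 0))"
    by (intro tendsto_intros \<Lambda>_lim ip_tendsto[OF Nw_L2 N0_L2 \<phi>(1) N_lim] ip_tendsto_0[OF dM_L2 \<phi>(1) dM_tendsto])
  then have "(\<lambda>j. \<gamma> * ip (q' j) \<phi>' + \<kappa> j * (ip (z j) \<phi> + ip (w j) \<phi>) + \<kappa> j * \<delta> j * b * (ip (z' j) \<phi>' + ip (w' j) \<phi>'))
    \<longlonglongrightarrow> - \<Lambda>0 * (ip (\<lambda>x. pow_p1 p (q0 x)) \<phi> + (p + 1) * (ip (\<lambda>x. pow_p1 p (q0 x)) \<phi> + 0))"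
    unfolding EL1[OF s] zM .
  from LIMSEQ_unique[OF l this] show ?thesis by (simp add: algebra_simps)
qed

text \<open>
  The second Euler-Lagrange equation forces \<open>d j / \<delta> j\<close> towards this profile. When \<open>D = 0\<close> the energy
  controls only \<open>\<delta> (d')\<^sup>2\<close>, so \<open>d' \<rightarrow> 0\<close> has to be read off the equation at order \<open>\<delta>\<close>.
\<close>
definition corrector :: "real \<Rightarrow> real" where
  "corrector x = - (\<mu> - \<nu>) / 2 * q0 x + - \<Lambda>0 * (\<mu> - \<nu> * (p + 1)) * pow_p1 p (q0 x)"

definition corrector' :: "real \<Rightarrow> real" where
  "corrector' x = (- (\<mu> - \<nu>) / 2 + - \<Lambda>0 * (\<mu> - \<nu> * (p + 1)) * ((p + 1) * pow_p p (q0 x))) * q0' x"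

text \<open>q0 is bounded and continuously differentiable with q0' in L^2, so the chain rule
  applies. Membership in \<open>sob\<close> makes d/\<delta> - \<open>corrector\<close> a legitimate
  test function.\<close>

lemma sob_corrector: "sob corrector corrector'"
proof (rule sob_C1)
  obtain R where R: "\<And>x. \<bar>q0 x\<bar> \<le> R" using q0_bounded by metis
  show "corrector \<in> L2" unfolding corrector_def[abs_def] by (intro L2_closed q0_L2 N0_L2)
  have [measurable]: "q0 \<in> borel_measurable borel" by (rule L2_measurable[OF q0_L2])
  note [measurable] = pow_p_measurable[OF p]
  show "corrector' \<in> L2"
    unfolding corrector'_def[abs_def]
  proof (rule L2_bounded_mult[OF q0'_L2])
    show "\<bar>- (\<mu> - \<nu>) / 2 + - \<Lambda>0 * (\<mu> - \<nu> * (p + 1)) * ((p + 1) * pow_p p (q0 x))\<bar>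
      \<le> \<bar>- (\<mu> - \<nu>) / 2\<bar> + \<bar>- \<Lambda>0 * (\<mu> - \<nu> * (p + 1)) * (p + 1)\<bar> * R powr p" for x
    proof -
      have "\<bar>- \<Lambda>0 * (\<mu> - \<nu> * (p + 1)) * ((p + 1) * pow_p p (q0 x))\<bar>
        = \<bar>- \<Lambda>0 * (\<mu> - \<nu> * (p + 1)) * (p + 1)\<bar> * \<bar>pow_p p (q0 x)\<bar>" by (simp add: abs_mult mult.assoc)
      also have "\<dots> \<le> \<bar>- \<Lambda>0 * (\<mu> - \<nu> * (p + 1)) * (p + 1)\<bar> * R powr p"
        by (intro mult_left_mono pow_p_bound[OF p R]) simp
      finally show ?thesis by (meson abs_triangle_ineq add_left_mono order_trans)
    qed
  qed measurable
  show "(corrector has_real_derivative corrector' x) (at x)" for x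
  proof -
    have "(corrector has_real_derivative - (\<mu> - \<nu>) / 2 * q0' x + - \<Lambda>0 * (\<mu> - \<nu> * (p + 1)) * ((p + 1) * pow_p p (q0 x) * q0' x)) (at x)"
      unfolding corrector_def[abs_def]
      by (intro DERIV_add DERIV_cmult q0_deriv DERIV_chain2[OF pow_p1_has_derivative[OF p]])
    then show ?thesis
      by (rule DERIV_cong) (simp only: corrector'_def distrib_right mult.assoc)
  qed
  show "isCont corrector' x" for x
    unfolding corrector'_def[abs_def] using \<gamma>
    by (intro continuous_intros P0_cont isCont_o2[OF q0_cont isCont_pow_p[OF p]]) auto
qed

lemma corrector_L2 [simp]: "corrector \<in> L2" "corrector' \<in> L2"
  using sob_corrector by (auto dest: sob_L2)

text \<open>The second equation is tested with e = d/\<delta> - \<open>corrector\<close>, which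
  cancels the terms of order one. By the strong convergence of q and q', what remains is |e|^2 +
  \<delta>\<beta>|e'|^2 \<le> o(1) |e| + o(1) \<delta>|e'| + \<delta>\<beta> |corrector'| |e'|.
  Young's inequality yields \<delta>|e'| \<rightarrow> 0, and d' = \<delta> (e' + corrector'). From
  below, only \<beta> \<ge> b^2\<delta>/\<gamma> is used, which does not degenerate with D.\<close>

theorem d'_strong: "(\<lambda>j. l2 (d' j)) \<longlonglongrightarrow> 0"
proof -
  define m where "m = \<mu> - \<nu>"
  define k where "k = \<mu> - \<nu> * (p + 1)"
  define e where "e j x = (1 / \<delta> j) * d j x - corrector x" for j x
  define e' where "e' j x = (1 / \<delta> j) * d' j x - corrector' x" for j x
  \<comment> \<open>The coefficient of (d')^2 in the energy, as in
    \<open>derivative_coefficient\<close>.\<close>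
  define \<beta> where "\<beta> j = D / \<gamma> - 2 * \<kappa> j * \<delta> j * b * (\<mu> * \<nu>)" for j
  have se: "sob (e j) (e' j)" for j
    unfolding e_def e'_def by (intro sob_diff sob_scale sd sob_corrector)
  then have eL [simp]: "e j \<in> L2" "e' j \<in> L2" for j by (auto dest: sob_L2)
  have d_e: "d j = (\<lambda>x. \<delta> j * (e j x + corrector x))" and d'_e: "d' j = (\<lambda>x. \<delta> j * (e' j x + corrector' x))" for j
    using less_imp_neq[OF \<delta>_pos[of j]] by (auto simp: e_def e'_def fun_eq_iff)
  define N0 where "N0 x = pow_p1 p (q0 x)" for x
  define \<eta> where "\<eta> j x = - (N0 x) + pow_p1 p (w j x)" for j x
  define dM where "dM j x = d j x * pow_p p (w j x)" for j x
  have sL [simp]: "N0 \<in> L2" "\<eta> j \<in> L2" "dM j \<in> L2" "(\<lambda>x. q j x - q0 x) \<in> L2" "(\<lambda>x. q' j x - q0' x) \<in> L2" for j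
    unfolding N0_def[abs_def] \<eta>_def[abs_def] dM_def[abs_def] by (intro L2_closed N0_L2 Nw_L2 dM_L2 L q0_L2 q0'_L2)+
  \<comment> \<open>Collects every coefficient that multiplies |e| after Cauchy-Schwarz. Each
    summand contains a factor tending to 0; the last line is the price of
    \<open>q0e'\<close>.\<close>
  define T where "T j = \<bar>1 / 2 - \<kappa> j\<bar> * \<bar>m\<bar> * l2 q0 + \<bar>m\<bar> * l2 (\<lambda>x. q j x - q0 x) + 2 * \<bar>\<mu> * \<nu>\<bar> * l2 (d j)
    + \<bar>\<Lambda>0 - \<Lambda> j\<bar> * \<bar>k\<bar> * l2 N0 + \<bar>\<Lambda> j\<bar> * \<bar>k\<bar> * l2 (\<eta> j) + \<bar>\<Lambda> j * \<nu>\<bar> * (p + 1) * l2 (dM j)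
    + \<delta> j * (b * \<bar>m\<bar> / \<gamma> * (l2 q0 + \<bar>\<Lambda>0 * (p + 2)\<bar> * l2 N0))" for j
  have main: "ip (e j) (e j) + \<delta> j * \<beta> j * ip (e' j) (e' j)
     = (1 / 2 - \<kappa> j) * m * ip q0 (e j) - \<kappa> j * m * ip (\<lambda>x. q j x - q0 x) (e j) + 2 * \<kappa> j * (\<mu> * \<nu>) * ip (d j) (e j)
       + (\<Lambda>0 - \<Lambda> j) * k * ip N0 (e j) - \<Lambda> j * k * ip (\<eta> j) (e j) + \<Lambda> j * \<nu> * (p + 1) * ip (dM j) (e j)
       - \<kappa> j * \<delta> j * b * m * ip (q' j) (e' j) - \<delta> j * \<beta> j * ip corrector' (e' j)" for j
  proof -
    have w: "ip (w j) (e j) = ip (q j) (e j) - \<nu> * ip (d j) (e j)" "ip (z j) (e j) = ip (q j) (e j) + \<mu> * ip (d j) (e j)"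
      "ip (w' j) (e' j) = ip (q' j) (e' j) - \<nu> * ip (d' j) (e' j)" "ip (z' j) (e' j) = ip (q' j) (e' j) + \<mu> * ip (d' j) (e' j)"
      by (simp_all add: ip_lin_left)
    have Nw: "ip (\<lambda>x. pow_p1 p (w j x)) (e j) = ip N0 (e j) + ip (\<eta> j) (e j)"
    proof -
      have "(\<lambda>x. pow_p1 p (w j x)) = (\<lambda>x. N0 x + \<eta> j x)" by (simp add: \<eta>_def)
      then show ?thesis by (simp only: ip_add_left sL eL)
    qed
    have zM: "ip (\<lambda>x. z j x * pow_p p (w j x)) (e j) = ip N0 (e j) + ip (\<eta> j) (e j) + ip (dM j) (e j)"
    proof -
      have "(\<lambda>x. z j x * pow_p p (w j x)) = (\<lambda>x. (N0 x + \<eta> j x) + dM j x)" unfolding zM_split by (simp add: \<eta>_def dM_def)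
      then show ?thesis by (simp only: ip_add_left sL eL L2_add)
    qed
    have de: "ip (d j) (e j) / \<delta> j = ip (e j) (e j) + ip corrector (e j)"
    proof -
      have "ip (d j) (e j) = \<delta> j * (ip (e j) (e j) + ip corrector (e j))"
        unfolding d_e[of j] by (simp only: ip_scale_left ip_add_left eL corrector_L2)
      then show ?thesis using less_imp_neq[OF \<delta>_pos[of j]] by simp
    qed
    have d'e': "ip (d' j) (e' j) = \<delta> j * (ip (e' j) (e' j) + ip corrector' (e' j))"
      unfolding d'_e[of j] by (simp only: ip_scale_left ip_add_left eL corrector_L2)
    have ce: "ip corrector (e j) = - m / 2 * ip q0 (e j) - \<Lambda>0 * k * ip N0 (e j)"
    proof -
      have "corrector = (\<lambda>x. (- m / 2) * q0 x + (- \<Lambda>0 * k) * N0 x)"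
        by (simp add: corrector_def fun_eq_iff m_def k_def N0_def)
      then have "ip corrector (e j) = (- m / 2) * ip q0 (e j) + (- \<Lambda>0 * k) * ip N0 (e j)"
        by (simp only: ip_scale_left ip_add_left sL eL q0_L2 L2_scale)
      then show ?thesis by simp
    qed
    have qe: "ip (q j) (e j) = ip q0 (e j) + ip (\<lambda>x. q j x - q0 x) (e j)"
      by (simp add: ip_diff_left)
    have eq: "ip (e j) (e j) + ip corrector (e j) + D / \<gamma> * ip (d' j) (e' j)
      + \<kappa> j * (m * ip (q j) (e j) - 2 * (\<mu> * \<nu>) * ip (d j) (e j))
      + \<kappa> j * \<delta> j * b * (m * ip (q' j) (e' j) - 2 * (\<mu> * \<nu>) * ip (d' j) (e' j))
      = - \<Lambda> j * (k * (ip N0 (e j) + ip (\<eta> j) (e j)) - \<nu> * (p + 1) * ip (dM j) (e j))"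
      using EL2[OF se, of j j] unfolding w Nw zM de m_def k_def by (simp add: algebra_simps)
    show ?thesis
      using eq unfolding ce qe d'e' \<beta>_def by (simp add: algebra_simps)
  qed
  \<comment> \<open>Cauchy-Schwarz would leave a fixed multiple of \<delta>|e'|, too large to
    conclude. The limit equation tested with e trades e' for e and keeps the factor
    \<delta>.\<close>
  have q0e': "- \<kappa> j * \<delta> j * b * m * ip q0' (e' j) = \<kappa> j * \<delta> j * b * m / \<gamma> * (ip q0 (e j) + \<Lambda>0 * (p + 2) * ip N0 (e j))" for j
  proof -
    have "ip q0' (e' j) = (- ip q0 (e j) - \<Lambda>0 * (p + 2) * ip N0 (e j)) / \<gamma>"
      using q0_weak_equation[OF se, of j] \<gamma> unfolding N0_def[abs_def, symmetric] by (simp add: field_simps)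
    moreover have "- c * ((- s - t) / \<gamma>) = c / \<gamma> * (s + t)" for c s t using \<gamma> by (simp add: field_simps)
    ultimately show ?thesis by (simp only: mult_minus_left)
  qed
  have est: "ip (e j) (e j) + \<delta> j * \<beta> j * ip (e' j) (e' j) \<le> T j * l2 (e j)
      + b * \<bar>m\<bar> * l2 (\<lambda>x. q' j x - q0' x) * (\<delta> j * l2 (e' j)) + \<delta> j * \<beta> j * (l2 corrector' * l2 (e' j))" for j
  proof -
    have \<kappa>: "0 \<le> \<kappa> j" "\<kappa> j \<le> 1" using \<kappa>_bounds[of j] by auto
    have \<beta>0: "0 \<le> \<delta> j * \<beta> j"
    proof -
      have "0 \<le> b\<^sup>2 * \<delta> j / \<gamma>" using \<gamma> \<delta>_pos[of j] by simp
      then have "0 \<le> \<beta> j"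
        using derivative_coefficient[OF \<delta>_pos[of j] \<delta>_small(2)[of j] \<kappa>_bounds[of j]] unfolding \<beta>_def by linarith
      then show ?thesis using \<delta>_pos[of j] by simp
    qed
    have CS: "\<bar>c * ip f g\<bar> \<le> C * (l2 f * l2 g)" if "\<bar>c\<bar> \<le> C" "f \<in> L2" "g \<in> L2" for c C f g
      unfolding abs_mult using that l2_nonneg by (intro mult_mono ip_Cauchy_Schwarz) auto
    have a1: "\<bar>(1 / 2 - \<kappa> j) * m * ip q0 (e j)\<bar> \<le> \<bar>1 / 2 - \<kappa> j\<bar> * \<bar>m\<bar> * (l2 q0 * l2 (e j))"
      by (rule CS) (simp_all add: abs_mult)
    have a2: "\<bar>- (\<kappa> j * m) * ip (\<lambda>x. q j x - q0 x) (e j)\<bar> \<le> \<bar>m\<bar> * (l2 (\<lambda>x. q j x - q0 x) * l2 (e j))"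
      by (rule CS) (use \<kappa> mult_right_mono[OF \<kappa>(2), of "\<bar>m\<bar>"] in \<open>simp_all add: abs_mult\<close>)
    have a3: "\<bar>2 * \<kappa> j * (\<mu> * \<nu>) * ip (d j) (e j)\<bar> \<le> 2 * \<bar>\<mu> * \<nu>\<bar> * (l2 (d j) * l2 (e j))"
      by (rule CS) (use \<kappa> mult_right_mono[OF \<kappa>(2), of "\<bar>\<mu> * \<nu>\<bar>"] in \<open>simp_all add: abs_mult\<close>)
    have a4: "\<bar>(\<Lambda>0 - \<Lambda> j) * k * ip N0 (e j)\<bar> \<le> \<bar>\<Lambda>0 - \<Lambda> j\<bar> * \<bar>k\<bar> * (l2 N0 * l2 (e j))"
      by (rule CS) (simp_all add: abs_mult)
    have a5: "\<bar>- (\<Lambda> j * k) * ip (\<eta> j) (e j)\<bar> \<le> \<bar>\<Lambda> j\<bar> * \<bar>k\<bar> * (l2 (\<eta> j) * l2 (e j))"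
      by (rule CS) (simp_all add: abs_mult)
    have a6: "\<bar>\<Lambda> j * \<nu> * (p + 1) * ip (dM j) (e j)\<bar> \<le> \<bar>\<Lambda> j * \<nu>\<bar> * (p + 1) * (l2 (dM j) * l2 (e j))"
      by (rule CS) (use p in \<open>simp_all add: abs_mult\<close>)
    have \<delta>bm: "\<bar>\<kappa> j * \<delta> j * b * m\<bar> \<le> \<delta> j * (b * \<bar>m\<bar>)"
      using mult_right_mono[OF \<kappa>(2), of "\<delta> j * (b * \<bar>m\<bar>)"] \<kappa> \<delta>_pos[of j] b by (simp add: abs_mult mult.assoc)
    have a7: "\<bar>- (\<kappa> j * \<delta> j * b * m) * ip (\<lambda>x. q' j x - q0' x) (e' j)\<bar> \<le> \<delta> j * (b * \<bar>m\<bar>) * (l2 (\<lambda>x. q' j x - q0' x) * l2 (e' j))"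
      by (rule CS) (use \<delta>bm in simp_all)
    have \<delta>bm': "\<bar>\<kappa> j * \<delta> j * b * m / \<gamma>\<bar> \<le> \<delta> j * (b * \<bar>m\<bar> / \<gamma>)"
      using divide_right_mono[OF \<delta>bm, of \<gamma>] \<gamma> by simp
    have a8: "\<bar>\<kappa> j * \<delta> j * b * m / \<gamma> * ip q0 (e j)\<bar> \<le> \<delta> j * (b * \<bar>m\<bar> / \<gamma>) * (l2 q0 * l2 (e j))"
      by (rule CS) (use \<delta>bm' in simp_all)
    have a9: "\<bar>\<kappa> j * \<delta> j * b * m / \<gamma> * (\<Lambda>0 * (p + 2)) * ip N0 (e j)\<bar> \<le> \<delta> j * (b * \<bar>m\<bar> / \<gamma>) * \<bar>\<Lambda>0 * (p + 2)\<bar> * (l2 N0 * l2 (e j))"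
    proof (rule CS)
      show "\<bar>\<kappa> j * \<delta> j * b * m / \<gamma> * (\<Lambda>0 * (p + 2))\<bar> \<le> \<delta> j * (b * \<bar>m\<bar> / \<gamma>) * \<bar>\<Lambda>0 * (p + 2)\<bar>"
        unfolding abs_mult[of _ "\<Lambda>0 * (p + 2)"] by (rule mult_right_mono[OF \<delta>bm']) simp
    qed simp_all
    have a10: "\<bar>- (\<delta> j * \<beta> j) * ip corrector' (e' j)\<bar> \<le> \<delta> j * \<beta> j * (l2 corrector' * l2 (e' j))"
      by (rule CS) (use \<beta>0 in simp_all)
    have split: "ip (q' j) (e' j) = ip q0' (e' j) + ip (\<lambda>x. q' j x - q0' x) (e' j)"
      by (simp add: ip_diff_left)
    have "ip (e j) (e j) + \<delta> j * \<beta> j * ip (e' j) (e' j)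
     = (1 / 2 - \<kappa> j) * m * ip q0 (e j) + - (\<kappa> j * m) * ip (\<lambda>x. q j x - q0 x) (e j) + 2 * \<kappa> j * (\<mu> * \<nu>) * ip (d j) (e j)
       + (\<Lambda>0 - \<Lambda> j) * k * ip N0 (e j) + - (\<Lambda> j * k) * ip (\<eta> j) (e j) + \<Lambda> j * \<nu> * (p + 1) * ip (dM j) (e j)
       + - (\<kappa> j * \<delta> j * b * m) * ip (\<lambda>x. q' j x - q0' x) (e' j) + \<kappa> j * \<delta> j * b * m / \<gamma> * ip q0 (e j)
       + \<kappa> j * \<delta> j * b * m / \<gamma> * (\<Lambda>0 * (p + 2)) * ip N0 (e j) + - (\<delta> j * \<beta> j) * ip corrector' (e' j)"
      using main[of j] q0e'[of j] unfolding split by (simp add: algebra_simps)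
    also have "\<dots> \<le> \<bar>1 / 2 - \<kappa> j\<bar> * \<bar>m\<bar> * (l2 q0 * l2 (e j)) + \<bar>m\<bar> * (l2 (\<lambda>x. q j x - q0 x) * l2 (e j)) + 2 * \<bar>\<mu> * \<nu>\<bar> * (l2 (d j) * l2 (e j))
       + \<bar>\<Lambda>0 - \<Lambda> j\<bar> * \<bar>k\<bar> * (l2 N0 * l2 (e j)) + \<bar>\<Lambda> j\<bar> * \<bar>k\<bar> * (l2 (\<eta> j) * l2 (e j)) + \<bar>\<Lambda> j * \<nu>\<bar> * (p + 1) * (l2 (dM j) * l2 (e j))
       + \<delta> j * (b * \<bar>m\<bar>) * (l2 (\<lambda>x. q' j x - q0' x) * l2 (e' j)) + \<delta> j * (b * \<bar>m\<bar> / \<gamma>) * (l2 q0 * l2 (e j))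
       + \<delta> j * (b * \<bar>m\<bar> / \<gamma>) * \<bar>\<Lambda>0 * (p + 2)\<bar> * (l2 N0 * l2 (e j)) + \<delta> j * \<beta> j * (l2 corrector' * l2 (e' j))"
      by (intro add_mono a1[THEN abs_le_D1] a2[THEN abs_le_D1] a3[THEN abs_le_D1] a4[THEN abs_le_D1] a5[THEN abs_le_D1]
          a6[THEN abs_le_D1] a7[THEN abs_le_D1] a8[THEN abs_le_D1] a9[THEN abs_le_D1] a10[THEN abs_le_D1])
    also have "\<dots> = T j * l2 (e j)
      + b * \<bar>m\<bar> * l2 (\<lambda>x. q' j x - q0' x) * (\<delta> j * l2 (e' j)) + \<delta> j * \<beta> j * (l2 corrector' * l2 (e' j))"
      unfolding T_def by (simp only: distrib_left distrib_right mult.assoc mult.left_commute add.assoc add.left_commute add.commute mult.commute)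
    finally show ?thesis .
  qed
  \<comment> \<open>With \<beta> j \<ge> c1 \<delta> j, the term \<delta>\<beta>|e'|^2 dominates c1
    (\<delta>|e'|)^2, the quantity to be estimated.\<close>
  define c1 where "c1 = b\<^sup>2 / \<gamma>"
  have c1: "c1 > 0" using b \<gamma> by (simp add: c1_def)
  define H where "H j = b * \<bar>m\<bar> * l2 (\<lambda>x. q' j x - q0' x)" for j
  define \<rho> where "\<rho> j = \<delta> j * \<beta> j / 2 * (l2 corrector')\<^sup>2" for j
  have key: "(\<delta> j * l2 (e' j))\<^sup>2 \<le> 4 / c1 * ((T j)\<^sup>2 / 4 + (H j)\<^sup>2 / c1 + \<rho> j)" for j
  proof -
    define E where "E = \<delta> j * l2 (e' j)"
    have \<beta>: "c1 * \<delta> j \<le> \<beta> j"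
      using derivative_coefficient[OF \<delta>_pos[of j] \<delta>_small(2)[of j] \<kappa>_bounds[of j]] by (simp add: \<beta>_def c1_def)
    have "0 < c1 * \<delta> j" using c1 \<delta>_pos[of j] by simp
    then have \<beta>0: "0 \<le> \<delta> j * \<beta> j" using \<beta> \<delta>_pos[of j] by simp
    have 1: "(l2 (e j))\<^sup>2 + \<delta> j * \<beta> j * (l2 (e' j))\<^sup>2 \<le> T j * l2 (e j) + H j * E + \<delta> j * \<beta> j * (l2 corrector' * l2 (e' j))"
      using est[of j] by (simp add: l2_sq H_def E_def)
    \<comment> \<open>Half of \<delta>\<beta>|e'|^2 pays for the corrector, leaving \<rho>. The
      other half is at least c1/2 E^2 by \<open>5\<close>, of which \<open>4\<close> spends half on
      H E. In \<open>3\<close>, |e|^2 is spent entirely on T.\<close>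
    have 2: "\<delta> j * \<beta> j * (l2 corrector' * l2 (e' j)) \<le> \<rho> j + \<delta> j * \<beta> j / 2 * (l2 (e' j))\<^sup>2"
    proof -
      have "0 \<le> \<delta> j * \<beta> j / 2 * (l2 corrector' - l2 (e' j))\<^sup>2" using \<beta>0 by simp
      then show ?thesis by (simp add: \<rho>_def power2_diff algebra_simps)
    qed
    have 3: "T j * l2 (e j) \<le> (T j)\<^sup>2 / 4 + (l2 (e j))\<^sup>2"
    proof -
      have "0 \<le> (T j / 2 - l2 (e j))\<^sup>2" by simp
      then show ?thesis by (simp add: power2_diff power_divide algebra_simps)
    qed
    have 4: "H j * E \<le> (H j)\<^sup>2 / c1 + c1 / 4 * E\<^sup>2"
    proof -
      have "0 \<le> 1 / c1 * (H j - c1 / 2 * E)\<^sup>2" using c1 by simp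
      also have "\<dots> = (H j)\<^sup>2 / c1 + c1 / 4 * E\<^sup>2 - H j * E"
        using c1 by (simp add: power2_diff power_mult_distrib field_simps) (simp add: power2_eq_square)
      finally show ?thesis by simp
    qed
    have 5: "c1 / 2 * E\<^sup>2 \<le> \<delta> j * \<beta> j / 2 * (l2 (e' j))\<^sup>2"
    proof -
      have "c1 / 2 * E\<^sup>2 = (c1 * \<delta> j) * (\<delta> j / 2 * (l2 (e' j))\<^sup>2)" by (simp add: E_def power2_eq_square)
      also have "\<dots> \<le> \<beta> j * (\<delta> j / 2 * (l2 (e' j))\<^sup>2)"
        using \<delta>_pos[of j] by (intro mult_right_mono \<beta>) auto
      finally show ?thesis by (simp add: mult_ac)
    qed
    have 6: "\<delta> j * \<beta> j * (l2 (e' j))\<^sup>2 = \<delta> j * \<beta> j / 2 * (l2 (e' j))\<^sup>2 + \<delta> j * \<beta> j / 2 * (l2 (e' j))\<^sup>2" by simp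
    have "c1 / 4 * E\<^sup>2 \<le> (T j)\<^sup>2 / 4 + (H j)\<^sup>2 / c1 + \<rho> j"
      using 1 2 3 4 5 6 by argo
    then have "4 / c1 * (c1 / 4 * E\<^sup>2) \<le> 4 / c1 * ((T j)\<^sup>2 / 4 + (H j)\<^sup>2 / c1 + \<rho> j)"
      using c1 by (intro mult_left_mono) auto
    then show ?thesis using c1 by (simp add: E_def)
  qed
  have \<eta>_lim: "(\<lambda>j. l2 (\<eta> j)) \<longlonglongrightarrow> 0"
    using Nw_N0_tendsto by (simp add: \<eta>_def[abs_def] N0_def)
  have dM_lim: "(\<lambda>j. l2 (dM j)) \<longlonglongrightarrow> 0" using dM_tendsto by (simp add: dM_def[abs_def])
  have "T \<longlonglongrightarrow> \<bar>1 / 2 - 1 / 2\<bar> * \<bar>m\<bar> * l2 q0 + \<bar>m\<bar> * 0 + 2 * \<bar>\<mu> * \<nu>\<bar> * 0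
    + \<bar>\<Lambda>0 - \<Lambda>0\<bar> * \<bar>k\<bar> * l2 N0 + \<bar>\<Lambda>0\<bar> * \<bar>k\<bar> * 0 + \<bar>\<Lambda>0 * \<nu>\<bar> * (p + 1) * 0
    + 0 * (b * \<bar>m\<bar> / \<gamma> * (l2 q0 + \<bar>\<Lambda>0 * (p + 2)\<bar> * l2 N0))"
    unfolding T_def[abs_def] by (intro tendsto_intros \<kappa>_lim \<Lambda>_lim q_strong l2_d_tendsto \<eta>_lim dM_lim \<delta>_lim)
  then have T_lim: "T \<longlonglongrightarrow> 0" by simp
  have "H \<longlonglongrightarrow> b * \<bar>m\<bar> * 0" unfolding H_def[abs_def] by (intro tendsto_intros q'_strong)
  then have H_lim: "H \<longlonglongrightarrow> 0" by simp
  have "\<rho> \<longlonglongrightarrow> 0 * (D / \<gamma> - 2 * (1 / 2) * 0 * b * (\<mu> * \<nu>)) / 2 * (l2 corrector')\<^sup>2"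
    unfolding \<rho>_def[abs_def] \<beta>_def by (intro tendsto_intros \<kappa>_lim \<delta>_lim) simp
  then have \<rho>_lim: "\<rho> \<longlonglongrightarrow> 0" by simp
  have "(\<lambda>j. 4 / c1 * ((T j)\<^sup>2 / 4 + (H j)\<^sup>2 / c1 + \<rho> j)) \<longlonglongrightarrow> 4 / c1 * (0\<^sup>2 / 4 + 0\<^sup>2 / c1 + 0)"
    using c1 by (intro tendsto_intros T_lim H_lim \<rho>_lim) auto
  then have "(\<lambda>j. 4 / c1 * ((T j)\<^sup>2 / 4 + (H j)\<^sup>2 / c1 + \<rho> j)) \<longlonglongrightarrow> 0" by simp
  then have "(\<lambda>j. (\<delta> j * l2 (e' j))\<^sup>2) \<longlonglongrightarrow> 0"
    by (rule tendsto_sandwich[OF always_eventually always_eventually tendsto_const, rotated 2]) (use key in auto)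
  then have "(\<lambda>j. sqrt ((\<delta> j * l2 (e' j))\<^sup>2)) \<longlonglongrightarrow> sqrt 0" by (rule tendsto_real_sqrt)
  moreover have "sqrt ((\<delta> j * l2 (e' j))\<^sup>2) = \<delta> j * l2 (e' j)" for j
    using \<delta>_pos[of j] l2_nonneg[of "e' j"] by simp
  ultimately have "(\<lambda>j. \<delta> j * l2 (e' j)) \<longlonglongrightarrow> 0" by simp
  then have "(\<lambda>j. \<delta> j * l2 (e' j) + \<delta> j * l2 corrector') \<longlonglongrightarrow> 0 + 0 * l2 corrector'"
    by (intro tendsto_intros \<delta>_lim)
  then have "(\<lambda>j. \<delta> j * l2 (e' j) + \<delta> j * l2 corrector') \<longlonglongrightarrow> 0" by simp
  then show ?thesis
  proof (rule l2_tendsto_0I)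
    fix j
    have "l2 (d' j) = \<delta> j * l2 (\<lambda>x. e' j x + corrector' x)"
      unfolding d'_e[of j] l2_scale using \<delta>_pos[of j] by simp
    also have "\<dots> \<le> \<delta> j * (l2 (e' j) + l2 corrector')"
      using \<delta>_pos[of j] by (intro mult_left_mono l2_triangle) auto
    finally show "l2 (d' j) \<le> \<delta> j * l2 (e' j) + \<delta> j * l2 corrector'" by (simp add: distrib_left)
  qed
qed

end

text \<open>After dropping N terms, translations move a point with |q| \<ge> c to the origin, so
  that the pointwise limit cannot vanish there. Subsequences are then taken for q, for P and for the
  scalar quantities. The conclusions on d carry no translation since L^2 norms do not see
  it.\<close>

theorem (in minimizing_sequence) strong_limit:
  obtains r :: "nat \<Rightarrow> nat" and y :: "nat \<Rightarrow> real" and Q Q' :: "real \<Rightarrow> real" and m :: real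
  where "strict_mono r" "m > 0" "sob Q Q'" "sob Q' (\<lambda>x. (Q x + 2 * m / (p + 1) * pow_p1 p (Q x)) / \<gamma>)"
    "\<And>x. (Q has_real_derivative Q' x) (at x)"
    "\<And>x. (Q' has_real_derivative (Q x + 2 * m / (p + 1) * pow_p1 p (Q x)) / \<gamma>) (at x)"
    "ip Q (\<lambda>x. pow_p1 p (Q x)) = - (p + 1) / 2" "m = ip Q Q + \<gamma> * ip Q' Q'"
    "\<And>\<phi> \<phi>'. sob \<phi> \<phi>' \<Longrightarrow> ip \<phi> (\<lambda>x. pow_p1 p (\<phi> x)) = - (p + 1) / 2 \<Longrightarrow> m \<le> ip \<phi> \<phi> + \<gamma> * ip \<phi>' \<phi>'"
    "(\<lambda>j. l2 (\<lambda>x. q (r j) (x + y j) - Q x)) \<longlonglongrightarrow> 0" "(\<lambda>j. l2 (\<lambda>x. q' (r j) (x + y j) - Q' x)) \<longlonglongrightarrow> 0"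
    "(\<lambda>j. l2 (d (r j))) \<longlonglongrightarrow> 0" "(\<lambda>j. l2 (d' (r j))) \<longlonglongrightarrow> 0"
proof -
  obtain c N where c: "c > 0" "\<And>j. j \<ge> N \<Longrightarrow> \<exists>y. c \<le> \<bar>q j y\<bar>"
    using nonvanishing unfolding eventually_sequentially by blast
  then have "\<forall>j. \<exists>y. c \<le> \<bar>q (j + N) y\<bar>" by simp
  then obtain y where y: "\<And>j. c \<le> \<bar>q (j + N) (y j)\<bar>" by metis
  have m1: "minimizing_sequence \<gamma> b D \<mu> \<nu> p (\<lambda>j. \<delta> (j + N)) (\<lambda>j. \<kappa> (j + N)) (\<lambda>j. lam (j + N))
     (\<lambda>j x. q (j + N) (x + y j)) (\<lambda>j x. q' (j + N) (x + y j)) (\<lambda>j x. d (j + N) (x + y j)) (\<lambda>j x. d' (j + N) (x + y j))"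
    by (intro minimizing_sequence_translate minimizing_sequence_subseq[OF minimizing_sequence_axioms, of "\<lambda>j. j + N"])
      (simp add: strict_mono_def)
  interpret M: minimizing_sequence \<gamma> b D \<mu> \<nu> p "\<lambda>j. \<delta> (j + N)" "\<lambda>j. \<kappa> (j + N)" "\<lambda>j. lam (j + N)"
     "\<lambda>j x. q (j + N) (x + y j)" "\<lambda>j x. q' (j + N) (x + y j)" "\<lambda>j x. d (j + N) (x + y j)" "\<lambda>j x. d' (j + N) (x + y j)"
    by (fact m1)
  define force' where "force' j = force p (\<kappa> (j + N)) (lam (j + N)) (M.z j) (M.w j)" for j
  have "\<forall>j. \<exists>P. sob P (force' j) \<and>
    (AE x in lborel. P x = \<gamma> * q' (j + N) (x + y j) + \<kappa> (j + N) * \<delta> (j + N) * b * (M.z' j x + M.w' j x))"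
    unfolding force'_def by (intro allI M.momentum_representative)
  from choice[OF this] obtain P where "\<forall>j. sob (P j) (force' j) \<and>
    (AE x in lborel. P j x = \<gamma> * q' (j + N) (x + y j) + \<kappa> (j + N) * \<delta> (j + N) * b * (M.z' j x + M.w' j x))" ..
  then have P: "\<And>j. sob (P j) (force' j)"
    "\<And>j. AE x in lborel. P j x = \<gamma> * q' (j + N) (x + y j) + \<kappa> (j + N) * \<delta> (j + N) * b * (M.z' j x + M.w' j x)"
    by simp_all
  obtain R1 where R1: "\<And>j. l2 (P j) \<le> R1" "\<And>j. l2 (force' j) \<le> R1"
  proof (rule M.momentum_bounds, fold force'_def)
    fix R
    assume R: "\<And>j P. sob P (force' j) \<Longrightarrow>
      AE x in lborel. P x = \<gamma> * q' (j + N) (x + y j) + \<kappa> (j + N) * \<delta> (j + N) * b * (M.z' j x + M.w' j x) \<Longrightarrow>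
      l2 P \<le> R \<and> l2 (force' j) \<le> R"
    show ?thesis by (rule that[of R]; rule R[OF P, THEN conjunct1] R[OF P, THEN conjunct2])
  qed
  obtain R2 where R2: "\<And>j. l2 (\<lambda>x. q (j + N) (x + y j)) \<le> R2" "\<And>j. l2 (\<lambda>x. q' (j + N) (x + y j)) \<le> R2"
    "\<And>j. 0 \<le> lam (j + N)" "\<And>j. lam (j + N) \<le> R2"
  proof (rule M.uniform_bounds)
    fix R
    assume a: "\<And>j. l2 (\<lambda>x. q (j + N) (x + y j)) \<le> R" "\<And>j. l2 (\<lambda>x. q' (j + N) (x + y j)) \<le> R"
      "\<And>j. 0 \<le> lam (j + N)" "\<And>j. lam (j + N) \<le> R"
    from a show ?thesis by (rule that)
  qed
  obtain r1 q0 where r1: "strict_mono (r1::nat \<Rightarrow> nat)" "\<And>x. (\<lambda>j. q (r1 j + N) (x + y (r1 j))) \<longlonglongrightarrow> q0 x" "\<And>x. isCont q0 x"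
    by (rule sob_convergent_subsequence[OF M.sq R2(1,2)]) (rule that)
  obtain r2 P0 where r2: "strict_mono (r2::nat \<Rightarrow> nat)" "\<And>x. (\<lambda>j. P (r1 (r2 j)) x) \<longlonglongrightarrow> P0 x" "\<And>x. isCont P0 x"
    by (rule sob_convergent_subsequence[of "\<lambda>j. P (r1 j)" "\<lambda>j. force' (r1 j)" R1, OF P(1) R1]) (rule that)
  \<comment> \<open>The three bounded scalar sequences are bundled into one in R^3, so that a single
    subsequence makes all of them converge.\<close>
  define u where "u j = (lam (r1 (r2 j) + N), ip (\<lambda>x. q (r1 (r2 j) + N) (x + y (r1 (r2 j)))) (\<lambda>x. q (r1 (r2 j) + N) (x + y (r1 (r2 j)))),
     ip (P (r1 (r2 j))) (P (r1 (r2 j))))" for j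
  have "bounded (range u)"
  proof -
    have sqle: "ip f f \<le> R\<^sup>2" if "l2 f \<le> R" for f R
      using power_mono[OF that l2_nonneg, of 2] by (simp add: l2_sq)
    have "range u \<subseteq> {0..R2} \<times> ({0..R2\<^sup>2} \<times> {0..R1\<^sup>2})"
      using R2(3,4) sqle[OF R2(1)] sqle[OF R1(1)] by (auto simp: u_def ip_self_nonneg)
    then show ?thesis by (rule bounded_subset[rotated]) (intro bounded_Times bounded_closed_interval)
  qed
  then obtain l r3 where r3: "strict_mono (r3::nat \<Rightarrow> nat)" "(u \<circ> r3) \<longlonglongrightarrow> l"
    using bounded_imp_convergent_subsequence by blast
  obtain l0 A A1 where l: "l = (l0, A, A1)" by (cases l) auto
  define s where "s j = r1 (r2 (r3 j))" for j
  have sm: "strict_mono s" using r1(1) r2(1) r3(1) unfolding s_def strict_mono_def by blast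
  have lims: "(\<lambda>j. lam (s j + N)) \<longlonglongrightarrow> l0"
    "(\<lambda>j. ip (\<lambda>x. q (s j + N) (x + y (s j))) (\<lambda>x. q (s j + N) (x + y (s j)))) \<longlonglongrightarrow> A"
    "(\<lambda>j. ip (P (s j)) (P (s j))) \<longlonglongrightarrow> A1"
    using tendsto_fst[OF r3(2)] tendsto_fst[OF tendsto_snd[OF r3(2)]] tendsto_snd[OF tendsto_snd[OF r3(2)]]
    by (simp_all add: l u_def s_def o_def)
  have ql: "(\<lambda>j. q (s j + N) (x + y (s j))) \<longlonglongrightarrow> q0 x" for x
  proof -
    have "strict_mono (\<lambda>j. r2 (r3 j))" using r2(1) r3(1) unfolding strict_mono_def by blast
    from LIMSEQ_subseq_LIMSEQ[OF r1(2) this] show ?thesis by (simp add: o_def s_def)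
  qed
  have Pl: "(\<lambda>j. P (s j) x) \<longlonglongrightarrow> P0 x" for x
    using LIMSEQ_subseq_LIMSEQ[OF r2(2) r3(1)] by (simp add: o_def s_def)
  have "q0 0 \<noteq> 0"
  proof -
    have "c \<le> \<bar>q0 0\<bar>"
      by (rule LIMSEQ_le_const[OF tendsto_rabs[OF ql[of 0]]]) (use y in auto)
    then show ?thesis using c(1) by auto
  qed
  interpret C: convergent_sequence \<gamma> b D \<mu> \<nu> p "\<lambda>j. \<delta> (s j + N)" "\<lambda>j. \<kappa> (s j + N)" "\<lambda>j. lam (s j + N)"
     "\<lambda>j x. q (s j + N) (x + y (s j))" "\<lambda>j x. q' (s j + N) (x + y (s j))" "\<lambda>j x. d (s j + N) (x + y (s j))"
     "\<lambda>j x. d' (s j + N) (x + y (s j))" "\<lambda>j. P (s j)" q0 P0 l0 A A1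
  proof (rule convergent_sequence.intro)
    show "minimizing_sequence \<gamma> b D \<mu> \<nu> p (\<lambda>j. \<delta> (s j + N)) (\<lambda>j. \<kappa> (s j + N)) (\<lambda>j. lam (s j + N))
      (\<lambda>j x. q (s j + N) (x + y (s j))) (\<lambda>j x. q' (s j + N) (x + y (s j))) (\<lambda>j x. d (s j + N) (x + y (s j)))
      (\<lambda>j x. d' (s j + N) (x + y (s j)))"
      by (rule minimizing_sequence_subseq[OF m1 sm])
    show "convergent_sequence_axioms \<gamma> b \<mu> \<nu> p (\<lambda>j. \<delta> (s j + N)) (\<lambda>j. \<kappa> (s j + N)) (\<lambda>j. lam (s j + N))
      (\<lambda>j x. q (s j + N) (x + y (s j))) (\<lambda>j x. q' (s j + N) (x + y (s j))) (\<lambda>j x. d (s j + N) (x + y (s j)))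
      (\<lambda>j x. d' (s j + N) (x + y (s j))) (\<lambda>j. P (s j)) q0 P0 l0 A A1"
      by unfold_locales (fact P(1)[unfolded force'_def] P(2) ql Pl r1(3) r2(3) lims \<open>q0 0 \<noteq> 0\<close>)+
  qed
  have k: "mult_const p l0 * (p + 2) = 2 * l0 / (p + 1)" using p by (simp add: mult_const_def)
  have dt: "l2 (\<lambda>x. d (s j + N) (x + y (s j))) = l2 (d (s j + N))"
    "l2 (\<lambda>x. d' (s j + N) (x + y (s j))) = l2 (d' (s j + N))" for j
    by (rule l2_translate[of "d (s j + N)" "y (s j)"], rule l2_translate[of "d' (s j + N)" "y (s j)"])
  have st: "strict_mono (\<lambda>j. s j + N)" using sm by (simp add: strict_mono_def)
  show ?thesis
  \<comment> \<open>The index carries the shift N and the translation does not, because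
    \<open>y j\<close> was chosen for \<open>q (j + N)\<close>.\<close>
  proof (rule that[where r = "\<lambda>j. s j + N" and y = "\<lambda>j. y (s j)" and Q = q0 and Q' = "\<lambda>x. P0 x / \<gamma>" and m = l0])
    show "strict_mono (\<lambda>j. s j + N)" "l0 > 0" "sob q0 (\<lambda>x. P0 x / \<gamma>)" "\<And>x. (q0 has_real_derivative P0 x / \<gamma>) (at x)"
      "ip q0 (\<lambda>x. pow_p1 p (q0 x)) = - (p + 1) / 2"
      by (fact st C.limit_is_minimizer C.sob_q0 C.q0_deriv)+
    show "l0 \<le> ip \<phi> \<phi> + \<gamma> * ip \<phi>' \<phi>'" if "sob \<phi> \<phi>'" "ip \<phi> (\<lambda>x. pow_p1 p (\<phi> x)) = - (p + 1) / 2" for \<phi> \<phi>'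
      by (rule C.l0_le[OF that])
    show "(\<lambda>j. l2 (\<lambda>x. q (s j + N) (x + y (s j)) - q0 x)) \<longlonglongrightarrow> 0"
      "(\<lambda>j. l2 (\<lambda>x. q' (s j + N) (x + y (s j)) - P0 x / \<gamma>)) \<longlonglongrightarrow> 0"
      by (fact C.q_strong C.q'_strong)+
    show "sob (\<lambda>x. P0 x / \<gamma>) (\<lambda>x. (q0 x + 2 * l0 / (p + 1) * pow_p1 p (q0 x)) / \<gamma>)"
      using sob_scale[OF C.sob_P0, of "1 / \<gamma>"] unfolding k by simp
    show "((\<lambda>x. P0 x / \<gamma>) has_real_derivative (q0 x + 2 * l0 / (p + 1) * pow_p1 p (q0 x)) / \<gamma>) (at x)" for x
      using DERIV_cdivide[OF C.P0_deriv, of \<gamma> x] unfolding k .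
    show "l0 = ip q0 q0 + \<gamma> * ip (\<lambda>x. P0 x / \<gamma>) (\<lambda>x. P0 x / \<gamma>)"
      using C.limit_is_minimizer(2) unfolding C.J_def by simp
    show "(\<lambda>j. l2 (d (s j + N))) \<longlonglongrightarrow> 0" using C.l2_d_tendsto unfolding dt .
    show "(\<lambda>j. l2 (d' (s j + N))) \<longlonglongrightarrow> 0" using C.d'_strong unfolding dt .
  qed
qed

section \<open>The rescaled Boussinesq functional\<close>

lemma sob_measurable:
  assumes "sob f g"
  shows "f \<in> borel_measurable borel" "g \<in> borel_measurable borel"
  using sob_L2[OF assms] by (auto intro: L2_measurable)

lemma quadratic_expand:
  assumes "F \<in> L2" "H \<in> L2"
  shows "s * ip (\<lambda>x. n * F x + m * H x) (\<lambda>x. n * F x + m * H x) + t * ip (\<lambda>x. F x - H x) (\<lambda>x. F x - H x)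
    = (s * n\<^sup>2 + t) * ip F F + (s * m\<^sup>2 + t) * ip H H + 2 * (s * m * n - t) * ip F H"
  using assms by (simp add: ip_linear L2_closed ip_commute[of H F] power2_eq_square algebra_simps)

context abcb_system
begin

text \<open>q = \<nu> z + \<mu> w and d = z - w invert z = q + \<mu> d, w = q - \<nu> d; this is
  where \<mu> + \<nu> = 1 is used.\<close>

lemma lin_coordinates:
  "lin \<mu> (\<lambda>x. \<nu> * f x + \<mu> * g x) (\<lambda>x. f x - g x) = f"
  "lin (- \<nu>) (\<lambda>x. \<nu> * f x + \<mu> * g x) (\<lambda>x. f x - g x) = g"
proof -
  have "lin \<mu> (\<lambda>x. \<nu> * f x + \<mu> * g x) (\<lambda>x. f x - g x) x = (\<mu> + \<nu>) * f x"
    "lin (- \<nu>) (\<lambda>x. \<nu> * f x + \<mu> * g x) (\<lambda>x. f x - g x) x = (\<mu> + \<nu>) * g x" for x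
    by (simp_all add: lin_def algebra_simps)
  then show "lin \<mu> (\<lambda>x. \<nu> * f x + \<mu> * g x) (\<lambda>x. f x - g x) = f"
    "lin (- \<nu>) (\<lambda>x. \<nu> * f x + \<mu> * g x) (\<lambda>x. f x - g x) = g"
    unfolding mn mult_1 fun_eq_iff by simp_all
qed

lemma coordinates_lin:
  "(\<lambda>x. \<nu> * (s * lin \<mu> u v x) + \<mu> * (s * lin (- \<nu>) u v x)) = (\<lambda>x. s * u x)"
  "(\<lambda>x. s * lin \<mu> u v x - s * lin (- \<nu>) u v x) = (\<lambda>x. s * v x)"
proof -
  have "\<nu> * (s * lin \<mu> u v x) + \<mu> * (s * lin (- \<nu>) u v x) = s * ((\<mu> + \<nu>) * u x)"
    "s * lin \<mu> u v x - s * lin (- \<nu>) u v x = s * ((\<mu> + \<nu>) * v x)" for x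
    by (simp_all add: lin_def algebra_simps)
  then show "(\<lambda>x. \<nu> * (s * lin \<mu> u v x) + \<mu> * (s * lin (- \<nu>) u v x)) = (\<lambda>x. s * u x)"
    "(\<lambda>x. s * lin \<mu> u v x - s * lin (- \<nu>) u v x) = (\<lambda>x. s * v x)"
    by (simp_all only: mn mult_1)
qed

end

section \<open>Norms, functionals and constraint on representatives\<close>

lemma H1_norm_eq:
  assumes "sob F g" "f \<in> borel_measurable borel" "AE x in lborel. f x = F x"
  shows "H1_norm f = sqrt ((l2 F)\<^sup>2 + (l2 g)\<^sup>2)"
proof -
  note h = sob_imp_H1[OF assms]
  have "F \<in> borel_measurable borel" "g \<in> borel_measurable borel"
    by (rule sob_measurable[OF assms(1)])+
  then have "ip f f = ip F F" "ip (weak_deriv f) (weak_deriv f) = ip g g"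
    using h assms by (auto intro!: ip_cong_AE)
  then show ?thesis unfolding H1_norm_def l2_sq by (simp add: ip_def power2_eq_square)
qed

lemma J0_functional_eq:
  assumes "sob F g" "f \<in> borel_measurable borel" "AE x in lborel. f x = F x"
  shows "(LINT y|lborel. (f y)\<^sup>2 + s * (weak_deriv f y)\<^sup>2) = ip F F + s * ip g g"
    and "(LINT y|lborel. pow_p2 p (f y)) = ip F (\<lambda>x. pow_p1 p (F x))"
proof -
  note h = sob_imp_H1[OF assms]
  have m: "F \<in> borel_measurable borel" "g \<in> borel_measurable borel"
    by (rule sob_measurable[OF assms(1)])+
  note [measurable] = m assms(2) h(3)
  have "(LINT y|lborel. (f y)\<^sup>2 + s * (weak_deriv f y)\<^sup>2) = (LINT y|lborel. F y * F y + s * (g y * g y))"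
    by (rule integral_cong_AE) (use assms(3) h(2) in \<open>auto simp: power2_eq_square\<close>)
  also have "\<dots> = ip F F + s * ip g g"
    unfolding ip_def
    by (subst Bochner_Integration.integral_add)
      (auto intro!: integrable_mult_right L2_square_integrable sob_L2[OF assms(1)])
  finally show "(LINT y|lborel. (f y)\<^sup>2 + s * (weak_deriv f y)\<^sup>2) = ip F F + s * ip g g" .
  show "(LINT y|lborel. pow_p2 p (f y)) = ip F (\<lambda>x. pow_p1 p (F x))"
    unfolding ip_def pow_p2_eq
  proof (rule integral_cong_AE)
    show "AE x in lborel. f x * pow_p1 p (f x) = F x * pow_p1 p (F x)"
      using assms(3) by eventually_elim simp
  qed measurable
qed

lemma G_eq:
  assumes "f \<in> borel_measurable borel" "AE x in lborel. f x = F x" "F \<in> borel_measurable borel"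
    and "g \<in> borel_measurable borel" "AE x in lborel. g x = H x" "H \<in> borel_measurable borel"
  shows "G p f g = 2 / (p + 1) * ip F (\<lambda>x. pow_p1 p (H x))"
proof -
  note [measurable] = assms(1,3,4,6)
  have "(LINT y|lborel. f y * pow_p1 p (g y)) = ip F (\<lambda>x. pow_p1 p (H x))"
    unfolding ip_def
  proof (rule integral_cong_AE)
    show "AE x in lborel. f x * pow_p1 p (g x) = F x * pow_p1 p (H x)"
      using assms(2,5) by eventually_elim simp
  qed measurable
  then show ?thesis by (simp add: G_def)
qed

locale abcb_parameters =
  fixes a b c p \<sigma> :: real
  assumes b_pos: "b > 0" and a_neg: "a < 0" and c_neg: "c < 0"
    and b_le: "b \<le> sqrt (a * c)" and b_lt: "2 * b < - a - c" and p_pos: "p > 0"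
    and \<sigma>: "a + c + 2 * b = 1 / 3 - \<sigma>"
begin

abbreviation "\<gamma> \<equiv> \<sigma> - 1 / 3"
abbreviation "\<mu> \<equiv> (- a - b) / \<gamma>"
abbreviation "\<nu> \<equiv> (- c - b) / \<gamma>"
abbreviation "\<Delta> \<equiv> a * c - b\<^sup>2"

lemma gamma_pos: "\<gamma> > 0" using b_lt \<sigma> by linarith

lemma gamma_eq: "\<gamma> = - (a + c + 2 * b)" using \<sigma> by linarith

text \<open>D \<ge> 0 is the hypothesis b \<le> sqrt (a c), and \<gamma> > 0 is 2b < -a - c. The
  product rule for \<mu>, \<nu> is (a + b)(c + b) = (a c - b^2) + b (a + c + 2b), whose last term is
  -b\<gamma>.\<close>

sublocale abcb_system \<gamma> b \<Delta> \<mu> \<nu> p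
proof
  have "b\<^sup>2 \<le> (sqrt (a * c))\<^sup>2" using b_le b_pos by (intro power_mono) auto
  then show "0 \<le> a * c - b\<^sup>2" using a_neg c_neg by (simp add: mult_nonpos_nonpos)
  have "\<mu> + \<nu> = (- a - c - 2 * b) / \<gamma>" by (simp add: add_divide_distrib[symmetric])
  also have "- a - c - 2 * b = \<gamma>" using \<sigma> by linarith
  finally show "\<mu> + \<nu> = 1" using gamma_pos by simp
  have "- (\<mu> * \<nu>) * \<gamma>\<^sup>2 = - ((- a - b) * (- c - b))" using gamma_pos by (simp add: power2_eq_square)
  also have "\<dots> = b * \<gamma> - (a * c - b\<^sup>2)" unfolding gamma_eq by (simp add: algebra_simps power2_eq_square)
  finally show "- (\<mu> * \<nu>) * \<gamma>\<^sup>2 = b * \<gamma> - (a * c - b\<^sup>2)" .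
qed (fact p_pos gamma_pos b_pos)+

definition del :: "real \<Rightarrow> real" where "del e = e powr (2 / (p + 1))"
definition kap :: "real \<Rightarrow> real" where "kap e = 1 / (1 + omega p e)"

lemma del_bounds: "0 < e \<Longrightarrow> e < 1 \<Longrightarrow> 0 < del e \<and> del e < 1"
  using p_pos powr_less_mono2[of "2 / (p + 1)" e 1] by (auto simp: del_def)

lemma omega_kap:
  assumes "0 < e" "e < 1"
  shows "omega p e = 1 - kap e * del e" "1 / 2 \<le> kap e" "kap e \<le> 1"
proof -
  have d: "0 < del e" "del e < 1" using del_bounds[OF assms] by auto
  have o: "omega p e = sqrt (1 - del e)" by (simp add: omega_def del_def)
  have o1: "0 \<le> omega p e" "omega p e \<le> 1" using d by (auto simp: o)
  have "(omega p e)\<^sup>2 = 1 - del e" using d by (simp add: o)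
  then have "del e = (1 - omega p e) * (1 + omega p e)" by (simp add: algebra_simps power2_eq_square)
  then show "omega p e = 1 - kap e * del e" using o1 by (simp add: kap_def)
  show "1 / 2 \<le> kap e" "kap e \<le> 1" using o1 by (auto simp: kap_def field_simps)
qed

text \<open>Writing \<omega> = 1 - \<kappa>\<delta> splits each mixed term. The part without
  \<kappa> completes (z^2 + w^2)/\<delta> to (z - w)^2/\<delta> and the derivative part to -c z'^2 -
  a w'^2 - 2b z'w', which \<open>quad\<close> diagonalises by comparing coefficients. The \<kappa>
  parts are the last two terms of \<open>energy_form\<close>.\<close>

lemma I_eps_eq:
  assumes e: "0 < e" "e < 1"
    and F: "sob F F'" "f \<in> borel_measurable borel" "AE x in lborel. f x = F x"
    and H: "sob H H'" "h \<in> borel_measurable borel" "AE x in lborel. h x = H x"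
  shows "I_eps a b c p e f h = energy_form (del e) (kap e) (\<lambda>x. \<nu> * F x + \<mu> * H x) (\<lambda>x. \<nu> * F' x + \<mu> * H' x)
    (\<lambda>x. F x - H x) (\<lambda>x. F' x - H' x)"
proof -
  have L [simp]: "F \<in> L2" "F' \<in> L2" "H \<in> L2" "H' \<in> L2" using F(1) H(1) by (auto dest: sob_L2)
  note hF = sob_imp_H1[OF F] and hH = sob_imp_H1[OF H]
  note [measurable] = L2_measurable[OF L(1)] L2_measurable[OF L(2)] L2_measurable[OF L(3)] L2_measurable[OF L(4)]
     F(2) H(2) hF(3) hH(3)
  define \<delta> where "\<delta> = del e"
  define \<kappa> where "\<kappa> = kap e"
  have \<delta>: "\<delta> > 0" using del_bounds[OF e] by (simp add: \<delta>_def)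
  have inv: "e powr (- 2 / (p + 1)) = 1 / \<delta>"
    using powr_minus_divide[of e "2 / (p + 1)"] by (simp add: \<delta>_def del_def)
  have om: "omega p e = 1 - \<kappa> * \<delta>" using omega_kap(1)[OF e] by (simp add: \<kappa>_def \<delta>_def)
  have i1: "(LINT y|lborel. e powr (- 2 / (p + 1)) * (f y)\<^sup>2 - c * (weak_deriv f y)\<^sup>2
      + e powr (- 2 / (p + 1)) * (h y)\<^sup>2 - a * (weak_deriv h y)\<^sup>2)
    = 1 / \<delta> * ip F F - c * ip F' F' + 1 / \<delta> * ip H H - a * ip H' H'"
  proof -
    have "(LINT y|lborel. e powr (- 2 / (p + 1)) * (f y)\<^sup>2 - c * (weak_deriv f y)\<^sup>2
      + e powr (- 2 / (p + 1)) * (h y)\<^sup>2 - a * (weak_deriv h y)\<^sup>2)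
      = (LINT y|lborel. 1 / \<delta> * (F y * F y) - c * (F' y * F' y) + 1 / \<delta> * (H y * H y) - a * (H' y * H' y))"
      unfolding inv
    proof (rule integral_cong_AE)
      show "AE y in lborel. 1 / \<delta> * (f y)\<^sup>2 - c * (weak_deriv f y)\<^sup>2 + 1 / \<delta> * (h y)\<^sup>2 - a * (weak_deriv h y)\<^sup>2
        = 1 / \<delta> * (F y * F y) - c * (F' y * F' y) + 1 / \<delta> * (H y * H y) - a * (H' y * H' y)"
        using F(3) H(3) hF(2) hH(2) by eventually_elim (simp add: power2_eq_square)
    qed measurable
    also have "\<dots> = 1 / \<delta> * ip F F - c * ip F' F' + 1 / \<delta> * ip H H - a * ip H' H'"
    proof -
      have I: "integrable lborel (\<lambda>y. k * (u y * u y))" if "u \<in> L2" for k u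
        using that by (intro integrable_mult_right L2_square_integrable)
      show ?thesis unfolding ip_def
        by (subst Bochner_Integration.integral_diff Bochner_Integration.integral_add,
            (intro I L Bochner_Integration.integrable_add Bochner_Integration.integrable_diff)+)+ simp
    qed
    finally show ?thesis .
  qed
  have i2: "(LINT y|lborel. e powr (- 2 / (p + 1)) * (f y * h y) + b * (weak_deriv f y * weak_deriv h y))
    = 1 / \<delta> * ip F H + b * ip F' H'"
  proof -
    have "(LINT y|lborel. e powr (- 2 / (p + 1)) * (f y * h y) + b * (weak_deriv f y * weak_deriv h y))
      = (LINT y|lborel. 1 / \<delta> * (F y * H y) + b * (F' y * H' y))"
      unfolding inv
    proof (rule integral_cong_AE)
      show "AE y in lborel. 1 / \<delta> * (f y * h y) + b * (weak_deriv f y * weak_deriv h y)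
        = 1 / \<delta> * (F y * H y) + b * (F' y * H' y)"
        using F(3) H(3) hF(2) hH(2) by eventually_elim simp
    qed measurable
    also have "\<dots> = 1 / \<delta> * ip F H + b * ip F' H'"
      unfolding ip_def by (subst Bochner_Integration.integral_add) (auto intro!: L2_mult_integrable)
    finally show ?thesis .
  qed
  have dd: "ip (\<lambda>x. F x - H x) (\<lambda>x. F x - H x) = ip F F - 2 * ip F H + ip H H"
    by (simp add: ip_linear L2_closed ip_commute[of H F])
  have quad: "\<gamma> * ip (\<lambda>x. \<nu> * F' x + \<mu> * H' x) (\<lambda>x. \<nu> * F' x + \<mu> * H' x) + \<Delta> / \<gamma> * ip (\<lambda>x. F' x - H' x) (\<lambda>x. F' x - H' x)
    = - c * ip F' F' - a * ip H' H' - 2 * b * ip F' H'"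
  proof -
    have q0: "\<gamma> * ip (\<lambda>x. \<nu> * F' x + \<mu> * H' x) (\<lambda>x. \<nu> * F' x + \<mu> * H' x) + \<Delta> / \<gamma> * ip (\<lambda>x. F' x - H' x) (\<lambda>x. F' x - H' x)
      = (\<gamma> * \<nu>\<^sup>2 + \<Delta> / \<gamma>) * ip F' F' + (\<gamma> * \<mu>\<^sup>2 + \<Delta> / \<gamma>) * ip H' H' + 2 * (\<gamma> * \<mu> * \<nu> - \<Delta> / \<gamma>) * ip F' H'"
      by (rule quadratic_expand[OF L(2,4)])
    have sq: "g * (x / g)\<^sup>2 + t / g = (x\<^sup>2 + t) / g" "g * (y / g) * (x / g) - t / g = (y * x - t) / g" if "g > 0" for g x y t :: real
      using that by (simp_all add: field_simps power2_eq_square)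
    have q1: "\<gamma> * \<nu>\<^sup>2 + \<Delta> / \<gamma> = - c"
    proof -
      have "\<gamma> * \<nu>\<^sup>2 + \<Delta> / \<gamma> = ((- c - b)\<^sup>2 + \<Delta>) / \<gamma>" by (rule sq[OF gamma_pos])
      also have "(- c - b)\<^sup>2 + \<Delta> = - c * \<gamma>" unfolding gamma_eq by (simp add: power2_eq_square algebra_simps)
      finally show ?thesis using gamma_pos by simp
    qed
    have q2: "\<gamma> * \<mu>\<^sup>2 + \<Delta> / \<gamma> = - a"
    proof -
      have "\<gamma> * \<mu>\<^sup>2 + \<Delta> / \<gamma> = ((- a - b)\<^sup>2 + \<Delta>) / \<gamma>" by (rule sq[OF gamma_pos])
      also have "(- a - b)\<^sup>2 + \<Delta> = - a * \<gamma>" unfolding gamma_eq by (simp add: power2_eq_square algebra_simps)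
      finally show ?thesis using gamma_pos by simp
    qed
    have q3: "\<gamma> * \<mu> * \<nu> - \<Delta> / \<gamma> = - b"
    proof -
      have "\<gamma> * \<mu> * \<nu> - \<Delta> / \<gamma> = ((- a - b) * (- c - b) - \<Delta>) / \<gamma>" by (rule sq[OF gamma_pos])
      also have "(- a - b) * (- c - b) - \<Delta> = - b * \<gamma>" unfolding gamma_eq by (simp add: power2_eq_square algebra_simps)
      finally show ?thesis using gamma_pos by simp
    qed
    show ?thesis unfolding q0 q1 q2 q3 by simp
  qed
  have "I_eps a b c p e f h = 1 / \<delta> * ip F F - c * ip F' F' + 1 / \<delta> * ip H H - a * ip H' H'
    - 2 * (1 - \<kappa> * \<delta>) * (1 / \<delta> * ip F H + b * ip F' H')"
    unfolding I_eps_def i1 i2 om ..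
  also have "\<dots> = ip (\<lambda>x. F x - H x) (\<lambda>x. F x - H x) / \<delta> + (- c * ip F' F' - a * ip H' H' - 2 * b * ip F' H')
      + 2 * \<kappa> * ip F H + 2 * \<kappa> * \<delta> * b * ip F' H'"
    unfolding dd using \<delta> by (simp add: field_simps)
  also have "\<dots> = energy_form \<delta> \<kappa> (\<lambda>x. \<nu> * F x + \<mu> * H x) (\<lambda>x. \<nu> * F' x + \<mu> * H' x)
    (\<lambda>x. F x - H x) (\<lambda>x. F' x - H' x)"
    unfolding energy_form_def lin_coordinates quad[symmetric] by simp
  finally show ?thesis unfolding \<delta>_def \<kappa>_def .
qed

text \<open>The thresholds are those of \<open>energy_coercive\<close>. They depend on the
  parameters of the system only, so they hold for all sufficiently small e.\<close>

definition small_eps :: "real \<Rightarrow> bool" where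
  "small_eps e \<longleftrightarrow> 0 < e \<and> e < 1 \<and> del e * (4 * (\<mu> - \<nu>)\<^sup>2 + 4 * \<bar>\<mu> * \<nu>\<bar>) \<le> 1 \<and> 2 * del e * b \<le> \<gamma>"

text \<open>Multiplying the pair by s = g^(-1/(p+2)) makes it admissible, as the constraint has
  degree p + 2, and multiplies the energy by s^2. Undoing the factor produces the power 2/(p +
  2).\<close>

lemma minimizer_inequality:
  assumes e: "small_eps e" and u: "sob u u'" and v: "sob v v'" and pos: "constraint_form u v > 0"
  shows "I_inf a b c p e * constraint_form u v powr (2 / (p + 2)) \<le> energy_form (del e) (kap e) u u' v v'"
proof -
  have e01: "0 < e" "e < 1" and sm: "del e * (4 * (\<mu> - \<nu>)\<^sup>2 + 4 * \<bar>\<mu> * \<nu>\<bar>) \<le> 1" "2 * del e * b \<le> \<gamma>"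
    using e by (auto simp: small_eps_def)
  have dpos: "0 < del e" using del_bounds[OF e01] by simp
  define g where "g = constraint_form u v"
  have g: "g > 0" using pos by (simp add: g_def)
  define s where "s = g powr (- 1 / (p + 2))"
  have s: "s > 0" using g by (simp add: s_def)
  define F where "F = (\<lambda>x. s * lin \<mu> u v x)"
  define H where "H = (\<lambda>x. s * lin (- \<nu>) u v x)"
  define F' where "F' = (\<lambda>x. s * lin \<mu> u' v' x)"
  define H' where "H' = (\<lambda>x. s * lin (- \<nu>) u' v' x)"
  have sF: "sob F F'" and sH: "sob H H'" unfolding F_def F'_def H_def H'_def by (intro sob_scale sob_lin u v)+
  have m: "F \<in> borel_measurable borel" "H \<in> borel_measurable borel" by (rule sob_measurable[OF sF] sob_measurable[OF sH])+
  have "F \<in> H1" "H \<in> H1" by (rule sob_imp_H1(1)[OF sF m(1) AE_I2] sob_imp_H1(1)[OF sH m(2) AE_I2], simp)+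
  then have XX: "(F, H) \<in> X" by (simp add: X_def)
  have sp: "s * s powr (p + 1) = 1 / g"
  proof -
    have "s * s powr (p + 1) = s powr (1 + (p + 1))" using s by (simp only: powr_add powr_one)
    also have "\<dots> = g powr (- 1 / (p + 2) * (1 + (p + 1)))" unfolding s_def by (rule powr_powr)
    also have "- 1 / (p + 2) * (1 + (p + 1)) = - 1" using p_pos by (simp add: field_simps)
    finally show ?thesis using g by (simp add: powr_minus_divide)
  qed
  have "G p F H = 2 / (p + 1) * ip F (\<lambda>x. pow_p1 p (H x))"
    by (rule G_eq[OF m(1) _ m(1) m(2) _ m(2)]) simp_all
  also have "ip F (\<lambda>x. pow_p1 p (H x)) = (s * s powr (p + 1)) * ip (lin \<mu> u v) (\<lambda>x. pow_p1 p (lin (- \<nu>) u v x))"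
    unfolding F_def H_def pow_p1_scale[OF s] ip_scale_left ip_scale_right by simp
  also have "2 / (p + 1) * \<dots> = - (1 / g) * g" unfolding sp g_def constraint_form_def by simp
  finally have Gm: "G p F H = - 1" using g by simp
  have En: "I_eps a b c p e F H = s\<^sup>2 * energy_form (del e) (kap e) u u' v v'"
    unfolding I_eps_eq[OF e01 sF m(1) AE_I2[OF refl] sH m(2) AE_I2[OF refl]]
    unfolding F_def H_def F'_def H'_def coordinates_lin by (rule energy_form_scale)
  have "I_inf a b c p e \<le> I_eps a b c p e F H"
    unfolding I_inf_def
  proof (rule cInf_lower)
    show "I_eps a b c p e F H \<in> {I_eps a b c p e z w |z w. (z, w) \<in> X \<and> G p z w = - 1}" using XX Gm by blast
    \<comment> \<open>For reals, \<open>Inf\<close> is a lower bound only of sets bounded below;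
      coercivity supplies the bound 0.\<close>
    show "bdd_below {I_eps a b c p e z w |z w. (z, w) \<in> X \<and> G p z w = - 1}"
    proof (rule bdd_belowI)
      fix t assume "t \<in> {I_eps a b c p e z w |z w. (z, w) \<in> X \<and> G p z w = - 1}"
      then obtain z w where t: "t = I_eps a b c p e z w" "z \<in> H1" "w \<in> H1" by (auto simp: X_def)
      obtain Z Z' where Z: "sob Z Z'" "AE x in lborel. z x = Z x" "z \<in> borel_measurable borel" using H1_imp_sob[OF t(2)] .
      obtain W W' where W: "sob W W'" "AE x in lborel. w x = W x" "w \<in> borel_measurable borel" using H1_imp_sob[OF t(3)] .
      show "0 \<le> t"
        unfolding t(1) I_eps_eq[OF e01 Z(1,3,2) W(1,3,2)]
        by (intro energy_form_nonneg dpos sm omega_kap[OF e01] sob_add sob_diff sob_scale Z(1) W(1))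
    qed
  qed
  also have "\<dots> = s\<^sup>2 * energy_form (del e) (kap e) u u' v v'" by (rule En)
  finally have "g powr (2 / (p + 2)) * I_inf a b c p e \<le> g powr (2 / (p + 2)) * (s\<^sup>2 * energy_form (del e) (kap e) u u' v v')"
    by (intro mult_left_mono) auto
  also have "\<dots> = (g powr (2 / (p + 2)) * s\<^sup>2) * energy_form (del e) (kap e) u u' v v'" by simp
  also have "g powr (2 / (p + 2)) * s\<^sup>2 = 1"
  proof -
    have "s\<^sup>2 = g powr (- 2 / (p + 2))" using g by (simp add: s_def powr_power)
    then have "g powr (2 / (p + 2)) * s\<^sup>2 = g powr (2 / (p + 2) + - 2 / (p + 2))" by (simp only: powr_add)
    then show ?thesis using g by simp
  qed
  finally show ?thesis by (simp add: g_def mult.commute)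
qed

lemma energy_min_I_inf: "small_eps e \<Longrightarrow> energy_min (del e) (kap e) (I_inf a b c p e)"
  unfolding energy_min_def by (intro allI impI minimizer_inequality)

end

section \<open>Conclusion\<close>

context abcb_parameters
begin

section \<open>Identification of \<open>J0\<close> and of the travelling wave\<close>

lemma J0_eq:
  assumes Q: "sob Q Q'" "ip Q (\<lambda>x. pow_p1 p (Q x)) = - (p + 1) / 2"
    and min: "\<And>\<phi> \<phi>'. sob \<phi> \<phi>' \<Longrightarrow> ip \<phi> (\<lambda>x. pow_p1 p (\<phi> x)) = - (p + 1) / 2 \<Longrightarrow> ip Q Q + \<gamma> * ip Q' Q' \<le> ip \<phi> \<phi> + \<gamma> * ip \<phi>' \<phi>'"
  shows "J0 \<sigma> p = ip Q Q + \<gamma> * ip Q' Q'"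
  unfolding J0_def
proof (rule cInf_eq_minimum)
  have c: "2 / (p + 1) * t = - 1 \<longleftrightarrow> t = - (p + 1) / 2" for t using p_pos by (simp add: field_simps)
  note Qm = sob_measurable(1)[OF Q(1)]
  have "Q \<in> H1" by (rule sob_imp_H1(1)[OF Q(1) Qm]) simp
  moreover have "2 / (p + 1) * (LINT y|lborel. pow_p2 p (Q y)) = - 1"
    unfolding c J0_functional_eq(2)[OF Q(1) Qm AE_I2[OF refl]] by (rule Q(2))
  moreover have "ip Q Q + \<gamma> * ip Q' Q' = (LINT y|lborel. (Q y)\<^sup>2 + \<gamma> * (weak_deriv Q y)\<^sup>2)"
    unfolding J0_functional_eq(1)[OF Q(1) Qm AE_I2[OF refl]] ..
  ultimately show "ip Q Q + \<gamma> * ip Q' Q' \<in> {LINT y|lborel. (w y)\<^sup>2 + \<gamma> * (weak_deriv w y)\<^sup>2 | w.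
     w \<in> H1 \<and> 2 / (p + 1) * (LINT y|lborel. pow_p2 p (w y)) = - 1}" by blast
  fix t assume "t \<in> {LINT y|lborel. (w y)\<^sup>2 + \<gamma> * (weak_deriv w y)\<^sup>2 | w.
     w \<in> H1 \<and> 2 / (p + 1) * (LINT y|lborel. pow_p2 p (w y)) = - 1}"
  then obtain w where w: "t = (LINT y|lborel. (w y)\<^sup>2 + \<gamma> * (weak_deriv w y)\<^sup>2)" "w \<in> H1"
    "2 / (p + 1) * (LINT y|lborel. pow_p2 p (w y)) = - 1" by blast
  obtain W W' where W: "sob W W'" "AE x in lborel. w x = W x" "w \<in> borel_measurable borel" using H1_imp_sob[OF w(2)] .
  show "ip Q Q + \<gamma> * ip Q' Q' \<le> t"
    using w(3) unfolding w(1) c J0_functional_eq[OF W(1,3,2)] by (rule min[OF W(1)])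
qed

text \<open>Insert u = A Q(k (x - s t)) and integrate once: (1 - s) A Q + (1/3 - \<sigma>) A k^2 Q''
  + A^(p+1) |Q|^(p+1) = 0. Since (1/3 - \<sigma>) Q'' = -(Q + L |Q|^(p+1)), this requires k^2 = 1 -
  s and A^p = L k^2. The speed s = 1/2 gives the constants below. The third derivative exists
  because the right-hand side of the second-order equation is differentiable.\<close>

lemma profile_travelling_wave:
  assumes Q: "\<And>x. (Q has_real_derivative Q' x) (at x)"
    "\<And>x. (Q' has_real_derivative (Q x + 2 * l / (p + 1) * pow_p1 p (Q x)) / \<gamma>) (at x)" and l: "l > 0"
  shows "rescaled_gKdV_travelling_wave \<sigma> p Q"
proof -
  define L where "L = 2 * l / (p + 1)"
  have L: "L > 0" using l p_pos by (simp add: L_def)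
  define A where "A = (L / 2) powr (1 / p)"
  define k where "k = sqrt (1 / 2)"
  have A: "A > 0" using L by (simp add: A_def)
  have Ap: "A powr (p + 1) = A * (L / 2)"
  proof -
    have "A powr p = L / 2" using L p_pos by (simp add: A_def powr_powr)
    then show ?thesis using A by (simp add: powr_add)
  qed
  have k: "k > 0" "k * k = 1 / 2" by (simp_all add: k_def)
  define \<xi> where "\<xi> t x = k * (x - 1 / 2 * t)" for t x
  define Q2 where "Q2 x = (Q x + L * pow_p1 p (Q x)) / \<gamma>" for x
  define Q3 where "Q3 x = (Q' x + L * ((p + 1) * pow_p p (Q x) * Q' x)) / \<gamma>" for x
  have d2: "(Q' has_real_derivative Q2 x) (at x)" for x using Q(2)[of x] by (simp add: Q2_def L_def)
  have dN: "((\<lambda>x. pow_p1 p (Q x)) has_real_derivative (p + 1) * pow_p p (Q x) * Q' x) (at x)" for x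
    by (rule DERIV_chain2[OF pow_p1_has_derivative[OF p_pos] Q(1)])
  have d3: "(Q2 has_real_derivative Q3 x) (at x)" for x
    unfolding Q2_def[abs_def] Q3_def by (intro DERIV_cdivide DERIV_add DERIV_cmult Q dN)
  have \<xi>x: "((\<lambda>x. \<xi> t x) has_real_derivative k) (at x)" for t x
    unfolding \<xi>_def by (auto intro!: derivative_eq_intros)
  have \<xi>t: "((\<lambda>t. \<xi> t x) has_real_derivative - (k / 2)) (at t)" for t x
    unfolding \<xi>_def by (auto intro!: derivative_eq_intros)
  have sol: "gKdV_solution \<sigma> p (\<lambda>t x. A * Q (\<xi> t x))"
    unfolding gKdV_solution_def
  proof (rule exI[of _ "\<lambda>t x. A * (Q' (\<xi> t x) * - (k / 2))"], rule exI[of _ "\<lambda>t x. A * (Q' (\<xi> t x) * k)"],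
      rule exI[of _ "\<lambda>t x. A * (Q2 (\<xi> t x) * k * k)"], rule exI[of _ "\<lambda>t x. A * (Q3 (\<xi> t x) * k * k * k)"],
      rule exI[of _ "\<lambda>t x. A powr (p + 1) * ((p + 1) * pow_p p (Q (\<xi> t x)) * Q' (\<xi> t x) * k)"], intro allI conjI)
    fix t x
    show "((\<lambda>\<tau>. A * Q (\<xi> \<tau> x)) has_real_derivative A * (Q' (\<xi> t x) * - (k / 2))) (at t)"
      by (intro DERIV_cmult DERIV_chain2[OF Q(1) \<xi>t])
    show "((\<lambda>x. A * Q (\<xi> t x)) has_real_derivative A * (Q' (\<xi> t x) * k)) (at x)"
      by (intro DERIV_cmult DERIV_chain2[OF Q(1) \<xi>x])
    show "((\<lambda>x. A * (Q' (\<xi> t x) * k)) has_real_derivative A * (Q2 (\<xi> t x) * k * k)) (at x)"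
      by (intro DERIV_cmult DERIV_cmult_right DERIV_chain2[OF d2 \<xi>x])
    show "((\<lambda>x. A * (Q2 (\<xi> t x) * k * k)) has_real_derivative A * (Q3 (\<xi> t x) * k * k * k)) (at x)"
      by (intro DERIV_cmult DERIV_cmult_right DERIV_chain2[OF d3 \<xi>x])
    have "((\<lambda>x. A powr (p + 1) * pow_p1 p (Q (\<xi> t x))) has_real_derivative
      A powr (p + 1) * ((p + 1) * pow_p p (Q (\<xi> t x)) * Q' (\<xi> t x) * k)) (at x)"
      by (intro DERIV_cmult DERIV_chain2[OF dN \<xi>x])
    then show "((\<lambda>y. pow_p1 p (A * Q (\<xi> t y))) has_real_derivative
      A powr (p + 1) * ((p + 1) * pow_p p (Q (\<xi> t x)) * Q' (\<xi> t x) * k)) (at x)"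
      by (simp only: pow_p1_scale[OF A])
    have cancel: "A * (s * - (k / 2)) + A * (s * k) + - (A * k * (1 / 2) * (s + L * t)) + A * (L / 2) * (t * k) = 0" for s t
      by (simp add: field_simps)
    have s: "(1 / 3 - \<sigma>) * Q3 y = - (Q' y + L * ((p + 1) * pow_p p (Q y) * Q' y))" for y
    proof -
      have "\<gamma> * Q3 y = Q' y + L * ((p + 1) * pow_p p (Q y) * Q' y)" using gamma_pos unfolding Q3_def by simp
      moreover have "(1 / 3 - \<sigma>) * Q3 y = - (\<gamma> * Q3 y)" by (simp add: algebra_simps)
      ultimately show ?thesis by simp
    qed
    have "(1 / 3 - \<sigma>) * (A * (Q3 (\<xi> t x) * k * k * k)) = A * k * (k * k) * ((1 / 3 - \<sigma>) * Q3 (\<xi> t x))"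
      by (simp only: mult_ac)
    also have "\<dots> = - (A * k * (1 / 2) * (Q' (\<xi> t x) + L * ((p + 1) * pow_p p (Q (\<xi> t x)) * Q' (\<xi> t x))))"
      unfolding s k(2) by (simp only: mult_minus_right)
    finally have e: "(1 / 3 - \<sigma>) * (A * (Q3 (\<xi> t x) * k * k * k)) = - (A * k * (1 / 2) * (Q' (\<xi> t x) + L * ((p + 1) * pow_p p (Q (\<xi> t x)) * Q' (\<xi> t x))))" .
    show "A * (Q' (\<xi> t x) * - (k / 2)) + A * (Q' (\<xi> t x) * k) + (1 / 3 - \<sigma>) * (A * (Q3 (\<xi> t x) * k * k * k))
      + A powr (p + 1) * ((p + 1) * pow_p p (Q (\<xi> t x)) * Q' (\<xi> t x) * k) = 0"
      unfolding e Ap by (rule cancel)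
  qed
  show ?thesis
    unfolding rescaled_gKdV_travelling_wave_def
    by (rule exI[of _ Q], rule exI[of _ A], rule exI[of _ k], rule exI[of _ "1 / 2"])
      (intro conjI AE_I2 refl A k(1) sol[unfolded \<xi>_def], simp)
qed

lemma del_tendsto:
  assumes "\<And>j. 0 \<le> e j" "e \<longlonglongrightarrow> 0"
  shows "(\<lambda>j. del (e j)) \<longlonglongrightarrow> 0"
proof -
  have "(\<lambda>j. e j powr (2 / (p + 1))) \<longlonglongrightarrow> 0 powr (2 / (p + 1))"
    by (rule tendsto_powr'[OF assms(2) tendsto_const]) (use assms(1) p_pos in auto)
  then show ?thesis using p_pos by (simp add: del_def)
qed

lemma minimizing_sequenceI:
  assumes e: "\<And>j. small_eps (e j)" "e \<longlonglongrightarrow> 0"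
    and Z: "\<And>j. sob (Z j) (Z' j)" and W: "\<And>j. sob (W j) (W' j)"
    and E: "\<And>j. energy_form (del (e j)) (kap (e j)) (\<lambda>x. \<nu> * Z j x + \<mu> * W j x) (\<lambda>x. \<nu> * Z' j x + \<mu> * W' j x)
      (\<lambda>x. Z j x - W j x) (\<lambda>x. Z' j x - W' j x) = I_inf a b c p (e j)"
    and C: "\<And>j. ip (Z j) (\<lambda>x. pow_p1 p (W j x)) = - (p + 1) / 2"
  shows "minimizing_sequence \<gamma> b \<Delta> \<mu> \<nu> p (\<lambda>j. del (e j)) (\<lambda>j. kap (e j)) (\<lambda>j. I_inf a b c p (e j))
    (\<lambda>j x. \<nu> * Z j x + \<mu> * W j x) (\<lambda>j x. \<nu> * Z' j x + \<mu> * W' j x) (\<lambda>j x. Z j x - W j x) (\<lambda>j x. Z' j x - W' j x)"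
proof -
  define q where "q j = (\<lambda>x. \<nu> * Z j x + \<mu> * W j x)" for j
  define q' where "q' j = (\<lambda>x. \<nu> * Z' j x + \<mu> * W' j x)" for j
  define d where "d j = (\<lambda>x. Z j x - W j x)" for j
  define d' where "d' j = (\<lambda>x. Z' j x - W' j x)" for j
  have sq: "sob (q j) (q' j)" and sd: "sob (d j) (d' j)" for j
    unfolding q_def q'_def d_def d'_def by (intro sob_add sob_scale sob_diff Z W)+
  have l: "lin \<mu> (q j) (d j) = Z j" "lin (- \<nu>) (q j) (d j) = W j" "lin \<mu> (q' j) (d' j) = Z' j" "lin (- \<nu>) (q' j) (d' j) = W' j" for j
    unfolding q_def q'_def d_def d'_def by (rule lin_coordinates)+
  have e01: "0 < e j" "e j < 1" for j using e(1)[of j] by (auto simp: small_eps_def)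
  have en: "energy_form (del (e j)) (kap (e j)) (q j) (q' j) (d j) (d' j) = I_inf a b c p (e j)" for j
    using E[of j] unfolding q_def q'_def d_def d'_def .
  have c: "constraint_form (q j) (d j) = 1" for j
    unfolding constraint_form_def l C using p_pos by (simp add: field_simps)
  have del_lim: "(\<lambda>j. del (e j)) \<longlonglongrightarrow> 0" by (rule del_tendsto[OF less_imp_le[OF e01(1)] e(2)])
  have "(\<lambda>j. 1 / (1 + sqrt (1 - del (e j)))) \<longlonglongrightarrow> 1 / (1 + sqrt (1 - 0))"
    by (intro tendsto_intros del_lim) simp
  then have kap_lim: "(\<lambda>j. kap (e j)) \<longlonglongrightarrow> 1 / 2" by (simp add: kap_def omega_def del_def)
  have small: "del (e j) * (4 * (\<mu> - \<nu>)\<^sup>2 + 4 * \<bar>\<mu> * \<nu>\<bar>) \<le> 1" "2 * del (e j) * b \<le> \<gamma>" "0 < del (e j)" for j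
    using e(1)[of j] del_bounds[OF e01] by (auto simp: small_eps_def)
  have "minimizing_sequence \<gamma> b \<Delta> \<mu> \<nu> p (\<lambda>j. del (e j)) (\<lambda>j. kap (e j)) (\<lambda>j. I_inf a b c p (e j)) q q' d d'"
    by unfold_locales (fact sq sd small omega_kap(2,3)[OF e01] en c energy_min_I_inf[OF e(1)] del_lim kap_lim)+
  then show ?thesis unfolding q_def q'_def d_def d'_def .
qed

end

theorem theorem3p3:
  fixes a b c p \<sigma> :: real and p1 p2 :: nat
    and z w :: "real \<Rightarrow> real \<Rightarrow> real" and \<epsilon> :: "nat \<Rightarrow> real"
  assumes "b > 0" and "a < 0" and "c < 0"
    and "b \<le> sqrt (a * c)" and "2 * b < - a - c"
    and "odd p1" and "odd p2" and "coprime p1 p2" and "p = real p1 / real p2"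
    and "a + c + 2 * b = 1 / 3 - \<sigma>"
    and "\<And>e. 0 < e \<Longrightarrow> e < 1 \<Longrightarrow> is_minimizer a b c p e (z e) (w e)"
    and "\<And>j. 0 < \<epsilon> j \<and> \<epsilon> j < 1" and "\<epsilon> \<longlonglongrightarrow> 0"
  shows "\<exists>(r :: nat \<Rightarrow> nat) (y :: nat \<Rightarrow> real) z0 w0.
           strict_mono r \<and> (z0, w0) \<in> X \<and>
           \<not> ((AE x in lborel. z0 x = 0) \<and> (AE x in lborel. w0 x = 0)) \<and>
           X_tendsto (\<lambda>j. (translate (y j) (z (\<epsilon> (r j))), translate (y j) (w (\<epsilon> (r j))))) (z0, w0) \<and>
           (\<lambda>j. H1_norm (\<lambda>x. translate (y j) (z (\<epsilon> (r j))) x - translate (y j) (w (\<epsilon> (r j))) x))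
             \<longlonglongrightarrow> 0 \<and>
           (AE x in lborel. z0 x = w0 x) \<and>
           solves_limit_eq \<sigma> p w0 \<and>
           rescaled_gKdV_travelling_wave \<sigma> p w0"
proof -
  have pp: "p > 0" using assms(6,7,9) by (simp add: odd_pos)
  interpret abcb_parameters a b c p \<sigma> by unfold_locales (fact assms pp)+
  have "\<forall>\<^sub>F j in sequentially. small_eps (\<epsilon> j)"
  proof -
    have l: "(\<lambda>j. del (\<epsilon> j)) \<longlonglongrightarrow> 0" by (rule del_tendsto[OF _ assms(13)]) (use assms(12) in \<open>auto intro: less_imp_le\<close>)
    have "(\<lambda>j. del (\<epsilon> j) * K) \<longlonglongrightarrow> 0" for K by (rule tendsto_mult_left_zero[OF l])
    then have ev: "\<forall>\<^sub>F j in sequentially. del (\<epsilon> j) * K < t" if "t > 0" for K t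
      using that by (rule order_tendstoD(2))
    have "\<forall>\<^sub>F j in sequentially. del (\<epsilon> j) * (4 * (\<mu> - \<nu>)\<^sup>2 + 4 * \<bar>\<mu> * \<nu>\<bar>) < 1" by (rule ev) simp
    moreover have "\<forall>\<^sub>F j in sequentially. del (\<epsilon> j) * (2 * b) < \<gamma>" by (rule ev[OF gamma_pos])
    ultimately show ?thesis
    proof eventually_elim
      case (elim j)
      then show ?case unfolding small_eps_def using assms(12)[of j] by (simp only: mult_ac) (auto intro: less_imp_le)
    qed
  qed
  then obtain N where N: "\<And>j. j \<ge> N \<Longrightarrow> small_eps (\<epsilon> j)" unfolding eventually_sequentially by blast
  \<comment> \<open>Finitely many terms are dropped so that coercivity holds for every index;
    \<open>R\<close> restores the original numbering at the end.\<close>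
  define e where "e j = \<epsilon> (j + N)" for j
  have e: "small_eps (e j)" "0 < e j" "e j < 1" for j using N[of "j + N"] assms(12)[of "j + N"] by (auto simp: e_def)
  have min: "is_minimizer a b c p (e j) (z (e j)) (w (e j))" for j by (rule assms(11)[OF e(2,3)])
  have "z (e j) \<in> H1" "w (e j) \<in> H1" for j using min[of j] by (auto simp: is_minimizer_def X_def)
  then have "\<forall>j. \<exists>Z Z'. sob Z Z' \<and> (AE x in lborel. z (e j) x = Z x) \<and> z (e j) \<in> borel_measurable borel"
    "\<forall>j. \<exists>W W'. sob W W' \<and> (AE x in lborel. w (e j) x = W x) \<and> w (e j) \<in> borel_measurable borel"
    using H1_imp_sob by metis+
  then obtain Z Z' W W' where Z: "\<And>j. sob (Z j) (Z' j)" "\<And>j. z (e j) \<in> borel_measurable borel" "\<And>j. AE x in lborel. z (e j) x = Z j x"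
    and W: "\<And>j. sob (W j) (W' j)" "\<And>j. w (e j) \<in> borel_measurable borel" "\<And>j. AE x in lborel. w (e j) x = W j x"
    by metis
  have "minimizing_sequence \<gamma> b (a * c - b\<^sup>2) \<mu> \<nu> p (\<lambda>j. del (e j)) (\<lambda>j. kap (e j)) (\<lambda>j. I_inf a b c p (e j))
    (\<lambda>j x. \<nu> * Z j x + \<mu> * W j x) (\<lambda>j x. \<nu> * Z' j x + \<mu> * W' j x) (\<lambda>j x. Z j x - W j x) (\<lambda>j x. Z' j x - W' j x)"
  proof (rule minimizing_sequenceI[OF e(1) _ Z(1) W(1)])
    show "e \<longlonglongrightarrow> 0" unfolding e_def by (rule LIMSEQ_ignore_initial_segment[OF assms(13)])
    fix j
    show "energy_form (del (e j)) (kap (e j)) (\<lambda>x. \<nu> * Z j x + \<mu> * W j x) (\<lambda>x. \<nu> * Z' j x + \<mu> * W' j x)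
      (\<lambda>x. Z j x - W j x) (\<lambda>x. Z' j x - W' j x) = I_inf a b c p (e j)"
      using min[of j] unfolding is_minimizer_def I_eps_eq[OF e(2,3) Z W] by simp
    have "2 / (p + 1) * ip (Z j) (\<lambda>x. pow_p1 p (W j x)) = - 1"
      using min[of j] G_eq[OF Z(2,3) sob_measurable(1)[OF Z(1)] W(2,3) sob_measurable(1)[OF W(1)], of p j j]
      by (simp add: is_minimizer_def)
    then show "ip (Z j) (\<lambda>x. pow_p1 p (W j x)) = - (p + 1) / 2" using pp by (simp add: field_simps)
  qed
  then interpret M: minimizing_sequence \<gamma> b "a * c - b\<^sup>2" \<mu> \<nu> p "\<lambda>j. del (e j)" "\<lambda>j. kap (e j)" "\<lambda>j. I_inf a b c p (e j)"
    "\<lambda>j x. \<nu> * Z j x + \<mu> * W j x" "\<lambda>j x. \<nu> * Z' j x + \<mu> * W' j x" "\<lambda>j x. Z j x - W j x" "\<lambda>j x. Z' j x - W' j x" .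
  obtain r y Q Q' m where r: "strict_mono r" and m: "m > 0" and Q: "sob Q Q'" and
    Q2: "sob Q' (\<lambda>x. (Q x + 2 * m / (p + 1) * pow_p1 p (Q x)) / \<gamma>)" and
    dQ: "\<And>x. (Q has_real_derivative Q' x) (at x)"
      "\<And>x. (Q' has_real_derivative (Q x + 2 * m / (p + 1) * pow_p1 p (Q x)) / \<gamma>) (at x)" and
    cQ: "ip Q (\<lambda>x. pow_p1 p (Q x)) = - (p + 1) / 2" and mQ: "m = ip Q Q + \<gamma> * ip Q' Q'" and
    le: "\<And>\<phi> \<phi>'. sob \<phi> \<phi>' \<Longrightarrow> ip \<phi> (\<lambda>x. pow_p1 p (\<phi> x)) = - (p + 1) / 2 \<Longrightarrow> m \<le> ip \<phi> \<phi> + \<gamma> * ip \<phi>' \<phi>'" and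
    lim: "(\<lambda>j. l2 (\<lambda>x. (\<nu> * Z (r j) (x + y j) + \<mu> * W (r j) (x + y j)) - Q x)) \<longlonglongrightarrow> 0"
      "(\<lambda>j. l2 (\<lambda>x. (\<nu> * Z' (r j) (x + y j) + \<mu> * W' (r j) (x + y j)) - Q' x)) \<longlonglongrightarrow> 0"
      "(\<lambda>j. l2 (\<lambda>x. Z (r j) x - W (r j) x)) \<longlonglongrightarrow> 0" "(\<lambda>j. l2 (\<lambda>x. Z' (r j) x - W' (r j) x)) \<longlonglongrightarrow> 0"
    by (rule M.strong_limit) (rule that)
  \<comment> \<open>The limit m of the minimal values bounds the limiting functional from below on
    all admissible functions and is attained at Q.\<close>
  have J0: "J0 \<sigma> p = m" unfolding mQ by (rule J0_eq[OF Q cQ]) (use le mQ in simp)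
  have Qm: "Q \<in> borel_measurable borel" by (rule sob_measurable[OF Q])
  have split: "lin s (\<lambda>x. (\<nu> * F (x + t) + \<mu> * H (x + t)) - P x) (\<lambda>x. F (x + t) - H (x + t))
    = (\<lambda>x. lin s (\<lambda>x. \<nu> * F x + \<mu> * H x) (\<lambda>x. F x - H x) (x + t) - P x)" for s t F H P
    by (simp add: lin_def fun_eq_iff)
  \<comment> \<open>Both components have the form q + s d with s = \<mu> or s = -\<nu>. Convergence
    of q and decay of d therefore give convergence of z and w to one limit, and likewise for the
    derivatives.\<close>
  have conv: "(\<lambda>j. l2 (\<lambda>x. F (r j) (x + y j) - P x)) \<longlonglongrightarrow> 0"
    if s: "\<And>j. F j = lin s (\<lambda>x. \<nu> * U j x + \<mu> * V j x) (\<lambda>x. U j x - V j x)" and L: "\<And>j. U j \<in> L2" "\<And>j. V j \<in> L2" "P \<in> L2"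
      and l: "(\<lambda>j. l2 (\<lambda>x. (\<nu> * U (r j) (x + y j) + \<mu> * V (r j) (x + y j)) - P x)) \<longlonglongrightarrow> 0" "(\<lambda>j. l2 (\<lambda>x. U (r j) x - V (r j) x)) \<longlonglongrightarrow> 0"
    for F U V P s
  proof -
    have "(\<lambda>j. l2 (\<lambda>x. (\<nu> * U (r j) (x + y j) + \<mu> * V (r j) (x + y j)) - P x) + \<bar>s\<bar> * l2 (\<lambda>x. U (r j) x - V (r j) x)) \<longlonglongrightarrow> 0 + \<bar>s\<bar> * 0"
      by (intro tendsto_intros l)
    then have "(\<lambda>j. l2 (\<lambda>x. (\<nu> * U (r j) (x + y j) + \<mu> * V (r j) (x + y j)) - P x) + \<bar>s\<bar> * l2 (\<lambda>x. U (r j) x - V (r j) x)) \<longlonglongrightarrow> 0" by simp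
    then show ?thesis
    proof (rule l2_tendsto_0I)
      fix j
      have "l2 (lin s (\<lambda>x. (\<nu> * U (r j) (x + y j) + \<mu> * V (r j) (x + y j)) - P x) (\<lambda>x. U (r j) (x + y j) - V (r j) (x + y j)))
        \<le> l2 (\<lambda>x. (\<nu> * U (r j) (x + y j) + \<mu> * V (r j) (x + y j)) - P x) + \<bar>s\<bar> * l2 (\<lambda>x. U (r j) (x + y j) - V (r j) (x + y j))"
        by (intro l2_lin L2_closed L2_translate L)
      then show "l2 (\<lambda>x. F (r j) (x + y j) - P x)
        \<le> l2 (\<lambda>x. (\<nu> * U (r j) (x + y j) + \<mu> * V (r j) (x + y j)) - P x) + \<bar>s\<bar> * l2 (\<lambda>x. U (r j) x - V (r j) x)"
        unfolding split s[symmetric] l2_translate[of "\<lambda>x. U (r j) x - V (r j) x" "y j"] .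
    qed
  qed
  have LL: "Z j \<in> L2" "Z' j \<in> L2" "W j \<in> L2" "W' j \<in> L2" "Q \<in> L2" "Q' \<in> L2" for j
    using Z(1)[of j] W(1)[of j] Q by (auto dest: sob_L2)
  have cZ: "(\<lambda>j. l2 (\<lambda>x. Z (r j) (x + y j) - Q x)) \<longlonglongrightarrow> 0" "(\<lambda>j. l2 (\<lambda>x. Z' (r j) (x + y j) - Q' x)) \<longlonglongrightarrow> 0"
    "(\<lambda>j. l2 (\<lambda>x. W (r j) (x + y j) - Q x)) \<longlonglongrightarrow> 0" "(\<lambda>j. l2 (\<lambda>x. W' (r j) (x + y j) - Q' x)) \<longlonglongrightarrow> 0"
    by (rule conv[OF lin_coordinates(1)[symmetric] LL(1) LL(3) LL(5) lim(1,3)] conv[OF lin_coordinates(1)[symmetric] LL(2) LL(4) LL(6) lim(2,4)]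
      conv[OF lin_coordinates(2)[symmetric] LL(1) LL(3) LL(5) lim(1,3)] conv[OF lin_coordinates(2)[symmetric] LL(2) LL(4) LL(6) lim(2,4)])+
  define R where "R j = r j + N" for j
  have eR: "\<epsilon> (R j) = e (r j)" for j by (simp add: e_def R_def)
  have trm: "translate t f \<in> borel_measurable borel" if "f \<in> borel_measurable borel" for t f
    using that unfolding translate_def by measurable
  have nZ: "H1_norm (\<lambda>x. translate (y j) (z (e (r j))) x - Q x)
     = sqrt ((l2 (\<lambda>x. Z (r j) (x + y j) - Q x))\<^sup>2 + (l2 (\<lambda>x. Z' (r j) (x + y j) - Q' x))\<^sup>2)" for j
  proof (rule H1_norm_eq)
    show "sob (\<lambda>x. Z (r j) (x + y j) - Q x) (\<lambda>x. Z' (r j) (x + y j) - Q' x)" by (intro sob_diff sob_translate Z Q)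
    show "(\<lambda>x. translate (y j) (z (e (r j))) x - Q x) \<in> borel_measurable borel" by (intro borel_measurable_diff trm Z Qm)
    show "AE x in lborel. translate (y j) (z (e (r j))) x - Q x = Z (r j) (x + y j) - Q x"
      using lborel_AE_translate[OF Z(3)[of "r j"], of "y j"] unfolding translate_def by eventually_elim simp
  qed
  have nW: "H1_norm (\<lambda>x. translate (y j) (w (e (r j))) x - Q x)
     = sqrt ((l2 (\<lambda>x. W (r j) (x + y j) - Q x))\<^sup>2 + (l2 (\<lambda>x. W' (r j) (x + y j) - Q' x))\<^sup>2)" for j
  proof (rule H1_norm_eq)
    show "sob (\<lambda>x. W (r j) (x + y j) - Q x) (\<lambda>x. W' (r j) (x + y j) - Q' x)" by (intro sob_diff sob_translate W Q)
    show "(\<lambda>x. translate (y j) (w (e (r j))) x - Q x) \<in> borel_measurable borel" by (intro borel_measurable_diff trm W Qm)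
    show "AE x in lborel. translate (y j) (w (e (r j))) x - Q x = W (r j) (x + y j) - Q x"
      using lborel_AE_translate[OF W(3)[of "r j"], of "y j"] unfolding translate_def by eventually_elim simp
  qed
  have nd: "H1_norm (\<lambda>x. translate (y j) (z (e (r j))) x - translate (y j) (w (e (r j))) x)
     = sqrt ((l2 (\<lambda>x. Z (r j) x - W (r j) x))\<^sup>2 + (l2 (\<lambda>x. Z' (r j) x - W' (r j) x))\<^sup>2)" for j
  proof -
    have "H1_norm (\<lambda>x. translate (y j) (z (e (r j))) x - translate (y j) (w (e (r j))) x)
     = sqrt ((l2 (\<lambda>x. Z (r j) (x + y j) - W (r j) (x + y j)))\<^sup>2 + (l2 (\<lambda>x. Z' (r j) (x + y j) - W' (r j) (x + y j)))\<^sup>2)"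
    proof (rule H1_norm_eq)
      show "sob (\<lambda>x. Z (r j) (x + y j) - W (r j) (x + y j)) (\<lambda>x. Z' (r j) (x + y j) - W' (r j) (x + y j))"
        by (intro sob_diff sob_translate Z W)
      show "(\<lambda>x. translate (y j) (z (e (r j))) x - translate (y j) (w (e (r j))) x) \<in> borel_measurable borel"
        by (intro borel_measurable_diff trm Z W)
      show "AE x in lborel. translate (y j) (z (e (r j))) x - translate (y j) (w (e (r j))) x = Z (r j) (x + y j) - W (r j) (x + y j)"
        using lborel_AE_translate[OF Z(3)[of "r j"], of "y j"] lborel_AE_translate[OF W(3)[of "r j"], of "y j"]
        unfolding translate_def by eventually_elim simp
    qed
    then show ?thesis
      unfolding l2_translate[of "\<lambda>x. Z (r j) x - W (r j) x" "y j"] l2_translate[of "\<lambda>x. Z' (r j) x - W' (r j) x" "y j"] .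
  qed
  have norm0: "(\<lambda>j. sqrt ((f j)\<^sup>2 + (g j)\<^sup>2)) \<longlonglongrightarrow> 0" if "f \<longlonglongrightarrow> 0" "g \<longlonglongrightarrow> 0" for f g :: "nat \<Rightarrow> real"
  proof -
    have "(\<lambda>j. sqrt ((f j)\<^sup>2 + (g j)\<^sup>2)) \<longlonglongrightarrow> sqrt (0\<^sup>2 + 0\<^sup>2)" by (intro tendsto_intros that)
    then show ?thesis by simp
  qed
  have "strict_mono R" using r by (simp add: R_def strict_mono_def)
  moreover have "(Q, Q) \<in> X" using sob_imp_H1(1)[OF Q Qm] by (simp add: X_def)
  \<comment> \<open>The constraint survives in the limit with the nonzero value -(p + 1)/2, which
    excludes the zero function.\<close>
  moreover have "\<not> (AE x in lborel. Q x = 0)"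
  proof
    assume "AE x in lborel. Q x = 0"
    then have "AE x in lborel. Q x * pow_p1 p (Q x) = 0" by eventually_elim simp
    then have "ip Q (\<lambda>x. pow_p1 p (Q x)) = 0" unfolding ip_def by (rule integral_eq_zero_AE)
    then show False using cQ pp by simp
  qed
  moreover have "X_tendsto (\<lambda>j. (translate (y j) (z (\<epsilon> (R j))), translate (y j) (w (\<epsilon> (R j))))) (Q, Q)"
    unfolding X_tendsto_def X_norm_def eR fst_conv snd_conv prod.case nZ nW by (intro norm0 cZ)
  moreover have "(\<lambda>j. H1_norm (\<lambda>x. translate (y j) (z (\<epsilon> (R j))) x - translate (y j) (w (\<epsilon> (R j))) x)) \<longlonglongrightarrow> 0"
    unfolding eR nd by (intro norm0 lim(3,4))
  moreover have "solves_limit_eq \<sigma> p Q"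
    unfolding solves_limit_eq_def
  proof (rule exI[of _ Q'], rule exI[of _ "\<lambda>x. (Q x + 2 * m / (p + 1) * pow_p1 p (Q x)) / \<gamma>"], intro conjI AE_I2)
    show "has_weak_deriv Q Q'" "has_weak_deriv Q' (\<lambda>x. (Q x + 2 * m / (p + 1) * pow_p1 p (Q x)) / \<gamma>)"
      by (rule sob_imp_has_weak_deriv[OF Q] sob_imp_has_weak_deriv[OF Q2])+
    fix x
    have "(1 / 3 - \<sigma>) * (t / \<gamma>) = - t" for t using gamma_pos by (simp add: field_simps)
    then have "(1 / 3 - \<sigma>) * ((Q x + 2 * m / (p + 1) * pow_p1 p (Q x)) / \<gamma>) = - (Q x + 2 * m / (p + 1) * pow_p1 p (Q x))" .
    then show "Q x + (1 / 3 - \<sigma>) * ((Q x + 2 * m / (p + 1) * pow_p1 p (Q x)) / \<gamma>) + 2 / (p + 1) * J0 \<sigma> p * pow_p1 p (Q x) = 0"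
      unfolding J0 by simp
  qed
  moreover have "rescaled_gKdV_travelling_wave \<sigma> p Q" by (rule profile_travelling_wave[OF dQ m])
  ultimately show ?thesis
    by (intro exI[of _ R] exI[of _ y] exI[of _ Q]) simp
qed

end
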